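(* Let $E$ be a Hausdorff locally convex space, $U\subseteq\mathbb R^n$ and $V\subseteq\mathbb R^m$ be open subsets, and $k,l\in\mathbb N_0\cup\{\infty\}$. Let $\mathcal W_1\subseteq C^k(U,[0,\infty))$ be a set of weights on $U$ such that (i) $\mathcal W_1$ satisfies the $o$-condition, (ii) for each $f\in\mathcal W_1$ and $\alpha\in\mathbb N_0^n$ with $|\alpha|\le k$ there exists $g\in\mathcal W_1$ such that $\left|\frac{\partial^\alpha}{\partial x^\alpha}f(x)\right|\le g(x)$ for all $x\in U$. Likewise, let $\mathcal W_2\subseteq C^l(V,[0,\infty))$ be a set of weights on $V$ which satisfies the $o$-condition and such that for each $f\in\mathcal W_2$ and $\beta\in\mathbb N_0^m$ with $|\beta|\le l$ there exists $g\in\mathcal W_2$ with $\left|\frac{\partial^\beta}{\partial y^\beta}f(y)\right|\le g(y)$ for all $y\in V$. Let $\mathcal W:=\mathcal W_1\otimes\mathcal W_2$. Then the linear map $$\Psi:C^k_{\mathcal W_1}(U,C^l_{\mathcal W_2}(V,E))\to C^{k,l}_{\mathcal W}(U\times V,E),\quad\gamma\mapsto\gamma^\wedge,$$ where $\gamma^\wedge(x,y):=\gamma(x)(y)$, is a homeomorphism.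
   Context: Topological vector spaces are over $\mathbb K\in\{\mathbb R,\mathbb C\}$; $\mathcal P_E$ is the set of all continuous seminorms on a locally convex space $E$; $\mathbb N_0=\{0,1,2,\dots\}$. For $U\subseteq\mathbb R^n$ open and $E$ Hausdorff locally convex, $C^k(U,E)$ is the space of continuous maps $\gamma:U\to E$ all of whose iterated partial derivatives $\frac{\partial^\alpha}{\partial x^\alpha}\gamma:U\to E$ with $|\alpha|\le k$ exist (as limits of difference quotients in $E$) and are continuous. $C^k(U,[0,\infty))$ denotes the real-valued $C^k$-functions with values in $[0,\infty)$. For open $V\subseteq\mathbb R^m$, $C^{k,l}(U\times V,E)$ is the space of maps $\gamma:U\times V\to E$ such that for all $\alpha\in\mathbb N_0^n$, $|\alpha|\le k$, and $\beta\in\mathbb N_0^m$, $|\beta|\le l$, the partial derivative $\frac{\partial^\alpha}{\partial x^\alpha}\frac{\partial^\beta}{\partial y^\beta}\gamma(x,y)$ exists in $E$ for all $(x,y)\in U\times V$ and is continuous in $(x,y)$. A set of weights on a Hausdorff space $X$ is a nonempty set $\mathcal W$ of functions $f:X\to[0,\infty)$ such that for each $x\in X$ there is $f_x\in\mathcal W$ with $f_x(x)>0$. For $f,g:X\to[0,\infty)$, $f=o(g)$ means: for each $\varepsilon>0$ there is a compact $K_\varepsilon\subseteq X$ with $f\le\varepsilon g$ on $X\setminus K_\varepsilon$. $\mathcal W$ satisfies the $o$-condition if for each $f\in\mathcal W$ there is $g\in\mathcal W$ with $f=o(g)$. $\mathcal W_1\otimes\mathcal W_2:=\{f_1\otimes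 f_2:f_i\in\mathcal W_i\}$, $(f_1\otimes f_2)(x,y):=f_1(x)f_2(y)$. $C^k_{\mathcal W}(U,E)$ is the space of all $\gamma\in C^k(U,E)$ with $\|\gamma\|_{f,\alpha,q}:=\sup_{x\in U}f(x)q(\frac{\partial^\alpha}{\partial x^\alpha}\gamma(x))<\infty$ for all $f\in\mathcal W$, $q\in\mathcal P_E$, $|\alpha|\le k$, with the (Hausdorff) locally convex topology given by these seminorms. $C^{k,l}_{\mathcal W_1\otimes\mathcal W_2}(U\times V,E)$ is the space of all $\gamma\in C^{k,l}(U\times V,E)$ with $\|\gamma\|_{f_1\otimes f_2,(\alpha,\beta),q}:=\sup_{(x,y)}f_1(x)f_2(y)q(\frac{\partial^\alpha}{\partial x^\alpha}\frac{\partial^\beta}{\partial y^\beta}\gamma(x,y))<\infty$ for all $f_1\in\mathcal W_1$, $f_2\in\mathcal W_2$, $q\in\mathcal P_E$, $|\alpha|\le k$, $|\beta|\le l$, with the locally convex topology given by these seminorms. *)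

theory Defs
  imports "HOL-Analysis.Analysis" "HOL-Library.Function_Algebras"
begin

text \<open>
  A space of maps on an open set \<open>U\<close> with values in \<open>E\<close> is to be used again as a range space,
  so topological vector spaces are not rendered by a type class. Such a space consists of a scalar
  multiplication and a topology on an additive group type; its underlying vector space is the
  \<^const>\<open>topspace\<close> of the topology. A map \<open>U \<rightarrow> E\<close> is represented by its extension by \<open>0\<close>
  outside \<open>U\<close>, with the pointwise vector operations of \<^theory>\<open>HOL-Library.Function_Algebras\<close>.

  The scalar field is a type of class \<^class>\<open>real_normed_field\<close>. By the Gelfand-Mazur theorem
  these are, up to isometric isomorphism, exactly the real and the complex numbers.
\<close>

type_synonym 'n rvec = "(real, 'n) vec"
type_synonym 'n multi_index = "(nat, 'n) vec"

record ('k, 'e) tvs =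
  tvs_scale :: "'k \<Rightarrow> 'e \<Rightarrow> 'e"
  tvs_topology :: "'e topology"

abbreviation tvs_carrier :: "('k, 'e) tvs \<Rightarrow> 'e set" where
  "tvs_carrier E \<equiv> topspace (tvs_topology E)"

definition tvs_convex :: "('k::real_normed_field, 'e::ab_group_add) tvs \<Rightarrow> 'e set \<Rightarrow> bool" where
  "tvs_convex E C \<longleftrightarrow>
     (\<forall>x\<in>C. \<forall>y\<in>C. \<forall>t\<in>{0..1}.
        tvs_scale E (of_real (1 - t)) x + tvs_scale E (of_real t) y \<in> C)"

definition hausdorff_lcs :: "('k::real_normed_field, 'e::ab_group_add) tvs \<Rightarrow> bool" where
  "hausdorff_lcs E \<longleftrightarrow>
     vector_space (tvs_scale E) \<and>
     module.subspace (tvs_scale E) (tvs_carrier E) \<and>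
     continuous_map (prod_topology (tvs_topology E) (tvs_topology E)) (tvs_topology E)
       (\<lambda>(x, y). x + y) \<and>
     continuous_map (prod_topology euclidean (tvs_topology E)) (tvs_topology E)
       (\<lambda>(c, x). tvs_scale E c x) \<and>
     Hausdorff_space (tvs_topology E) \<and>
     (\<forall>N. openin (tvs_topology E) N \<and> 0 \<in> N \<longrightarrow>
        (\<exists>C. openin (tvs_topology E) C \<and> 0 \<in> C \<and> C \<subseteq> N \<and> tvs_convex E C))"

text \<open>The values of a seminorm outside the underlying vector space are irrelevant.\<close>

definition continuous_seminorms ::
  "('k::real_normed_field, 'e::ab_group_add) tvs \<Rightarrow> ('e \<Rightarrow> real) set" where
  "continuous_seminorms E = {q.
     (\<forall>x\<in>tvs_carrier E. 0 \<le> q x) \<and>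
     (\<forall>x\<in>tvs_carrier E. \<forall>y\<in>tvs_carrier E. q (x + y) \<le> q x + q y) \<and>
     (\<forall>c. \<forall>x\<in>tvs_carrier E. q (tvs_scale E c x) = norm c * q x) \<and>
     continuous_map (tvs_topology E) euclidean q}"

definition real_tvs :: "(real, real) tvs" where
  "real_tvs = \<lparr>tvs_scale = (*), tvs_topology = euclidean\<rparr>"

definition has_pderiv ::
  "('k::real_normed_field, 'e::ab_group_add) tvs \<Rightarrow> 'n \<Rightarrow> (('n::finite) rvec \<Rightarrow> 'e) \<Rightarrow>
   'n rvec \<Rightarrow> 'e \<Rightarrow> bool" where
  "has_pderiv E i \<gamma> x d \<longleftrightarrow>
     limitin (tvs_topology E)
       (\<lambda>h::real. tvs_scale E (of_real (1 / h)) (\<gamma> (x + h *\<^sub>R axis i 1) - \<gamma> x)) d (at 0)"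

text \<open>The derivative is the unique limit; uniqueness holds when \<open>E\<close> is Hausdorff.\<close>

definition pderiv_on ::
  "('k::real_normed_field, 'e::ab_group_add) tvs \<Rightarrow> ('n::finite) rvec set \<Rightarrow> 'n \<Rightarrow>
   ('n rvec \<Rightarrow> 'e) \<Rightarrow> 'n rvec \<Rightarrow> 'e" where
  "pderiv_on E U i \<gamma> = (\<lambda>x. if x \<in> U then THE d. has_pderiv E i \<gamma> x d else 0)"

text \<open>In a list of coordinates, the last entry is the first one to be differentiated by.\<close>

primrec iter_pderiv ::
  "('k::real_normed_field, 'e::ab_group_add) tvs \<Rightarrow> ('n::finite) rvec set \<Rightarrow> 'n list \<Rightarrow>
   ('n rvec \<Rightarrow> 'e) \<Rightarrow> 'n rvec \<Rightarrow> 'e" where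
  "iter_pderiv E U [] \<gamma> = \<gamma>"
| "iter_pderiv E U (i # is) \<gamma> = pderiv_on E U i (iter_pderiv E U is \<gamma>)"

primrec iter_pderiv_exists ::
  "('k::real_normed_field, 'e::ab_group_add) tvs \<Rightarrow> ('n::finite) rvec set \<Rightarrow> 'n list \<Rightarrow>
   ('n rvec \<Rightarrow> 'e) \<Rightarrow> bool" where
  "iter_pderiv_exists E U [] \<gamma> \<longleftrightarrow> True"
| "iter_pderiv_exists E U (i # is) \<gamma> \<longleftrightarrow>
     iter_pderiv_exists E U is \<gamma> \<and> (\<forall>x\<in>U. \<exists>d. has_pderiv E i (iter_pderiv E U is \<gamma>) x d)"

definition mi_order :: "('n::finite) multi_index \<Rightarrow> nat" where
  "mi_order \<alpha> = (\<Sum>i\<in>UNIV. \<alpha> $ i)"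

text \<open>
  The linear order on the index type plays the role of the order of \<open>{1, \<dots>, n}\<close>, so that
  \<open>\<partial>\<^sup>\<alpha>\<close> differentiates \<open>\<alpha> $ i\<close> times by the \<open>i\<close>-th coordinate, the largest \<open>i\<close> first.
\<close>

definition mi_list :: "('n::{finite,linorder}) multi_index \<Rightarrow> 'n list" where
  "mi_list \<alpha> = concat (map (\<lambda>i. replicate (\<alpha> $ i) i) (sorted_list_of_set UNIV))"

definition partial_deriv ::
  "('k::real_normed_field, 'e::ab_group_add) tvs \<Rightarrow>
   ('n::{finite,linorder}) rvec set \<Rightarrow> 'n multi_index \<Rightarrow> ('n rvec \<Rightarrow> 'e) \<Rightarrow> 'n rvec \<Rightarrow> 'e" where
  "partial_deriv E U \<alpha> \<gamma> = iter_pderiv E U (mi_list \<alpha>) \<gamma>"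

definition partial_deriv_exists ::
  "('k::real_normed_field, 'e::ab_group_add) tvs \<Rightarrow>
   ('n::{finite,linorder}) rvec set \<Rightarrow> 'n multi_index \<Rightarrow> ('n rvec \<Rightarrow> 'e) \<Rightarrow> bool" where
  "partial_deriv_exists E U \<alpha> \<gamma> \<longleftrightarrow> iter_pderiv_exists E U (mi_list \<alpha>) \<gamma>"

definition partial_deriv2 ::
  "('k::real_normed_field, 'e::ab_group_add) tvs \<Rightarrow>
   ('n::{finite,linorder}) rvec set \<Rightarrow> ('m::{finite,linorder}) rvec set \<Rightarrow>
   'n multi_index \<Rightarrow> 'm multi_index \<Rightarrow> ('n rvec \<times> 'm rvec \<Rightarrow> 'e) \<Rightarrow> 'n rvec \<times> 'm rvec \<Rightarrow> 'e" where
  "partial_deriv2 E U V \<alpha> \<beta> \<gamma> =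
     (\<lambda>(x, y). partial_deriv E U \<alpha> (\<lambda>x'. partial_deriv E V \<beta> (\<lambda>y'. \<gamma> (x', y')) y) x)"

definition partial_deriv2_exists ::
  "('k::real_normed_field, 'e::ab_group_add) tvs \<Rightarrow>
   ('n::{finite,linorder}) rvec set \<Rightarrow> ('m::{finite,linorder}) rvec set \<Rightarrow>
   'n multi_index \<Rightarrow> 'm multi_index \<Rightarrow> ('n rvec \<times> 'm rvec \<Rightarrow> 'e) \<Rightarrow> bool" where
  "partial_deriv2_exists E U V \<alpha> \<beta> \<gamma> \<longleftrightarrow>
     (\<forall>x\<in>U. partial_deriv_exists E V \<beta> (\<lambda>y. \<gamma> (x, y))) \<and>
     (\<forall>y\<in>V. partial_deriv_exists E U \<alpha> (\<lambda>x. partial_deriv E V \<beta> (\<lambda>y'. \<gamma> (x, y')) y))"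

definition Ck ::
  "enat \<Rightarrow> ('n::{finite,linorder}) rvec set \<Rightarrow> ('k::real_normed_field, 'e::ab_group_add) tvs \<Rightarrow>
   ('n rvec \<Rightarrow> 'e) set" where
  "Ck k U E = {\<gamma>. (\<forall>x. x \<notin> U \<longrightarrow> \<gamma> x = 0) \<and>
     (\<forall>\<alpha>. enat (mi_order \<alpha>) \<le> k \<longrightarrow>
        partial_deriv_exists E U \<alpha> \<gamma> \<and>
        continuous_map (top_of_set U) (tvs_topology E) (partial_deriv E U \<alpha> \<gamma>))}"

definition Ckl ::
  "enat \<Rightarrow> enat \<Rightarrow> ('n::{finite,linorder}) rvec set \<Rightarrow> ('m::{finite,linorder}) rvec set \<Rightarrow>
   ('k::real_normed_field, 'e::ab_group_add) tvs \<Rightarrow> ('n rvec \<times> 'm rvec \<Rightarrow> 'e) set" where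
  "Ckl k l U V E = {\<gamma>. (\<forall>z. z \<notin> U \<times> V \<longrightarrow> \<gamma> z = 0) \<and>
     (\<forall>\<alpha> \<beta>. enat (mi_order \<alpha>) \<le> k \<and> enat (mi_order \<beta>) \<le> l \<longrightarrow>
        partial_deriv2_exists E U V \<alpha> \<beta> \<gamma> \<and>
        continuous_map (top_of_set (U \<times> V)) (tvs_topology E) (partial_deriv2 E U V \<alpha> \<beta> \<gamma>))}"

definition Ck_nonneg :: "enat \<Rightarrow> ('n::{finite,linorder}) rvec set \<Rightarrow> ('n rvec \<Rightarrow> real) set" where
  "Ck_nonneg k U = {f \<in> Ck k U real_tvs. \<forall>x\<in>U. 0 \<le> f x}"

definition set_of_weights :: "'a::t2_space set \<Rightarrow> ('a \<Rightarrow> real) set \<Rightarrow> bool" where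
  "set_of_weights X W \<longleftrightarrow>
     W \<noteq> {} \<and> (\<forall>f\<in>W. \<forall>x\<in>X. 0 \<le> f x) \<and> (\<forall>x\<in>X. \<exists>f\<in>W. f x > 0)"

definition weight_small_o :: "'a::t2_space set \<Rightarrow> ('a \<Rightarrow> real) \<Rightarrow> ('a \<Rightarrow> real) \<Rightarrow> bool" where
  "weight_small_o X f g \<longleftrightarrow>
     (\<forall>\<epsilon>>0. \<exists>K. compact K \<and> K \<subseteq> X \<and> (\<forall>x\<in>X - K. f x \<le> \<epsilon> * g x))"

definition o_condition :: "'a::t2_space set \<Rightarrow> ('a \<Rightarrow> real) set \<Rightarrow> bool" where
  "o_condition X W \<longleftrightarrow> (\<forall>f\<in>W. \<exists>g\<in>W. weight_small_o X f g)"

definition weights_tensor ::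
  "('a \<Rightarrow> real) set \<Rightarrow> ('b \<Rightarrow> real) set \<Rightarrow> ('a \<times> 'b \<Rightarrow> real) set" where
  "weights_tensor W1 W2 = {(\<lambda>(x, y). f1 x * f2 y) |f1 f2. f1 \<in> W1 \<and> f2 \<in> W2}"

text \<open>
  The topology on \<open>S\<close> defined by a family of seminorms, finite on \<open>S\<close>: the balls form a subbasis.
\<close>

definition seminorm_topology :: "'a::ab_group_add set \<Rightarrow> ('a \<Rightarrow> ennreal) set \<Rightarrow> 'a topology" where
  "seminorm_topology S P =
     topology_generated_by
       (insert S {{\<eta> \<in> S. p (\<eta> - \<gamma>) < ennreal r} |p \<gamma> r. p \<in> P \<and> \<gamma> \<in> S \<and> 0 < r})"

text \<open>Suprema are formed in \<open>[0, \<infinity>]\<close>; in particular they are \<open>0\<close> over the empty set.\<close>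

definition wnorm ::
  "('n::{finite,linorder}) rvec set \<Rightarrow> ('k::real_normed_field, 'e::ab_group_add) tvs \<Rightarrow>
   ('n rvec \<Rightarrow> real) \<Rightarrow> 'n multi_index \<Rightarrow> ('e \<Rightarrow> real) \<Rightarrow> ('n rvec \<Rightarrow> 'e) \<Rightarrow> ennreal" where
  "wnorm U E f \<alpha> q \<gamma> = (SUP x\<in>U. ennreal (f x * q (partial_deriv E U \<alpha> \<gamma> x)))"

definition CkW_seminorms ::
  "enat \<Rightarrow> (('n::{finite,linorder}) rvec \<Rightarrow> real) set \<Rightarrow> 'n rvec set \<Rightarrow>
   ('k::real_normed_field, 'e::ab_group_add) tvs \<Rightarrow> (('n rvec \<Rightarrow> 'e) \<Rightarrow> ennreal) set" where
  "CkW_seminorms k W U E =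
     {wnorm U E f \<alpha> q |f \<alpha> q. f \<in> W \<and> q \<in> continuous_seminorms E \<and> enat (mi_order \<alpha>) \<le> k}"

definition CkW ::
  "enat \<Rightarrow> (('n::{finite,linorder}) rvec \<Rightarrow> real) set \<Rightarrow> 'n rvec set \<Rightarrow>
   ('k::real_normed_field, 'e::ab_group_add) tvs \<Rightarrow> ('k, 'n rvec \<Rightarrow> 'e) tvs" where
  "CkW k W U E =
     \<lparr>tvs_scale = (\<lambda>c \<gamma> x. tvs_scale E c (\<gamma> x)),
      tvs_topology =
        seminorm_topology {\<gamma> \<in> Ck k U E. \<forall>p\<in>CkW_seminorms k W U E. p \<gamma> < \<infinity>}
          (CkW_seminorms k W U E)\<rparr>"

definition wnorm2 ::
  "('n::{finite,linorder}) rvec set \<Rightarrow> ('m::{finite,linorder}) rvec set \<Rightarrow>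
   ('k::real_normed_field, 'e::ab_group_add) tvs \<Rightarrow>
   ('n rvec \<times> 'm rvec \<Rightarrow> real) \<Rightarrow> 'n multi_index \<Rightarrow> 'm multi_index \<Rightarrow> ('e \<Rightarrow> real) \<Rightarrow>
   ('n rvec \<times> 'm rvec \<Rightarrow> 'e) \<Rightarrow> ennreal" where
  "wnorm2 U V E f \<alpha> \<beta> q \<gamma> =
     (SUP z\<in>U \<times> V. ennreal (f z * q (partial_deriv2 E U V \<alpha> \<beta> \<gamma> z)))"

definition CklW_seminorms ::
  "enat \<Rightarrow> enat \<Rightarrow> (('n::{finite,linorder}) rvec \<times> ('m::{finite,linorder}) rvec \<Rightarrow> real) set \<Rightarrow>
   'n rvec set \<Rightarrow> 'm rvec set \<Rightarrow> ('k::real_normed_field, 'e::ab_group_add) tvs \<Rightarrow>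
   (('n rvec \<times> 'm rvec \<Rightarrow> 'e) \<Rightarrow> ennreal) set" where
  "CklW_seminorms k l W U V E =
     {wnorm2 U V E f \<alpha> \<beta> q |f \<alpha> \<beta> q. f \<in> W \<and> q \<in> continuous_seminorms E \<and>
        enat (mi_order \<alpha>) \<le> k \<and> enat (mi_order \<beta>) \<le> l}"

definition CklW ::
  "enat \<Rightarrow> enat \<Rightarrow> (('n::{finite,linorder}) rvec \<times> ('m::{finite,linorder}) rvec \<Rightarrow> real) set \<Rightarrow>
   'n rvec set \<Rightarrow> 'm rvec set \<Rightarrow> ('k::real_normed_field, 'e::ab_group_add) tvs \<Rightarrow>
   ('k, 'n rvec \<times> 'm rvec \<Rightarrow> 'e) tvs" where
  "CklW k l W U V E =
     \<lparr>tvs_scale = (\<lambda>c \<gamma> z. tvs_scale E c (\<gamma> z)),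
      tvs_topology =
        seminorm_topology {\<gamma> \<in> Ckl k l U V E. \<forall>p\<in>CklW_seminorms k l W U V E. p \<gamma> < \<infinity>}
          (CklW_seminorms k l W U V E)\<rparr>"

end

theory Submission imports Defs begin

text \<open>
  Write \<open>F\<close> for the weighted space \<open>C\<^sup>l\<close> over \<open>V\<close>, and \<open>\<Psi>\<close> for \<open>\<gamma> \<mapsto> \<gamma>\<^sup>\<and>\<close>. The theorem says that
  \<open>\<Psi>\<close> matches iterated derivatives with iterated derivatives, and seminorms with seminorms.

  \<^item> Derivatives at a point \<open>y\<close> are continuous linear maps \<open>F \<rightarrow> E\<close>, since some weight is positive
    at \<open>y\<close>. They therefore commute with the partial derivatives of an \<open>F\<close>-valued map \<open>\<gamma>\<close>, so that
    \<open>\<partial>\<^sup>\<alpha>\<partial>\<^sup>\<beta>\<gamma>\<^sup>\<and>(x, y)\<close> is the \<open>\<beta>\<close>-derivative of \<open>\<partial>\<^sup>\<alpha>\<gamma>(x)\<close> at \<open>y\<close> (\<open>iter_pderiv2_uncurry\<close>). A supremum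
    over \<open>U \<times> V\<close> is an iterated supremum, so the seminorm of \<open>\<gamma>\<^sup>\<and>\<close> belonging to \<open>f\<^sub>1 \<otimes> f\<^sub>2\<close>, \<open>(\<alpha>, \<beta>)\<close> and
    \<open>q\<close> equals the seminorm of \<open>\<gamma>\<close> belonging to \<open>f\<^sub>1\<close>, \<open>\<alpha>\<close> and the seminorm of \<open>F\<close> given by
    \<open>f\<^sub>2\<close>, \<open>\<beta>\<close> and \<open>q\<close> (\<open>weighted_sup_uncurry\<close>). Every continuous seminorm on \<open>F\<close> is dominated by
    finitely many of the latter kind. Hence \<open>\<Psi>\<close> is a linear topological embedding.

  \<^item> For surjectivity let \<open>\<delta>\<close> belong to the target. The candidate for \<open>\<partial>\<^sup>\<alpha>\<close> of the curried map at \<open>x\<close>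
    is \<open>\<partial>\<^sup>\<alpha>\<delta>(x, \<cdot>)\<close>. By Schwarz's theorem it is a \<open>C\<^sup>l\<close>-map on \<open>V\<close> with the expected derivatives, and
    the seminorms of \<open>\<delta>\<close> show that it lies in \<open>F\<close>. It depends continuously on \<open>x\<close>, as a map
    into \<open>F\<close>: the \<open>o\<close>-condition over \<open>V\<close> makes the weighted differences uniformly small
    off a compact set, and on the compact set continuity suffices
    (\<open>locally_uniform_continuity\<close>). The mean value inequality upgrades this uniform continuity of the
    next derivative to convergence of the difference quotients in \<open>F\<close> (\<open>slice_has_pderiv\<close>).

  The analysis takes place in locally convex spaces that need not be complete. The mean value
  inequality is proved for one continuous seminorm at a time by bisection
  (\<open>mean_value_interval\<close>), and Schwarz's theorem follows from it
  (\<open>mixed_derivatives_commute\<close>). The continuous seminorms determine the topology of \<open>E\<close> because of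
  Minkowski functionals (\<open>minkowski_csn\<close>); for the function spaces they are controlled by
  the family that defines the topology (\<open>csn_dominated\<close>).
\<close>

section \<open>Locally convex spaces described by their continuous seminorms\<close>

lemma continuous_seminormsI:
  assumes "\<And>x. x \<in> tvs_carrier E \<Longrightarrow> 0 \<le> q x"
    and "\<And>x y. x \<in> tvs_carrier E \<Longrightarrow> y \<in> tvs_carrier E \<Longrightarrow> q (x + y) \<le> q x + q y"
    and "\<And>c x. x \<in> tvs_carrier E \<Longrightarrow> q (tvs_scale E c x) = norm c * q x"
    and "continuous_map (tvs_topology E) euclidean q"
  shows "q \<in> continuous_seminorms E"
  using assms unfolding continuous_seminorms_def by blast

text \<open>
  A common interface to the three kinds of spaces in play: the given space \<open>E\<close>, the weighted
  function space over \<open>V\<close> that is used again as a range, and the two spaces to be compared. All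
  that analysis in such a space needs is that the continuous seminorms generate the topology and
  separate points.
\<close>

locale seminormed_tvs = vector_space "tvs_scale E"
  for E :: "('k::real_normed_field, 'e::ab_group_add) tvs" +
  assumes carrier_subspace: "subspace (tvs_carrier E)"
    and ball_open: "\<And>q x r. q \<in> continuous_seminorms E \<Longrightarrow> x \<in> tvs_carrier E \<Longrightarrow>
      openin (tvs_topology E) {y \<in> tvs_carrier E. q (y - x) < r}"
    and ball_basis: "\<And>N x. openin (tvs_topology E) N \<Longrightarrow> x \<in> N \<Longrightarrow>
      \<exists>q\<in>continuous_seminorms E. \<exists>r>0. {y \<in> tvs_carrier E. q (y - x) < r} \<subseteq> N"
    and separating: "\<And>x. x \<in> tvs_carrier E \<Longrightarrow> x \<noteq> 0 \<Longrightarrow> \<exists>q\<in>continuous_seminorms E. q x \<noteq> 0"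
begin

lemma carrier_closed [simp, intro]:
  shows "0 \<in> tvs_carrier E"
    and "x \<in> tvs_carrier E \<Longrightarrow> y \<in> tvs_carrier E \<Longrightarrow> x + y \<in> tvs_carrier E"
    and "x \<in> tvs_carrier E \<Longrightarrow> y \<in> tvs_carrier E \<Longrightarrow> x - y \<in> tvs_carrier E"
    and "x \<in> tvs_carrier E \<Longrightarrow> - x \<in> tvs_carrier E"
    and "x \<in> tvs_carrier E \<Longrightarrow> tvs_scale E c x \<in> tvs_carrier E"
  by (simp_all add: carrier_subspace subspace_0 subspace_add subspace_diff subspace_neg subspace_scale)

context
  fixes q assumes q: "q \<in> continuous_seminorms E"
begin

lemma csn_nonneg: "x \<in> tvs_carrier E \<Longrightarrow> 0 \<le> q x"
  and csn_triangle: "x \<in> tvs_carrier E \<Longrightarrow> y \<in> tvs_carrier E \<Longrightarrow> q (x + y) \<le> q x + q y"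
  and csn_scale: "x \<in> tvs_carrier E \<Longrightarrow> q (tvs_scale E c x) = norm c * q x"
  and csn_continuous: "continuous_map (tvs_topology E) euclidean q"
  using q unfolding continuous_seminorms_def by blast+

lemma csn_zero: "q 0 = 0"
  using csn_scale[of 0 0] by simp

lemma csn_minus: "x \<in> tvs_carrier E \<Longrightarrow> q (- x) = q x"
  using csn_scale[of x "-1"] by simp

lemma csn_commute: "x \<in> tvs_carrier E \<Longrightarrow> y \<in> tvs_carrier E \<Longrightarrow> q (x - y) = q (y - x)"
  using csn_minus[of "x - y"] by simp

lemma csn_triangle_diff:
  assumes "x \<in> tvs_carrier E" "y \<in> tvs_carrier E" "z \<in> tvs_carrier E"
  shows "q (x - z) \<le> q (x - y) + q (y - z)"
  using csn_triangle[of "x - y" "y - z"] assms by simp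

lemma csn_triangle_minus:
  assumes "x \<in> tvs_carrier E" "y \<in> tvs_carrier E"
  shows "q (x - y) \<le> q x + q y"
  using csn_triangle_diff[of x 0 y] csn_minus[of y] assms by simp

end

lemma atin_euclidean: "a \<in> A \<Longrightarrow> atin (top_of_set A) a = at a within A"
  by (simp add: filter_eq_iff atin_subtopology_within eventually_atin_within eventually_at_topological)
    blast

lemma limitinD:
  assumes "limitin (tvs_topology E) f l F" "q \<in> continuous_seminorms E" "0 < e"
  shows "\<forall>\<^sub>F h in F. f h \<in> tvs_carrier E \<and> q (f h - l) < e"
proof -
  have l: "l \<in> tvs_carrier E" using assms(1) by (simp add: limitin_def)
  have "openin (tvs_topology E) {y \<in> tvs_carrier E. q (y - l) < e}"
    by (rule ball_open[OF assms(2) l])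
  moreover have "l \<in> {y \<in> tvs_carrier E. q (y - l) < e}" using l assms by (simp add: csn_zero)
  ultimately have "\<forall>\<^sub>F h in F. f h \<in> {y \<in> tvs_carrier E. q (y - l) < e}"
    using assms(1) unfolding limitin_def by blast
  then show ?thesis by (rule eventually_mono) simp
qed

lemma limitin_carrier: "limitin (tvs_topology E) f l F \<Longrightarrow> \<forall>\<^sub>F h in F. f h \<in> tvs_carrier E"
  unfolding limitin_def by (auto dest: spec[of _ "tvs_carrier E"])

lemma limitin_iff:
  assumes f: "\<forall>\<^sub>F h in F. f h \<in> tvs_carrier E"
  shows "limitin (tvs_topology E) f l F \<longleftrightarrow>
    l \<in> tvs_carrier E \<and> (\<forall>q\<in>continuous_seminorms E. \<forall>e>0. \<forall>\<^sub>F h in F. q (f h - l) < e)"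
    (is "?lhs \<longleftrightarrow> ?rhs")
proof
  assume L: ?lhs
  then have l: "l \<in> tvs_carrier E" by (simp add: limitin_def)
  show ?rhs
  proof (intro conjI l ballI allI impI)
    fix q e assume "q \<in> continuous_seminorms E" "(0::real) < e"
    from limitinD[OF L this] show "\<forall>\<^sub>F h in F. q (f h - l) < e" by (rule eventually_mono) simp
  qed
next
  assume R: ?rhs
  show ?lhs
    unfolding limitin_def
  proof (intro conjI allI impI)
    show "l \<in> tvs_carrier E" using R by blast
    fix N assume "openin (tvs_topology E) N \<and> l \<in> N"
    then obtain q r where q: "q \<in> continuous_seminorms E" and r: "0 < r"
      and N: "{y \<in> tvs_carrier E. q (y - l) < r} \<subseteq> N"
      using ball_basis by meson
    have "\<forall>\<^sub>F h in F. q (f h - l) < r" using R q r by blast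
    then show "\<forall>\<^sub>F h in F. f h \<in> N" using f by eventually_elim (use N in blast)
  qed
qed

lemma limitin_add:
  assumes f: "limitin (tvs_topology E) f l F" and g: "limitin (tvs_topology E) g m F"
  shows "limitin (tvs_topology E) (\<lambda>h. f h + g h) (l + m) F"
proof (subst limitin_iff)
  have lm: "l \<in> tvs_carrier E" "m \<in> tvs_carrier E" using assms by (simp_all add: limitin_def)
  show "\<forall>\<^sub>F h in F. f h + g h \<in> tvs_carrier E"
    using limitin_carrier[OF f] limitin_carrier[OF g] by eventually_elim simp
  show "l + m \<in> tvs_carrier E \<and>
      (\<forall>q\<in>continuous_seminorms E. \<forall>e>0. \<forall>\<^sub>F h in F. q (f h + g h - (l + m)) < e)"
  proof (intro conjI ballI allI impI)
    fix q e assume q: "q \<in> continuous_seminorms E" and e: "(0::real) < e"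
    show "\<forall>\<^sub>F h in F. q (f h + g h - (l + m)) < e"
      using limitinD[OF f q half_gt_zero[OF e]] limitinD[OF g q half_gt_zero[OF e]]
    proof eventually_elim
      case (elim h)
      then have "q ((f h - l) + (g h - m)) \<le> q (f h - l) + q (g h - m)"
        using lm by (intro csn_triangle[OF q]) auto
      then show ?case using elim by (simp add: algebra_simps)
    qed
  qed (use lm in simp)
qed

lemma limitin_scale:
  assumes f: "limitin (tvs_topology E) f l F"
  shows "limitin (tvs_topology E) (\<lambda>h. tvs_scale E c (f h)) (tvs_scale E c l) F"
proof (subst limitin_iff)
  have l: "l \<in> tvs_carrier E" using assms by (simp add: limitin_def)
  show "\<forall>\<^sub>F h in F. tvs_scale E c (f h) \<in> tvs_carrier E"
    using limitin_carrier[OF f] by eventually_elim simp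
  show "tvs_scale E c l \<in> tvs_carrier E \<and>
      (\<forall>q\<in>continuous_seminorms E. \<forall>e>0. \<forall>\<^sub>F h in F. q (tvs_scale E c (f h) - tvs_scale E c l) < e)"
  proof (intro conjI ballI allI impI)
    fix q e assume q: "q \<in> continuous_seminorms E" and e: "(0::real) < e"
    have pos: "0 < norm c + 1" by (simp add: add_nonneg_pos)
    have "0 < e / (norm c + 1)" using e pos by simp
    from limitinD[OF f q this] show "\<forall>\<^sub>F h in F. q (tvs_scale E c (f h) - tvs_scale E c l) < e"
    proof eventually_elim
      case (elim h)
      have "q (tvs_scale E c (f h) - tvs_scale E c l) = norm c * q (f h - l)"
        using csn_scale[OF q, of "f h - l" c] elim l by (simp add: scale_right_diff_distrib)
      also have "\<dots> \<le> (norm c + 1) * q (f h - l)"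
        using csn_nonneg[OF q, of "f h - l"] elim l by (simp add: mult_right_mono)
      also have "\<dots> < e" using elim pos by (simp add: field_simps)
      finally show ?case .
    qed
  qed (use l in simp)
qed

lemma continuous_map_limitin:
  "continuous_map (top_of_set A) (tvs_topology E) f \<longleftrightarrow>
    (\<forall>x\<in>A. f x \<in> tvs_carrier E) \<and> (\<forall>a\<in>A. limitin (tvs_topology E) f (f a) (at a within A))"
  unfolding continuous_map_atin by (auto simp: atin_euclidean limitin_def)

lemma continuous_map_iff:
  "continuous_map (top_of_set A) (tvs_topology E) f \<longleftrightarrow>
    (\<forall>x\<in>A. f x \<in> tvs_carrier E) \<and>
    (\<forall>a\<in>A. \<forall>q\<in>continuous_seminorms E. \<forall>e>0. \<forall>\<^sub>F x in at a within A. q (f x - f a) < e)"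
proof -
  have "\<forall>\<^sub>F x in at a within A. f x \<in> tvs_carrier E" if "\<forall>x\<in>A. f x \<in> tvs_carrier E" for a
    using that by (auto simp: eventually_at_filter)
  from limitin_iff[OF this] show ?thesis unfolding continuous_map_limitin by blast
qed

lemma continuous_map_in_carrier:
  "continuous_map (top_of_set A) (tvs_topology E) f \<Longrightarrow> x \<in> A \<Longrightarrow> f x \<in> tvs_carrier E"
  by (simp add: continuous_map_iff)

lemma continuous_map_csnD:
  "continuous_map (top_of_set A) (tvs_topology E) f \<Longrightarrow> a \<in> A \<Longrightarrow> q \<in> continuous_seminorms E \<Longrightarrow>
    0 < e \<Longrightarrow> \<forall>\<^sub>F x in at a within A. q (f x - f a) < e"
  by (simp add: continuous_map_iff)

lemma continuous_map_add:
  assumes "continuous_map (top_of_set A) (tvs_topology E) f"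
    and "continuous_map (top_of_set A) (tvs_topology E) g"
  shows "continuous_map (top_of_set A) (tvs_topology E) (\<lambda>x. f x + g x)"
  using assms unfolding continuous_map_limitin by (simp add: limitin_add)

lemma continuous_map_scale:
  assumes "continuous_map (top_of_set A) (tvs_topology E) f"
  shows "continuous_map (top_of_set A) (tvs_topology E) (\<lambda>x. tvs_scale E c (f x))"
  using assms unfolding continuous_map_limitin by (simp add: limitin_scale)

lemma continuous_map_diff:
  assumes "continuous_map (top_of_set A) (tvs_topology E) f"
    and "continuous_map (top_of_set A) (tvs_topology E) g"
  shows "continuous_map (top_of_set A) (tvs_topology E) (\<lambda>x. f x - g x)"
  using continuous_map_add[OF assms(1) continuous_map_scale[OF assms(2), of "-1"]] by simp

lemma continuous_on_csn:
  assumes "continuous_map (top_of_set A) (tvs_topology E) f" "q \<in> continuous_seminorms E"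
  shows "continuous_on A (\<lambda>x. q (f x))"
  using continuous_map_compose[OF assms(1) csn_continuous[OF assms(2)]] by (simp add: o_def)

end

section \<open>The topology generated by a family of seminorms\<close>

text \<open>
  The seminorms are \<open>[0, \<infinity>]\<close>-valued, as suprema are, and finite on the subspace \<open>S\<close>. All estimates
  are made with their real values \<open>real_p p\<close>.
\<close>

locale seminorm_family = vector_space scl
  for scl :: "'k::real_normed_field \<Rightarrow> 'a::ab_group_add \<Rightarrow> 'a" +
  fixes S :: "'a set" and P :: "('a \<Rightarrow> ennreal) set"
  assumes subspace: "subspace S"
    and finite_on: "\<And>p x. p \<in> P \<Longrightarrow> x \<in> S \<Longrightarrow> p x < \<infinity>"
    and triangle: "\<And>p x y. p \<in> P \<Longrightarrow> x \<in> S \<Longrightarrow> y \<in> S \<Longrightarrow> p (x + y) \<le> p x + p y"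
    and homogeneous: "\<And>p c x. p \<in> P \<Longrightarrow> x \<in> S \<Longrightarrow> p (scl c x) = ennreal (norm c) * p x"
    and separates: "\<And>x. x \<in> S \<Longrightarrow> x \<noteq> 0 \<Longrightarrow> \<exists>p\<in>P. p x \<noteq> 0"
begin

abbreviation space :: "('k, 'a) tvs" where
  "space \<equiv> \<lparr>tvs_scale = scl, tvs_topology = seminorm_topology S P\<rparr>"

abbreviation real_p :: "('a \<Rightarrow> ennreal) \<Rightarrow> 'a \<Rightarrow> real" where
  "real_p p x \<equiv> enn2real (p x)"

lemma topspace_eq [simp]: "topspace (seminorm_topology S P) = S"
  unfolding seminorm_topology_def topology_generated_by_topspace by auto

lemma S_closed [simp, intro]:
  shows "0 \<in> S"
    and "x \<in> S \<Longrightarrow> y \<in> S \<Longrightarrow> x + y \<in> S"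
    and "x \<in> S \<Longrightarrow> y \<in> S \<Longrightarrow> x - y \<in> S"
    and "x \<in> S \<Longrightarrow> - x \<in> S"
    and "x \<in> S \<Longrightarrow> scl c x \<in> S"
  by (simp_all add: subspace subspace_0 subspace_add subspace_diff subspace_neg subspace_scale)

lemma less_ennreal_iff: "p \<in> P \<Longrightarrow> x \<in> S \<Longrightarrow> 0 < r \<Longrightarrow> p x < ennreal r \<longleftrightarrow> real_p p x < r"
  using finite_on[of p x] by (cases "p x") (auto simp: ennreal_less_iff)

lemma real_p_triangle: "p \<in> P \<Longrightarrow> x \<in> S \<Longrightarrow> y \<in> S \<Longrightarrow> real_p p (x + y) \<le> real_p p x + real_p p y"
  using triangle[of p x y] finite_on[of p x] finite_on[of p y]
  by (metis enn2real_mono enn2real_plus ennreal_add_less_top infinity_ennreal_def)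

lemma real_p_scale: "p \<in> P \<Longrightarrow> x \<in> S \<Longrightarrow> real_p p (scl c x) = norm c * real_p p x"
  using homogeneous[of p x c] by (simp add: enn2real_mult)

lemma real_p_triangle_diff:
  "p \<in> P \<Longrightarrow> x \<in> S \<Longrightarrow> y \<in> S \<Longrightarrow> z \<in> S \<Longrightarrow> real_p p (x - z) \<le> real_p p (x - y) + real_p p (y - z)"
  using real_p_triangle[of p "x - y" "y - z"] by simp

lemma real_p_zero: "p \<in> P \<Longrightarrow> real_p p 0 = 0"
  using real_p_scale[of p 0 0] by simp

text \<open>
  In the subbasis the balls have arbitrary centres. By the triangle inequality a ball around \<open>\<gamma>\<close>
  contains one around each of its points, so finite sets of balls around the point suffice.
\<close>

lemma openin_iff:
  "openin (seminorm_topology S P) N \<longleftrightarrow> N \<subseteq> S \<and>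
    (\<forall>x\<in>N. \<exists>A r. finite A \<and> A \<subseteq> P \<and> 0 < r \<and> {y \<in> S. \<forall>p\<in>A. real_p p (y - x) < r} \<subseteq> N)"
    (is "?lhs \<longleftrightarrow> N \<subseteq> S \<and> ?R N")
proof (intro iffI conjI)
  assume L: ?lhs
  then show "N \<subseteq> S" using openin_subset by fastforce
  have "generate_topology_on
      (insert S {{\<eta> \<in> S. p (\<eta> - \<gamma>) < ennreal r} |p \<gamma> r. p \<in> P \<and> \<gamma> \<in> S \<and> 0 < r}) N"
    using L by (simp add: seminorm_topology_def openin_topology_generated_by_iff)
  then show "?R N"
  proof induction
    case Empty
    show ?case by simp
  next
    case (Int a b)
    show ?case
    proof
      fix x assume x: "x \<in> a \<inter> b"
      obtain A r where A: "finite A" "A \<subseteq> P" "0 < r" "{y \<in> S. \<forall>p\<in>A. real_p p (y - x) < r} \<subseteq> a"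
        using Int.IH(1) x by (meson IntD1)
      obtain B s where B: "finite B" "B \<subseteq> P" "0 < s" "{y \<in> S. \<forall>p\<in>B. real_p p (y - x) < s} \<subseteq> b"
        using Int.IH(2) x by (meson IntD2)
      have "{y \<in> S. \<forall>p\<in>A \<union> B. real_p p (y - x) < min r s} \<subseteq> a \<inter> b"
        using A(4) B(4) by auto
      then show "\<exists>A r. finite A \<and> A \<subseteq> P \<and> 0 < r \<and>
          {y \<in> S. \<forall>p\<in>A. real_p p (y - x) < r} \<subseteq> a \<inter> b"
        using A B by (intro exI[of _ "A \<union> B"] exI[of _ "min r s"]) simp
    qed
  next
    case (UN K)
    show ?case
    proof
      fix x assume "x \<in> \<Union>K"
      then obtain k where k: "k \<in> K" "x \<in> k" by blast
      then obtain A r where "finite A" "A \<subseteq> P" "0 < r" "{y \<in> S. \<forall>p\<in>A. real_p p (y - x) < r} \<subseteq> k"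
        using UN.IH by meson
      then show "\<exists>A r. finite A \<and> A \<subseteq> P \<and> 0 < r \<and>
          {y \<in> S. \<forall>p\<in>A. real_p p (y - x) < r} \<subseteq> \<Union>K"
        using k(1) by (meson Union_upper order_trans)
    qed
  next
    case (Basis s)
    show ?case
    proof
      fix x assume x: "x \<in> s"
      show "\<exists>A r. finite A \<and> A \<subseteq> P \<and> 0 < r \<and> {y \<in> S. \<forall>p\<in>A. real_p p (y - x) < r} \<subseteq> s"
      proof (cases "s = S")
        case True
        then show ?thesis by (intro exI[of _ "{}"] exI[of _ 1]) auto
      next
        case False
        then obtain p \<gamma> r where s: "s = {\<eta> \<in> S. p (\<eta> - \<gamma>) < ennreal r}"
          and p: "p \<in> P" and \<gamma>: "\<gamma> \<in> S" and r: "0 < r"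
          using Basis by auto
        have xS: "x \<in> S" and xr: "real_p p (x - \<gamma>) < r"
          using x s p \<gamma> r less_ennreal_iff[OF p _ r, of "x - \<gamma>"] by auto
        have "{y \<in> S. \<forall>p'\<in>{p}. real_p p' (y - x) < r - real_p p (x - \<gamma>)} \<subseteq> s"
        proof
          fix y assume "y \<in> {y \<in> S. \<forall>p'\<in>{p}. real_p p' (y - x) < r - real_p p (x - \<gamma>)}"
          then have y: "y \<in> S" and "real_p p (y - x) < r - real_p p (x - \<gamma>)" by auto
          then have "real_p p (y - \<gamma>) < r" using real_p_triangle_diff[OF p y xS \<gamma>] by linarith
          then show "y \<in> s" using s y less_ennreal_iff[OF p _ r, of "y - \<gamma>"] \<gamma> by simp
        qed
        then show ?thesis using p xr by (intro exI[of _ "{p}"] exI[of _ "r - real_p p (x - \<gamma>)"]) auto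
      qed
    qed
  qed
next
  assume R: "N \<subseteq> S \<and> ?R N"
  have "openin (seminorm_topology S P) {y \<in> S. \<forall>p\<in>A. real_p p (y - x) < r}"
    if "finite A" "A \<subseteq> P" "x \<in> S" "0 < r" for A x r
  proof -
    have eq: "{y \<in> S. \<forall>p\<in>A. real_p p (y - x) < r} =
        \<Inter>(insert S ((\<lambda>p. {y \<in> S. p (y - x) < ennreal r}) ` A))"
      using that less_ennreal_iff[OF _ _ that(4)] by (auto simp: subset_iff)
    have "openin (seminorm_topology S P) B"
      if B: "B \<in> insert S ((\<lambda>p. {y \<in> S. p (y - x) < ennreal r}) ` A)" for B
    proof -
      have "B \<in> insert S {{\<eta> \<in> S. p (\<eta> - \<gamma>) < ennreal r} |p \<gamma> r. p \<in> P \<and> \<gamma> \<in> S \<and> 0 < r}"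
        using B \<open>A \<subseteq> P\<close> \<open>x \<in> S\<close> \<open>0 < r\<close> by blast
      then show ?thesis unfolding seminorm_topology_def by (rule topology_generated_by_Basis)
    qed
    then show ?thesis unfolding eq using \<open>finite A\<close> by (intro openin_Inter) auto
  qed
  note ball = this
  show ?lhs
  proof (subst openin_subopen, intro ballI)
    fix x assume x: "x \<in> N"
    then obtain A r where A: "finite A" "A \<subseteq> P" "0 < r"
      and sub: "{y \<in> S. \<forall>p\<in>A. real_p p (y - x) < r} \<subseteq> N"
      using R by meson
    have "x \<in> S" using R x by blast
    moreover have "x \<in> {y \<in> S. \<forall>p\<in>A. real_p p (y - x) < r}"
      using A \<open>x \<in> S\<close> real_p_zero by auto
    ultimately show "\<exists>T. openin (seminorm_topology S P) T \<and> x \<in> T \<and> T \<subseteq> N"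
      using ball[OF A(1,2) _ A(3)] sub by blast
  qed
qed

lemma dominated_continuous:
  assumes nonneg: "\<And>x. x \<in> S \<Longrightarrow> 0 \<le> q x"
    and tri: "\<And>x y. x \<in> S \<Longrightarrow> y \<in> S \<Longrightarrow> q (x + y) \<le> q x + q y"
    and sc: "\<And>c x. x \<in> S \<Longrightarrow> q (scl c x) = norm c * q x"
    and A: "finite A" "A \<subseteq> P" and C: "0 \<le> C"
    and dom: "\<And>x. x \<in> S \<Longrightarrow> q x \<le> C * (\<Sum>p\<in>A. real_p p x)"
  shows "x \<in> S \<Longrightarrow> openin (seminorm_topology S P) {y \<in> S. q (y - x) < r}"
    and "q \<in> continuous_seminorms space"
proof -
  have close: "\<exists>d>0. \<forall>y\<in>S. (\<forall>p\<in>A. real_p p (y - z) < d) \<longrightarrow> q (y - z) < e"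
    if z: "z \<in> S" and e: "0 < e" for z e
  proof -
    (* The summand 1 keeps n positive when C or A vanishes. *)
    define n where "n = C * real (card A) + 1"
    have n: "0 < n" using C by (simp add: n_def add_nonneg_pos)
    show ?thesis
    proof (intro exI[of _ "e / n"] conjI ballI impI)
      show "0 < e / n" using e n by simp
      fix y assume y: "y \<in> S" and *: "\<forall>p\<in>A. real_p p (y - z) < e / n"
      have "q (y - z) \<le> C * (\<Sum>p\<in>A. real_p p (y - z))" using dom y z by simp
      also have "\<dots> \<le> C * (\<Sum>p\<in>A. e / n)"
        using * C by (intro mult_left_mono sum_mono) auto
      also have "\<dots> = C * real (card A) * (e / n)" by simp
      also have "\<dots> < n * (e / n)" using e n by (intro mult_strict_right_mono) (auto simp: n_def)
      finally show "q (y - z) < e" using n by simp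
    qed
  qed
  have diff: "q (x - z) \<le> q (x - y) + q (y - z)" if "x \<in> S" "y \<in> S" "z \<in> S" for x y z
    using tri[of "x - y" "y - z"] that by simp
  show ball: "openin (seminorm_topology S P) {y \<in> S. q (y - x) < r}" if x: "x \<in> S" for x r
    unfolding openin_iff
  proof (intro conjI ballI)
    fix z assume "z \<in> {y \<in> S. q (y - x) < r}"
    then have z: "z \<in> S" "0 < r - q (z - x)" by auto
    then obtain d where d: "d > 0" "\<forall>y\<in>S. (\<forall>p\<in>A. real_p p (y - z) < d) \<longrightarrow> q (y - z) < r - q (z - x)"
      using close by meson
    have "{y \<in> S. \<forall>p\<in>A. real_p p (y - z) < d} \<subseteq> {y \<in> S. q (y - x) < r}"
      using d diff[OF _ z(1) x] by fastforce
    then show "\<exists>A d. finite A \<and> A \<subseteq> P \<and> 0 < d \<and>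
        {y \<in> S. \<forall>p\<in>A. real_p p (y - z) < d} \<subseteq> {y \<in> S. q (y - x) < r}"
      using A d(1) by blast
  qed auto
  have "q 0 = 0" using sc[of 0 0] by simp
  have neg: "q (y - x) = q (x - y)" if "x \<in> S" "y \<in> S" for x y
    using sc[of "x - y" "-1"] that by simp
  have "openin (seminorm_topology S P) {x \<in> S. q x \<in> G}" if G: "open G" for G
  proof (subst openin_subopen, intro ballI)
    fix x assume "x \<in> {x \<in> S. q x \<in> G}"
    then have x: "x \<in> S" "q x \<in> G" by auto
    then obtain e where e: "e > 0" "\<forall>y. dist y (q x) < e \<longrightarrow> y \<in> G" using G open_dist by blast
    have "{y \<in> S. q (y - x) < e} \<subseteq> {x \<in> S. q x \<in> G}"
    proof clarify
      fix y assume y: "y \<in> S" and "q (y - x) < e"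
      then have "dist (q y) (q x) < e"
        using diff[of y x 0] diff[of x y 0] neg[of x y] x(1) by (auto simp: dist_real_def)
      then show "q y \<in> G" using e by blast
    qed
    then show "\<exists>T. openin (seminorm_topology S P) T \<and> x \<in> T \<and> T \<subseteq> {x \<in> S. q x \<in> G}"
      using ball[OF x(1), of e] x \<open>q 0 = 0\<close> e(1) by (intro exI[of _ "{y \<in> S. q (y - x) < e}"]) simp
  qed
  then have "continuous_map (seminorm_topology S P) euclidean q"
    by (simp add: continuous_map_def)
  then show "q \<in> continuous_seminorms space"
    by (intro continuous_seminormsI) (simp_all add: nonneg tri sc)
qed

lemma sum_csn:
  assumes "finite A" "A \<subseteq> P"
  shows "(\<lambda>x. \<Sum>p\<in>A. real_p p x) \<in> continuous_seminorms space"
proof (rule dominated_continuous(2)[where A = A and C = 1])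
  show "(\<Sum>p\<in>A. real_p p (x + y)) \<le> (\<Sum>p\<in>A. real_p p x) + (\<Sum>p\<in>A. real_p p y)" if "x \<in> S" "y \<in> S" for x y
    unfolding sum.distrib[symmetric] using that assms by (intro sum_mono real_p_triangle) auto
  show "(\<Sum>p\<in>A. real_p p (scl c x)) = norm c * (\<Sum>p\<in>A. real_p p x)" if "x \<in> S" for c x
    unfolding sum_distrib_left using that assms by (intro sum.cong real_p_scale) auto
qed (use assms in \<open>auto intro: sum_nonneg\<close>)

lemma real_p_csn: "p \<in> P \<Longrightarrow> real_p p \<in> continuous_seminorms space"
  using sum_csn[of "{p}"] by simp

text \<open>
  If \<open>q < 1\<close> wherever finitely many members \<open>p\<close> of the family are \<open>< r\<close>, then rescaling
  the argument gives \<open>q \<le> (\<Sum> p) / r\<close>.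
\<close>

lemma csn_dominated:
  assumes q: "q \<in> continuous_seminorms space"
  shows "\<exists>A C. finite A \<and> A \<subseteq> P \<and> 0 \<le> C \<and> (\<forall>x\<in>S. q x \<le> C * (\<Sum>p\<in>A. real_p p x))"
proof -
  have q0: "q (scl c x) = norm c * q x" if "x \<in> S" for c x
    using q that by (simp add: continuous_seminorms_def)
  have "openin (seminorm_topology S P) {x \<in> S. q x \<in> {..<1}}"
    using q openin_continuous_map_preimage[of "seminorm_topology S P" euclidean q "{..<1}"]
    by (simp add: continuous_seminorms_def)
  moreover have "0 \<in> {x \<in> S. q x \<in> {..<1}}" using q0[of 0 0] by simp
  ultimately obtain A r where A: "finite A" "A \<subseteq> P" and r: "0 < r"
    and sub: "{y \<in> S. \<forall>p\<in>A. real_p p (y - 0) < r} \<subseteq> {x \<in> S. q x \<in> {..<1}}"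
    unfolding openin_iff by meson
  have "q x \<le> (1 / r) * (\<Sum>p\<in>A. real_p p x)" if x: "x \<in> S" for x
  proof (rule dense_ge)
    fix t assume t: "(1 / r) * (\<Sum>p\<in>A. real_p p x) < t"
    have "0 \<le> (1 / r) * (\<Sum>p\<in>A. real_p p x)" using r by (simp add: sum_nonneg)
    then have t0: "0 < t" using t by linarith
    have "real_p p (scl (of_real (1 / t)) x) < r" if "p \<in> A" for p
    proof -
      have "real_p p x \<le> (\<Sum>p\<in>A. real_p p x)" using A that by (intro member_le_sum) auto
      also have "\<dots> < t * r" using t r by (simp add: field_simps)
      finally show ?thesis
        using t0 A that x by (simp add: real_p_scale subset_iff norm_divide field_simps)
    qed
    then have "q (scl (of_real (1 / t)) x) < 1" using sub x by auto
    moreover have "q (scl (of_real (1 / t)) x) = q x / t"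
      using q0[OF x, of "of_real (1 / t)"] t0 by (simp add: norm_divide)
    ultimately show "q x \<le> t" using t0 by (simp add: divide_less_eq)
  qed
  then show ?thesis using A r by (intro exI[of _ A] exI[of _ "1 / r"]) simp
qed

lemma seminormed_tvs_space: "seminormed_tvs space"
proof (intro seminormed_tvs.intro seminormed_tvs_axioms.intro)
  show "vector_space (tvs_scale space)" by (simp add: vector_space_axioms)
  show "module.subspace (tvs_scale space) (tvs_carrier space)" using subspace by simp
  show "openin (tvs_topology space) {y \<in> tvs_carrier space. q (y - x) < r}"
    if q: "q \<in> continuous_seminorms space" and x: "x \<in> tvs_carrier space" for q x r
  proof -
    obtain A C where "finite A" "A \<subseteq> P" "0 \<le> C" "\<forall>x\<in>S. q x \<le> C * (\<Sum>p\<in>A. real_p p x)"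
      using csn_dominated[OF q] by blast
    then show ?thesis
      using q x by (simp, intro dominated_continuous(1)[where A = A and C = C])
        (simp_all add: continuous_seminorms_def)
  qed
  show "\<exists>q\<in>continuous_seminorms space. \<exists>r>0. {y \<in> tvs_carrier space. q (y - x) < r} \<subseteq> N"
    if N: "openin (tvs_topology space) N" "x \<in> N" for N x
  proof -
    obtain A r where A: "finite A" "A \<subseteq> P" and r: "0 < r"
      and sub: "{y \<in> S. \<forall>p\<in>A. real_p p (y - x) < r} \<subseteq> N"
      using N by (simp add: openin_iff) meson
    have "real_p p y \<le> (\<Sum>p\<in>A. real_p p y)" if "p \<in> A" for p y using A that by (intro member_le_sum) auto
    then have "{y \<in> tvs_carrier space. (\<Sum>p\<in>A. real_p p (y - x)) < r} \<subseteq>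
        {y \<in> S. \<forall>p\<in>A. real_p p (y - x) < r}"
      using le_less_trans by (simp add: subset_iff) fast
    then have "{y \<in> tvs_carrier space. (\<Sum>p\<in>A. real_p p (y - x)) < r} \<subseteq> N"
      using sub by (rule order_trans)
    then show ?thesis
      using r by (intro bexI[OF _ sum_csn[OF A]] exI[of _ r] conjI)
  qed
  show "\<exists>q\<in>continuous_seminorms space. q x \<noteq> 0" if x: "x \<in> tvs_carrier space" "x \<noteq> 0" for x
  proof -
    obtain p where p: "p \<in> P" "p x \<noteq> 0" using separates x by auto
    then have "real_p p x \<noteq> 0" using finite_on[OF p(1), of x] x by (simp add: enn2real_eq_0_iff)
    then show ?thesis by (rule bexI[OF _ real_p_csn[OF p(1)]])
  qed
qed

end

section \<open>Minkowski functionals\<close>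

text \<open>
  The largest subset \<open>D\<close> of \<open>C\<close> that is stable under scalars of norm \<open>\<le> 1\<close> is convex, and it is
  a neighbourhood of \<open>0\<close> by joint continuity of the scalar multiplication at \<open>(0, 0)\<close>. So the
  gauge of \<open>D\<close> is a continuous seminorm, and \<open>gauge < 1\<close> holds only inside \<open>D\<close>.
\<close>

lemma minkowski_csn:
  fixes E :: "('k::real_normed_field, 'e::ab_group_add) tvs"
  assumes E: "hausdorff_lcs E"
    and C: "openin (tvs_topology E) C" "0 \<in> C" "tvs_convex E C"
  shows "\<exists>q\<in>continuous_seminorms E. {y \<in> tvs_carrier E. q y < 1} \<subseteq> C"
proof -
  let ?T = "tvs_topology E"
  let ?X = "tvs_carrier E"
  let ?s = "tvs_scale E"
  interpret vector_space ?s using E by (simp add: hausdorff_lcs_def)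
  have sub: "subspace ?X" using E by (simp add: hausdorff_lcs_def)
  have cont_add: "continuous_map (prod_topology ?T ?T) ?T (\<lambda>(x, y). x + y)"
    and cont_scale: "continuous_map (prod_topology euclidean ?T) ?T (\<lambda>(c, x). ?s c x)"
    using E by (simp_all add: hausdorff_lcs_def)
  note X = subspace_0[OF sub] subspace_add[OF sub] subspace_diff[OF sub] subspace_scale[OF sub]
    subspace_neg[OF sub]
  have cont_diff: "continuous_map ?T ?T (\<lambda>y. y - x)" if "x \<in> ?X" for x
  proof -
    have "continuous_map ?T (prod_topology ?T ?T) (\<lambda>y. (y, - x))"
      using that by (simp add: continuous_map_paired X)
    from continuous_map_compose[OF this cont_add] show ?thesis by (simp add: o_def)
  qed
  have cont_scale_right: "continuous_map ?T ?T (?s c)" for c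
  proof -
    have "continuous_map ?T (prod_topology euclidean ?T) (\<lambda>y. (c, y))"
      by (simp add: continuous_map_paired)
    from continuous_map_compose[OF this cont_scale] show ?thesis by (simp add: o_def)
  qed
  have cont_scale_left: "continuous_map euclidean ?T (\<lambda>c. ?s c y)" if "y \<in> ?X" for y
  proof -
    have "continuous_map euclidean (prod_topology euclidean ?T) (\<lambda>c. (c, y))"
      using that by (simp add: continuous_map_paired)
    from continuous_map_compose[OF this cont_scale] show ?thesis by (simp add: o_def)
  qed

  define D where "D = {y \<in> ?X. \<forall>c. norm c \<le> 1 \<longrightarrow> ?s c y \<in> C}"
  have DX: "D \<subseteq> ?X" by (auto simp: D_def)
  have DC: "D \<subseteq> C" using scale_one unfolding D_def by (force dest: spec[of _ 1])
  have D_balanced: "?s c y \<in> D" if "y \<in> D" "norm c \<le> 1" for c y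
    unfolding D_def
  proof (intro CollectI conjI allI impI)
    show "?s c y \<in> ?X" using that DX by (auto intro!: X)
    fix b :: 'k assume "norm b \<le> 1"
    then have "norm (b * c) \<le> 1" using that(2) by (simp add: norm_mult mult_le_one)
    then show "?s b (?s c y) \<in> C" using that(1) by (simp add: D_def)
  qed
  have D_convex: "?s (of_real (1 - t)) x + ?s (of_real t) y \<in> D"
    if "x \<in> D" "y \<in> D" "0 \<le> t" "t \<le> 1" for x y t
    unfolding D_def
  proof (intro CollectI conjI allI impI)
    show "?s (of_real (1 - t)) x + ?s (of_real t) y \<in> ?X" using that DX by (auto intro!: X)
    fix c :: 'k assume c: "norm c \<le> 1"
    have "?s c x \<in> C" "?s c y \<in> C" using that(1,2) c by (simp_all add: D_def)
    then have "?s (of_real (1 - t)) (?s c x) + ?s (of_real t) (?s c y) \<in> C"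
      using C(3) that(3,4) unfolding tvs_convex_def by (metis atLeastAtMost_iff)
    then show "?s c (?s (of_real (1 - t)) x + ?s (of_real t) y) \<in> C"
      by (simp add: scale_right_distrib mult.commute)
  qed
  obtain N where N: "openin ?T N" "0 \<in> N" "N \<subseteq> D"
  proof -
    have "openin (prod_topology euclidean ?T)
        {p \<in> topspace (prod_topology euclidean ?T). (\<lambda>(c, x). ?s c x) p \<in> C}"
      using openin_continuous_map_preimage[OF cont_scale C(1)] .
    moreover have "(0, 0) \<in> {p \<in> topspace (prod_topology euclidean ?T). (\<lambda>(c, x). ?s c x) p \<in> C}"
      using C(2) X by simp
    ultimately obtain A B where "openin euclidean A" and B: "openin ?T B" "0 \<in> B" and "0 \<in> A"
      and AB: "A \<times> B \<subseteq> {p \<in> topspace (prod_topology euclidean ?T). (\<lambda>(c, x). ?s c x) p \<in> C}"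
      unfolding openin_prod_topology_alt by meson
    then obtain d where d: "d > 0" "ball 0 d \<subseteq> A" using open_contains_ball by (metis open_openin)
    (* For |c| \<le> 1 the scalar c * a stays in the ball, so a * B is inside D. *)
    define a :: 'k where "a = of_real (d / 2)"
    have a: "norm a < d" "a \<noteq> 0" using d(1) by (simp_all add: a_def norm_divide)
    have "{z \<in> ?X. ?s (1 / a) z \<in> B} \<subseteq> D"
    proof
      fix z assume z: "z \<in> {z \<in> ?X. ?s (1 / a) z \<in> B}"
      show "z \<in> D"
        unfolding D_def
      proof (intro CollectI conjI allI impI)
        show "z \<in> ?X" using z by blast
        fix c :: 'k assume "norm c \<le> 1"
        then have "norm (c * a) \<le> 1 * norm a" unfolding norm_mult by (intro mult_right_mono) auto
        then have "c * a \<in> A" using a d by auto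
        then have "?s (c * a) (?s (1 / a) z) \<in> C" using AB z by auto
        then show "?s c z \<in> C" using a by simp
      qed
    qed
    moreover have "openin ?T {z \<in> ?X. ?s (1 / a) z \<in> B}"
      using openin_continuous_map_preimage[OF cont_scale_right B(1)] .
    ultimately show ?thesis using that B(2) X by simp
  qed

  define T where "T y = {t. 0 < t \<and> ?s (of_real (1 / t)) y \<in> D}" for y
  define q where "q y = Inf (T y)" for y
  have T_nonempty: "T y \<noteq> {}" if y: "y \<in> ?X" for y
  proof -
    have "openin euclidean {c \<in> topspace euclidean. ?s c y \<in> N}"
      using openin_continuous_map_preimage[OF cont_scale_left[OF y] N(1)] .
    then have "open {c. ?s c y \<in> N}" by simp
    moreover have "0 \<in> {c. ?s c y \<in> N}" using N by simp
    ultimately obtain e where e: "e > 0" "ball 0 e \<subseteq> {c. ?s c y \<in> N}"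
      using open_contains_ball by blast
    define t where "t = 2 / e"
    have t: "0 < t" "1 / t < e" using e(1) by (simp_all add: t_def)
    then have "of_real (1 / t) \<in> ball (0::'k) e" by (simp add: norm_divide)
    with e(2) have "of_real (1 / t) \<in> {c. ?s c y \<in> N}" by (rule subsetD)
    then have "?s (of_real (1 / t)) y \<in> D" using N(3) by (simp add: subset_iff)
    then have "t \<in> T y" using t by (simp add: T_def)
    then show ?thesis by blast
  qed
  have T_bdd: "bdd_below (T y)" for y by (intro bdd_belowI[of _ 0]) (simp add: T_def)
  have T_up: "s \<in> T y" if "t \<in> T y" "t \<le> s" for s t y
  proof -
    have t: "0 < t" "?s (of_real (1 / t)) y \<in> D" using that by (simp_all add: T_def)
    then have "?s (of_real (t / s)) (?s (of_real (1 / t)) y) \<in> D"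
      using that(2) by (intro D_balanced[OF t(2)]) (simp add: norm_divide)
    then show ?thesis using t that(2) by (simp add: T_def)
  qed
  have q_le: "q y \<le> t" if "t \<in> T y" for t y
    unfolding q_def using that T_bdd by (rule cInf_lower)
  have q_less: "t \<in> T y" if "q y < t" "y \<in> ?X" for t y
    using cInf_lessD[OF T_nonempty[OF that(2)]] that T_up by (fastforce simp: q_def)
  have nonneg: "0 \<le> q y" if "y \<in> ?X" for y
    unfolding q_def using T_nonempty[OF that] by (intro cInf_greatest) (auto simp: T_def)
  have triangle: "q (x + y) \<le> q x + q y" if x: "x \<in> ?X" and y: "y \<in> ?X" for x y
  proof (rule field_le_epsilon)
    fix e :: real assume e: "0 < e"
    define s where "s = q x + e / 2"
    define t where "t = q y + e / 2"
    have st: "0 < s" "0 < t" using nonneg x y e by (simp_all add: s_def t_def add_nonneg_pos)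
    have "s \<in> T x" "t \<in> T y" using e x y by (auto intro!: q_less simp: s_def t_def)
    then have "?s (of_real (1 - t / (s + t))) (?s (of_real (1 / s)) x) +
        ?s (of_real (t / (s + t))) (?s (of_real (1 / t)) y) \<in> D"
      using st by (intro D_convex) (auto simp: T_def field_simps)
    moreover have "(1 - t / (s + t)) * (1 / s) = 1 / (s + t)" "(t / (s + t)) * (1 / t) = 1 / (s + t)"
      using st by (simp_all add: field_simps)
    ultimately have "?s (of_real (1 / (s + t))) (x + y) \<in> D"
      unfolding scale_scale of_real_mult[symmetric] by (simp only: scale_right_distrib)
    then have "s + t \<in> T (x + y)" using st by (simp add: T_def)
    then show "q (x + y) \<le> q x + q y + e" using q_le[of "s + t" "x + y"] by (simp add: s_def t_def)
  qed
  have q_zero: "q 0 = 0"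
  proof (rule antisym[OF field_le_epsilon nonneg])
    fix e :: real assume "0 < e"
    then have "e \<in> T 0" using N by (auto simp: T_def)
    then show "q 0 \<le> 0 + e" using q_le by simp
  qed (rule X)
  have scale_le: "q (?s c y) \<le> norm c * q y" if c: "c \<noteq> 0" and y: "y \<in> ?X" for c y
  proof -
    have "q (?s c y) / norm c \<le> q y"
    proof (rule dense_ge)
      fix t assume "q y < t"
      then have t: "0 < t" "?s (of_real (1 / t)) y \<in> D"
        using q_less[OF _ y] by (auto simp: T_def)
      then have "?s (c / of_real (norm c)) (?s (of_real (1 / t)) y) \<in> D"
        using c by (intro D_balanced[OF t(2)]) (simp add: norm_divide)
      then have "norm c * t \<in> T (?s c y)"
        using c t(1) by (simp add: T_def field_simps)
      then show "q (?s c y) / norm c \<le> t" using q_le[of "norm c * t" "?s c y"] c by (simp add: field_simps)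
    qed
    then show ?thesis using c by (simp add: field_simps)
  qed
  have scale: "q (?s c y) = norm c * q y" if y: "y \<in> ?X" for c y
  proof (cases "c = 0")
    case False
    have "q (?s (1 / c) (?s c y)) \<le> norm (1 / c) * q (?s c y)"
      using False y X by (intro scale_le) auto
    then have "norm c * q y \<le> q (?s c y)" using False by (simp add: norm_divide field_simps)
    then show ?thesis using scale_le[OF False y] by simp
  qed (simp add: q_zero)
  have reverse: "\<bar>q y - q x\<bar> \<le> q (y - x)" if "x \<in> ?X" "y \<in> ?X" for x y
    using triangle[of "y - x" x] triangle[of "x - y" y] scale[of "y - x" "-1"] that X by simp
  have "openin ?T {y \<in> ?X. q y \<in> G}" if G: "open G" for G
  proof (subst openin_subopen, intro ballI)
    fix x assume "x \<in> {y \<in> ?X. q y \<in> G}"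
    then have x: "x \<in> ?X" "q x \<in> G" by auto
    then obtain e where e: "e > 0" "\<forall>y. dist y (q x) < e \<longrightarrow> y \<in> G" using G open_dist by blast
    define M where "M = {y \<in> ?X. (?s (of_real (1 / (e / 2))) \<circ> (\<lambda>y. y - x)) y \<in> N}"
    have "openin ?T M"
      unfolding M_def
      by (rule openin_continuous_map_preimage[OF continuous_map_compose[OF cont_diff[OF x(1)]
        cont_scale_right] N(1)])
    moreover have "x \<in> M" using x N by (simp add: M_def)
    moreover have "M \<subseteq> {y \<in> ?X. q y \<in> G}"
    proof
      fix y assume y: "y \<in> M"
      then have "e / 2 \<in> T (y - x)" using e N by (auto simp: M_def T_def)
      then have "q (y - x) < e" using q_le[of "e / 2" "y - x"] e by simp
      then have "dist (q y) (q x) < e" using reverse[OF x(1)] y by (fastforce simp: M_def dist_real_def)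
      then show "y \<in> {y \<in> ?X. q y \<in> G}" using e y by (simp add: M_def)
    qed
    ultimately show "\<exists>M. openin ?T M \<and> x \<in> M \<and> M \<subseteq> {y \<in> ?X. q y \<in> G}" by blast
  qed
  then have "continuous_map ?T euclidean q" by (simp add: continuous_map_def)
  then have "q \<in> continuous_seminorms E"
    by (intro continuous_seminormsI) (simp_all add: nonneg triangle scale)
  moreover have "{y \<in> ?X. q y < 1} \<subseteq> C"
    using q_less[of _ 1] DC by (auto simp: T_def)
  ultimately show ?thesis by blast
qed

lemma hausdorff_lcs_imp_seminormed_tvs:
  fixes E :: "('k::real_normed_field, 'e::ab_group_add) tvs"
  assumes E: "hausdorff_lcs E"
  shows "seminormed_tvs E"
proof -
  let ?T = "tvs_topology E"
  let ?X = "tvs_carrier E"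
  interpret vector_space "tvs_scale E" using E by (simp add: hausdorff_lcs_def)
  have sub: "subspace ?X" using E by (simp add: hausdorff_lcs_def)
  have cont_add: "continuous_map ?T ?T (\<lambda>y. y + x)" if "x \<in> ?X" for x
  proof -
    have "continuous_map ?T (prod_topology ?T ?T) (\<lambda>y. (y, x))"
      using that by (simp add: continuous_map_paired)
    moreover have "continuous_map (prod_topology ?T ?T) ?T (\<lambda>(x, y). x + y)"
      using E by (simp add: hausdorff_lcs_def)
    ultimately show ?thesis by (auto dest: continuous_map_compose simp: o_def)
  qed
  have basis: "\<exists>q\<in>continuous_seminorms E. \<exists>r>0. {y \<in> ?X. q (y - x) < r} \<subseteq> N"
    if N: "openin ?T N" "x \<in> N" for N x
  proof -
    have x: "x \<in> ?X" using N openin_subset by blast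
    have "openin ?T {y \<in> ?X. y + x \<in> N}"
      using openin_continuous_map_preimage[OF cont_add[OF x] N(1)] .
    moreover have "0 \<in> {y \<in> ?X. y + x \<in> N}" using N subspace_0[OF sub] by simp
    ultimately obtain C where C: "openin ?T C" "0 \<in> C" "C \<subseteq> {y \<in> ?X. y + x \<in> N}" "tvs_convex E C"
      using E unfolding hausdorff_lcs_def by meson
    then obtain q where q: "q \<in> continuous_seminorms E" "{y \<in> ?X. q y < 1} \<subseteq> C"
      using minkowski_csn[OF E] by meson
    have "{y \<in> ?X. q (y - x) < 1} \<subseteq> N"
    proof
      fix y assume "y \<in> {y \<in> ?X. q (y - x) < 1}"
      then have "y - x \<in> C" using q x subspace_diff[OF sub] by blast
      then show "y \<in> N" using C(3) by auto
    qed
    then show ?thesis by (intro bexI[OF _ q(1)] exI[of _ 1]) simp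
  qed
  show ?thesis
  proof (intro seminormed_tvs.intro seminormed_tvs_axioms.intro)
    show "openin ?T {y \<in> ?X. q (y - x) < r}"
      if q: "q \<in> continuous_seminorms E" and x: "x \<in> ?X" for q x r
    proof -
      have "continuous_map ?T euclidean (q \<circ> (\<lambda>y. y - x))"
        using continuous_map_compose[OF cont_add[of "- x"]] q x subspace_neg[OF sub]
        by (auto simp: continuous_seminorms_def)
      from openin_continuous_map_preimage[OF this, of "{..<r}"] show ?thesis by simp
    qed
    show "\<exists>q\<in>continuous_seminorms E. q x \<noteq> 0" if x: "x \<in> ?X" "x \<noteq> 0" for x
    proof -
      have "Hausdorff_space ?T" using E by (simp add: hausdorff_lcs_def)
      then obtain N where N: "openin ?T N" "0 \<in> N" "x \<notin> N"
        using x subspace_0[OF sub] unfolding Hausdorff_space_def disjnt_iff by metis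
      then obtain q r where q: "q \<in> continuous_seminorms E" and r: "0 < r"
        and qr: "{y \<in> ?X. q (y - 0) < r} \<subseteq> N"
        using basis by meson
      have "q x \<noteq> 0" using x N(3) r qr by auto
      then show ?thesis by (rule bexI[OF _ q])
    qed
  qed (use basis in \<open>simp_all add: vector_space_axioms sub\<close>)
qed

section \<open>Multi-indices as sorted lists of coordinates\<close>

text \<open>
  Sorted lists stand for multi-indices; dropping the head, which undoes the last differentiation,
  stays within the sorted lists. This makes inductions over derivatives plain list inductions.
\<close>

definition admissible :: "enat \<Rightarrow> 'n::linorder list \<Rightarrow> bool" where
  "admissible k is \<longleftrightarrow> sorted is \<and> enat (length is) \<le> k"

lemma admissible_Nil [simp]: "admissible k []"
  by (simp add: admissible_def zero_enat_def[symmetric])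

lemma admissible_ConsD: "admissible k (i # is) \<Longrightarrow> admissible k is"
  unfolding admissible_def by (auto intro: order_trans[rotated])

lemma sorted_mi_list: "sorted (mi_list \<alpha>)"
proof -
  have "sorted (concat (map (\<lambda>i. replicate (\<alpha> $ i) i) xs))" if "sorted xs" for xs
    using that by (induction xs) (auto simp: sorted_append)
  then show ?thesis by (simp add: mi_list_def)
qed

lemma length_mi_list: "length (mi_list \<alpha>) = mi_order \<alpha>"
  by (simp add: mi_list_def mi_order_def length_concat o_def sum_list_distinct_conv_sum_set)

lemma mi_list_count: "sorted is \<Longrightarrow> mi_list (\<chi> i. count_list is i) = is"
proof -
  assume s: "sorted is"
  have "mset (concat (map (\<lambda>i. replicate (f i) i) xs)) = (\<Sum>i\<leftarrow>xs. replicate_mset (f i) i)"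
    for f :: "'a \<Rightarrow> nat" and xs
    by (induction xs) auto
  then have "mset (mi_list (\<chi> i. count_list is i)) = (\<Sum>i\<in>UNIV. replicate_mset (count_list is i) i)"
    by (simp add: mi_list_def sum_list_distinct_conv_sum_set)
  also have "\<dots> = mset is"
    by (rule multiset_eqI) (simp add: count_sum count_mset)
  finally show ?thesis using s sorted_mi_list by (metis sorted_sort_id properties_for_sort)
qed

lemma admissible_eq_mi_list: "{is. admissible k is} = mi_list ` {\<alpha>. enat (mi_order \<alpha>) \<le> k}"
proof (intro set_eqI iffI)
  fix "is" :: "'a list" assume "is \<in> {is. admissible k is}"
  then have "mi_list (\<chi> i. count_list is i) = is" "enat (length is) \<le> k"
    using mi_list_count by (auto simp: admissible_def)
  then show "is \<in> mi_list ` {\<alpha>. enat (mi_order \<alpha>) \<le> k}"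
    by (intro image_eqI[of _ _ "\<chi> i. count_list is i"]) (simp_all add: length_mi_list[symmetric])
qed (auto simp: admissible_def sorted_mi_list length_mi_list)

lemma all_multi_indices_iff:
  "(\<forall>\<alpha>. enat (mi_order \<alpha>) \<le> k \<longrightarrow> Q (mi_list \<alpha>)) \<longleftrightarrow> (\<forall>is. admissible k is \<longrightarrow> Q is)"
  using admissible_eq_mi_list[of k] by (auto simp: set_eq_iff image_iff)

section \<open>Partial derivatives in locally convex spaces\<close>

lemma eventually_shift_in_open:
  fixes x :: "('n::finite) rvec"
  assumes "open U" "x \<in> U"
  shows "\<forall>\<^sub>F h in at 0. x + h *\<^sub>R axis i 1 \<in> U"
proof -
  have "((\<lambda>h::real. x + h *\<^sub>R axis i 1) \<longlongrightarrow> x + 0 *\<^sub>R axis i 1) (at 0)"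
    by (intro tendsto_intros)
  then show ?thesis using assms by (simp add: topological_tendstoD)
qed

lemma has_pderiv_cong:
  fixes x :: "('n::finite) rvec"
  assumes U: "open U" "x \<in> U" and eq: "\<And>x. x \<in> U \<Longrightarrow> f x = g x" and f: "has_pderiv E i f x d"
  shows "has_pderiv E i g x d"
proof -
  have "\<forall>\<^sub>F h in at 0. tvs_scale E (of_real (1 / h)) (f (x + h *\<^sub>R axis i 1) - f x) =
      tvs_scale E (of_real (1 / h)) (g (x + h *\<^sub>R axis i 1) - g x)"
    using eventually_shift_in_open[OF U, of i] by eventually_elim (simp add: eq U)
  from limitin_transform_eventually[OF this] show ?thesis using f unfolding has_pderiv_def by blast
qed

context seminormed_tvs
begin

lemma limitin_csn_le:
  assumes f: "limitin (tvs_topology E) f l F" and F: "F \<noteq> bot" and q: "q \<in> continuous_seminorms E"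
    and c: "c \<in> tvs_carrier E" and B: "\<forall>\<^sub>F h in F. q (f h - c) \<le> B"
  shows "q (l - c) \<le> B"
proof (rule field_le_epsilon)
  fix e :: real assume e: "0 < e"
  have l: "l \<in> tvs_carrier E" using f by (simp add: limitin_def)
  have "\<forall>\<^sub>F h in F. q (l - c) \<le> B + e"
    using limitinD[OF f q e] B
  proof eventually_elim
    case (elim h)
    have "q (l - c) \<le> q (l - f h) + q (f h - c)" using elim l c by (intro csn_triangle_diff[OF q]) auto
    then show ?case using elim csn_commute[OF q l, of "f h"] by simp
  qed
  then show "q (l - c) \<le> B + e" using F by (simp add: eventually_const)
qed

lemma limitin_unique:
  assumes "limitin (tvs_topology E) f l F" "limitin (tvs_topology E) f m F" "F \<noteq> bot"
  shows "l = m"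
proof (rule ccontr)
  assume "l \<noteq> m"
  have lm: "l \<in> tvs_carrier E" "m \<in> tvs_carrier E" using assms by (simp_all add: limitin_def)
  obtain q where q: "q \<in> continuous_seminorms E" "q (l - m) \<noteq> 0"
    using separating[of "l - m"] lm \<open>l \<noteq> m\<close> by auto
  have "q (l - m) \<le> 0 + e" if "0 < e" for e
    using limitinD[OF assms(2) q(1) that]
    by (intro limitin_csn_le[OF assms(1,3) q(1) lm(2)]) (auto elim: eventually_mono)
  then have "q (l - m) \<le> 0" by (rule field_le_epsilon)
  then show False using q csn_nonneg[OF q(1), of "l - m"] lm by simp
qed

lemma has_pderiv_unique: "has_pderiv E i f x d \<Longrightarrow> has_pderiv E i f x d' \<Longrightarrow> d = d'"
  unfolding has_pderiv_def by (rule limitin_unique) auto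

lemma has_pderiv_in_carrier: "has_pderiv E i f x d \<Longrightarrow> d \<in> tvs_carrier E"
  unfolding has_pderiv_def by (simp add: limitin_def)

lemma has_pderiv_add:
  assumes "has_pderiv E i f x a" "has_pderiv E i g x b"
  shows "has_pderiv E i (\<lambda>x. f x + g x) x (a + b)"
  using limitin_add[OF assms[unfolded has_pderiv_def]]
  by (simp only: has_pderiv_def add_diff_add scale_right_distrib)

lemma has_pderiv_scale:
  assumes "has_pderiv E i f x a"
  shows "has_pderiv E i (\<lambda>x. tvs_scale E c (f x)) x (tvs_scale E c a)"
  using limitin_scale[OF assms[unfolded has_pderiv_def], of c]
  unfolding has_pderiv_def by (simp add: scale_right_diff_distrib mult.commute)

lemma has_pderiv_diff:
  assumes "has_pderiv E i f x a" "has_pderiv E i g x b"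
  shows "has_pderiv E i (\<lambda>x. f x - g x) x (a - b)"
  using has_pderiv_add[OF assms(1) has_pderiv_scale[OF assms(2), of "-1"]] by simp

lemma has_pderiv_iff:
  fixes x :: "('n::finite) rvec"
  assumes U: "open U" "x \<in> U" and f: "\<And>x. x \<in> U \<Longrightarrow> f x \<in> tvs_carrier E"
  shows "has_pderiv E i f x d \<longleftrightarrow> d \<in> tvs_carrier E \<and>
    (\<forall>q\<in>continuous_seminorms E. \<forall>e>0. \<forall>\<^sub>F h in at 0.
       q (tvs_scale E (of_real (1 / h)) (f (x + h *\<^sub>R axis i 1) - f x) - d) < e)"
  unfolding has_pderiv_def
  by (rule limitin_iff, use eventually_shift_in_open[OF U, of i] in eventually_elim) (simp add: f U)

subsection \<open>The mean value inequality\<close>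

text \<open>
  By the triangle inequality the estimate is additive over adjacent intervals, and with a margin
  \<open>e\<close> it holds on all short intervals around a given point because the derivative exists there.
  Bisection then gives it on the whole interval. The argument involves one seminorm only and takes
  place in \<open>E\<close> itself, where integrals of continuous functions may fail to exist.
\<close>

lemma mean_value_interval:
  fixes \<phi> :: "real \<Rightarrow> 'e"
  assumes q: "q \<in> continuous_seminorms E" and A: "A \<in> tvs_carrier E" and ab: "a \<le> b"
    and \<phi>: "\<And>t. a \<le> t \<Longrightarrow> t \<le> b \<Longrightarrow> \<phi> t \<in> tvs_carrier E"
    and deriv: "\<And>t. a \<le> t \<Longrightarrow> t \<le> b \<Longrightarrow>
      limitin (tvs_topology E) (\<lambda>h. tvs_scale E (of_real (1 / h)) (\<phi> (t + h) - \<phi> t)) (d t) (at 0)"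
    and bound: "\<And>t. a \<le> t \<Longrightarrow> t \<le> b \<Longrightarrow> q (d t - A) \<le> M"
  shows "q (\<phi> b - \<phi> a - tvs_scale E (of_real (b - a)) A) \<le> M * (b - a)"
proof (rule field_le_epsilon)
  fix e0 :: real assume "0 < e0"
  (* The denominator makes e * (b - a) at most e0, also when a = b. *)
  define e where "e = e0 / (b - a + 1)"
  have e: "0 < e" "e * (b - a) \<le> e0"
    using \<open>0 < e0\<close> ab by (simp_all add: e_def field_simps)
  let ?s = "\<lambda>t. tvs_scale E (of_real t)"
  (* P is vacuous for intervals that leave [a, b], because Bolzano's principle asks for the local
     property on all short intervals around a point, also around a and b. *)
  define P where "P u v \<longleftrightarrow>
    (a \<le> u \<and> v \<le> b \<longrightarrow> q (\<phi> v - \<phi> u - ?s (v - u) A) \<le> (M + e) * (v - u))" for u v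
  have "P a b"
  proof (rule Bolzano[of a b P, OF ab], unfold P_def, goal_cases)
    case (1 u v w)
    show ?case
    proof
      assume uw: "a \<le> u \<and> w \<le> b"
      have "\<phi> u \<in> tvs_carrier E" "\<phi> v \<in> tvs_carrier E" "\<phi> w \<in> tvs_carrier E"
        using 1(3,4) uw by (auto intro!: \<phi>)
      then have "q ((\<phi> w - \<phi> v - ?s (w - v) A) + (\<phi> v - \<phi> u - ?s (v - u) A)) \<le>
          q (\<phi> w - \<phi> v - ?s (w - v) A) + q (\<phi> v - \<phi> u - ?s (v - u) A)"
        using A by (intro csn_triangle[OF q] carrier_closed)
      also have "\<dots> \<le> (M + e) * (w - v) + (M + e) * (v - u)" using 1 uw by (intro add_mono) auto
      finally show "q (\<phi> w - \<phi> u - ?s (w - u) A) \<le> (M + e) * (w - u)"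
        by (simp add: algebra_simps)
    qed
  next
    case (2 x)
    have dx: "d x \<in> tvs_carrier E" using deriv[OF 2] by (simp add: limitin_def)
    obtain r where r: "r > 0"
      "\<And>h. h \<noteq> 0 \<Longrightarrow> \<bar>h\<bar> < r \<Longrightarrow> q (?s (1 / h) (\<phi> (x + h) - \<phi> x) - d x) < e"
      using limitinD[OF deriv[OF 2] q e(1)] by (auto simp: eventually_at dist_real_def)
    have near: "q (\<phi> s - \<phi> x - ?s (s - x) (d x)) \<le> e * \<bar>s - x\<bar>"
      if s: "a \<le> s" "s \<le> b" "\<bar>s - x\<bar> < r" for s
    proof (cases "s = x")
      case True
      then show ?thesis by (simp add: csn_zero[OF q])
    next
      case False
      let ?z = "?s (1 / (s - x)) (\<phi> s - \<phi> x) - d x"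
      have "?z \<in> tvs_carrier E" using s 2 dx by (auto intro!: \<phi>)
      moreover have "?s (s - x) ?z = \<phi> s - \<phi> x - ?s (s - x) (d x)"
        using False
        by (simp only: scale_right_diff_distrib scale_scale of_real_mult[symmetric]) simp
      ultimately have "q (\<phi> s - \<phi> x - ?s (s - x) (d x)) = \<bar>s - x\<bar> * q ?z"
        using csn_scale[OF q, of ?z "of_real (s - x)"] by (metis norm_of_real)
      also have "\<dots> \<le> \<bar>s - x\<bar> * e"
        using r(2)[of "s - x"] False s by (intro mult_left_mono) auto
      finally show ?thesis by (simp add: mult.commute)
    qed
    show ?case
    proof (intro exI[of _ r] conjI allI impI r(1))
      fix u v assume *: "u \<le> x \<and> x \<le> v \<and> v - u < r" "a \<le> u \<and> v \<le> b"
      let ?y = "\<phi> v - \<phi> x - ?s (v - x) (d x)" and ?z = "\<phi> u - \<phi> x - ?s (u - x) (d x)"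
      have p: "\<phi> u \<in> tvs_carrier E" "\<phi> v \<in> tvs_carrier E" "\<phi> x \<in> tvs_carrier E"
        using * 2 by (auto intro!: \<phi>)
      then have c: "?y \<in> tvs_carrier E" "?z \<in> tvs_carrier E"
        using dx by (auto intro!: carrier_closed)
      have "\<phi> v - \<phi> u - ?s (v - u) A = (?y - ?z) + ?s (v - u) (d x - A)"
        by (simp add: algebra_simps)
      also have "q \<dots> \<le> q (?y - ?z) + q (?s (v - u) (d x - A))"
        using p dx A by (intro csn_triangle[OF q] carrier_closed)
      also have "q (?y - ?z) \<le> q ?y + q ?z" using c by (rule csn_triangle_minus[OF q])
      also have "q ?y \<le> e * \<bar>v - x\<bar>" using * by (intro near) auto
      also have "q ?z \<le> e * \<bar>u - x\<bar>" using * by (intro near) auto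
      also have "q (?s (v - u) (d x - A)) = \<bar>v - u\<bar> * q (d x - A)"
        using csn_scale[OF q, of "d x - A" "of_real (v - u)"] dx A by (metis carrier_closed(3) norm_of_real)
      also have "\<dots> \<le> \<bar>v - u\<bar> * M" using bound[OF 2] by (intro mult_left_mono) auto
      finally show "q (\<phi> v - \<phi> u - ?s (v - u) A) \<le> (M + e) * (v - u)"
        using * by (simp add: algebra_simps)
    qed
  qed
  then show "q (\<phi> b - \<phi> a - ?s (b - a) A) \<le> M * (b - a) + e0"
    using e(2) unfolding P_def by (simp add: algebra_simps)
qed

lemma mean_value_inequality:
  fixes x :: "('n::finite) rvec"
  assumes q: "q \<in> continuous_seminorms E" and A: "A \<in> tvs_carrier E"
    and f: "\<And>t. \<bar>t\<bar> \<le> \<bar>h\<bar> \<Longrightarrow> f (x + t *\<^sub>R axis i 1) \<in> tvs_carrier E"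
    and deriv: "\<And>t. \<bar>t\<bar> \<le> \<bar>h\<bar> \<Longrightarrow> has_pderiv E i f (x + t *\<^sub>R axis i 1) (f' (x + t *\<^sub>R axis i 1))"
    and bound: "\<And>t. \<bar>t\<bar> \<le> \<bar>h\<bar> \<Longrightarrow> q (f' (x + t *\<^sub>R axis i 1) - A) \<le> M"
  shows "q (f (x + h *\<^sub>R axis i 1) - f x - tvs_scale E (of_real h) A) \<le> M * \<bar>h\<bar>"
proof -
  let ?\<phi> = "\<lambda>t. f (x + t *\<^sub>R axis i 1)"
  have lim: "limitin (tvs_topology E) (\<lambda>s. tvs_scale E (of_real (1 / s)) (?\<phi> (t + s) - ?\<phi> t))
      (f' (x + t *\<^sub>R axis i 1)) (at 0)" if "\<bar>t\<bar> \<le> \<bar>h\<bar>" for t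
    using deriv[OF that] unfolding has_pderiv_def by (simp add: scaleR_add_left add.assoc)
  show ?thesis
  proof (cases "0 \<le> h")
    case True
    then show ?thesis
      using mean_value_interval[OF q A, of 0 h ?\<phi> "\<lambda>t. f' (x + t *\<^sub>R axis i 1)" M] f lim bound by simp
  next
    case False
    then have "q (?\<phi> 0 - ?\<phi> h - tvs_scale E (of_real (0 - h)) A) \<le> M * (0 - h)"
      by (intro mean_value_interval[OF q A, of h 0 ?\<phi> "\<lambda>t. f' (x + t *\<^sub>R axis i 1)"] f lim bound) auto
    moreover have "q (?\<phi> h - ?\<phi> 0 - tvs_scale E (of_real h) A) = q (?\<phi> 0 - ?\<phi> h - tvs_scale E (of_real (0 - h)) A)"
      using csn_minus[OF q, of "?\<phi> 0 - ?\<phi> h - tvs_scale E (of_real (0 - h)) A"] f[of 0] f[of h] A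
      by (simp add: algebra_simps)
    ultimately show ?thesis using False by simp
  qed
qed

subsection \<open>Schwarz's theorem\<close>

text \<open>
  The second difference of \<open>g\<close> over a rectangle with sides \<open>h\<close> and \<open>t\<close> differs from \<open>h t\<close> times the
  mixed derivative at the corner by at most \<open>\<epsilon> \<bar>h\<bar> \<bar>t\<bar>\<close>: apply the mean value inequality
  in \<open>y\<close>, and in \<open>x\<close> to the resulting difference of \<open>y\<close>-derivatives. Dividing by \<open>h\<close> and
  letting \<open>h\<close> tend to \<open>0\<close> bounds the difference quotient of the \<open>x\<close>-derivative in direction \<open>y\<close>.
  So the derivative in the opposite order exists.
\<close>

lemma mixed_derivatives_commute:
  fixes g gx gy gxy :: "('n::finite) rvec \<Rightarrow> ('m::finite) rvec \<Rightarrow> 'e"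
  assumes U: "open U" and V: "open V" and x: "x \<in> U" and y: "y \<in> V"
    and g: "\<And>x y. x \<in> U \<Longrightarrow> y \<in> V \<Longrightarrow> g x y \<in> tvs_carrier E"
    and dy: "\<And>x y. x \<in> U \<Longrightarrow> y \<in> V \<Longrightarrow> has_pderiv E j (g x) y (gy x y)"
    and dx: "\<And>x y. x \<in> U \<Longrightarrow> y \<in> V \<Longrightarrow> has_pderiv E i (\<lambda>x. g x y) x (gx x y)"
    and dxy: "\<And>x y. x \<in> U \<Longrightarrow> y \<in> V \<Longrightarrow> has_pderiv E i (\<lambda>x. gy x y) x (gxy x y)"
    and cont: "continuous_map (top_of_set (U \<times> V)) (tvs_topology E) (\<lambda>(x, y). gxy x y)"
  shows "has_pderiv E j (gx x) y (gxy x y)"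
proof (subst has_pderiv_iff[OF V y])
  let ?A = "gxy x y"
  let ?s = "\<lambda>t. tvs_scale E (of_real t)"
  have gx: "gx x y \<in> tvs_carrier E" and gy: "gy x y \<in> tvs_carrier E"
    and gxy: "gxy x y \<in> tvs_carrier E" if "x \<in> U" "y \<in> V" for x y
    using has_pderiv_in_carrier[OF dx[OF that]] has_pderiv_in_carrier[OF dy[OF that]]
      has_pderiv_in_carrier[OF dxy[OF that]] by auto
  show "gx x y \<in> tvs_carrier E" if "y \<in> V" for y using gx[OF x that] .
  have A: "?A \<in> tvs_carrier E" using gxy x y .
  show "?A \<in> tvs_carrier E \<and> (\<forall>q\<in>continuous_seminorms E. \<forall>e>0. \<forall>\<^sub>F h in at 0.
      q (?s (1 / h) (gx x (y + h *\<^sub>R axis j 1) - gx x y) - ?A) < e)"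
  proof (intro conjI ballI allI impI A)
    fix q and e0 :: real assume q: "q \<in> continuous_seminorms E" and "0 < e0"
    define e where "e = e0 / 2"
    have e: "0 < e" "e < e0" using \<open>0 < e0\<close> by (simp_all add: e_def)
    obtain r1 where r1: "r1 > 0" and
      "\<And>z. z \<in> U \<times> V \<Longrightarrow> z \<noteq> (x, y) \<Longrightarrow> dist z (x, y) < r1 \<Longrightarrow> q ((\<lambda>(x, y). gxy x y) z - ?A) < e"
      using continuous_map_csnD[OF cont _ q e(1), of "(x, y)"] x y unfolding eventually_at by auto
    then have r1': "q (gxy x' y' - ?A) < e"
      if "x' \<in> U" "y' \<in> V" "dist (x', y') (x, y) < r1" for x' y'
      using that csn_zero[OF q] e(1) by (cases "(x', y') = (x, y)") fastforce+
    obtain r2 where r2: "r2 > 0" "ball x r2 \<subseteq> U" using U x open_contains_ball by blast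
    obtain r3 where r3: "r3 > 0" "ball y r3 \<subseteq> V" using V y open_contains_ball by blast
    define r where "r = min (r1 / 2) (min r2 r3)"
    have r: "0 < r" using r1 r2 r3 by (simp add: r_def)
    let ?x = "\<lambda>h. x + h *\<^sub>R axis i 1" and ?y = "\<lambda>h. y + h *\<^sub>R axis j 1"
    have dist_x: "dist (?x h) x = \<bar>h\<bar>" and dist_y: "dist (?y h) y = \<bar>h\<bar>" for h
      by (simp_all add: dist_norm)
    have xU: "?x h \<in> U" and yV: "?y h \<in> V" if "\<bar>h\<bar> < r" for h
      using that r2 r3 dist_x[of h] dist_y[of h]
      by (auto simp: r_def subset_iff dist_commute)
    have near: "q (gxy (?x h) (?y t) - ?A) \<le> e" if "\<bar>h\<bar> < r" "\<bar>t\<bar> < r" for h t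
    proof -
      have "dist (?x h, ?y t) (x, y) \<le> dist (?x h) x + dist (?y t) y"
        by (simp add: dist_Pair_Pair sqrt_sum_squares_le_sum)
      also have "\<dots> < r1" using that unfolding dist_x dist_y by (simp add: r_def)
      finally show ?thesis using r1'[OF xU[OF that(1)] yV[OF that(2)]] by simp
    qed
    have rect: "q (g (?x h) (?y t) - g x (?y t) - (g (?x h) y - g x y) - ?s t (?s h ?A)) \<le>
        e * \<bar>h\<bar> * \<bar>t\<bar>" if h: "\<bar>h\<bar> < r" and t: "\<bar>t\<bar> < r" for h t
    proof (rule mean_value_inequality[OF q])
      show "?s h ?A \<in> tvs_carrier E" using A by simp
      fix s :: real assume "\<bar>s\<bar> \<le> \<bar>t\<bar>"
      then have s: "\<bar>s\<bar> < r" using t by simp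
      show "g (?x h) (?y s) - g x (?y s) \<in> tvs_carrier E"
        using xU[OF h] yV[OF s] x g by simp
      show "has_pderiv E j (\<lambda>y. g (?x h) y - g x y) (?y s) ((\<lambda>y. gy (?x h) y - gy x y) (?y s))"
        using xU[OF h] yV[OF s] x by (intro has_pderiv_diff dy)
      show "q ((\<lambda>y. gy (?x h) y - gy x y) (?y s) - ?s h ?A) \<le> e * \<bar>h\<bar>"
      proof (rule mean_value_inequality[OF q A])
        fix u :: real assume "\<bar>u\<bar> \<le> \<bar>h\<bar>"
        then have u: "\<bar>u\<bar> < r" using h by simp
        show "gy (?x u) (?y s) \<in> tvs_carrier E" using xU[OF u] yV[OF s] gy by simp
        show "has_pderiv E i (\<lambda>x. gy x (?y s)) (?x u) (gxy (?x u) (?y s))"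
          using xU[OF u] yV[OF s] by (rule dxy)
        show "q (gxy (?x u) (?y s) - ?A) \<le> e" by (rule near[OF u s])
      qed
    qed
    have quot: "q (gx x (?y t) - gx x y - ?s t ?A) \<le> e * \<bar>t\<bar>" if t: "\<bar>t\<bar> < r" for t
    proof (rule limitin_csn_le[OF _ _ q])
      have "has_pderiv E i (\<lambda>x. g x (?y t) - g x y) x (gx x (?y t) - gx x y)"
        using x yV[OF t] y by (intro has_pderiv_diff dx)
      then show "limitin (tvs_topology E)
          (\<lambda>h. ?s (1 / h) (g (?x h) (?y t) - g (?x h) y - (g x (?y t) - g x y)))
          (gx x (?y t) - gx x y) (at 0)"
        unfolding has_pderiv_def .
      show "?s t ?A \<in> tvs_carrier E" using A by simp
      have "\<forall>\<^sub>F h::real in at 0. \<bar>h\<bar> < r \<and> h \<noteq> 0" using r by (auto simp: eventually_at)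
      then show "\<forall>\<^sub>F h in at 0. q (?s (1 / h) (g (?x h) (?y t) - g (?x h) y - (g x (?y t) - g x y))
          - ?s t ?A) \<le> e * \<bar>t\<bar>"
      proof eventually_elim
        case (elim h)
        let ?R = "g (?x h) (?y t) - g x (?y t) - (g (?x h) y - g x y) - ?s t (?s h ?A)"
        have R: "?R \<in> tvs_carrier E"
          using elim t x y A by (auto intro!: g xU yV)
        have "?s (1 / h) (g (?x h) (?y t) - g (?x h) y - (g x (?y t) - g x y)) - ?s t ?A = ?s (1 / h) ?R"
          using elim by (simp add: scale_right_diff_distrib algebra_simps)
        also have "q \<dots> = norm (of_real (1 / h) :: 'k) * q ?R" by (rule csn_scale[OF q R])
        also have "\<dots> = (1 / \<bar>h\<bar>) * q ?R" by (simp add: norm_divide)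
        also have "\<dots> \<le> (1 / \<bar>h\<bar>) * (e * \<bar>h\<bar> * \<bar>t\<bar>)"
          using rect[of h t] elim t by (intro mult_left_mono) auto
        finally show ?case using elim by simp
      qed
    qed simp
    have "\<forall>\<^sub>F t::real in at 0. \<bar>t\<bar> < r \<and> t \<noteq> 0" using r by (auto simp: eventually_at)
    then show "\<forall>\<^sub>F t in at 0. q (?s (1 / t) (gx x (?y t) - gx x y) - ?A) < e0"
    proof eventually_elim
      case (elim t)
      let ?R = "gx x (?y t) - gx x y - ?s t ?A"
      have R: "?R \<in> tvs_carrier E" using elim x y A by (auto intro!: gx yV)
      have "?s (1 / t) (gx x (?y t) - gx x y) - ?A = ?s (1 / t) ?R"
        using elim by (simp add: scale_right_diff_distrib)
      also have "q \<dots> = norm (of_real (1 / t) :: 'k) * q ?R" by (rule csn_scale[OF q R])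
      also have "\<dots> = (1 / \<bar>t\<bar>) * q ?R" by (simp add: norm_divide)
      also have "\<dots> \<le> (1 / \<bar>t\<bar>) * (e * \<bar>t\<bar>)"
        using quot[of t] elim by (intro mult_left_mono) auto
      finally show ?case using elim e by simp
    qed
  qed
qed

end

section \<open>Families of iterated derivatives\<close>

lemma Ck_iff_admissible:
  "\<gamma> \<in> Ck k U E \<longleftrightarrow> (\<forall>x. x \<notin> U \<longrightarrow> \<gamma> x = 0) \<and>
    (\<forall>is. admissible k is \<longrightarrow> iter_pderiv_exists E U is \<gamma> \<and>
      continuous_map (top_of_set U) (tvs_topology E) (iter_pderiv E U is \<gamma>))"
  unfolding Ck_def partial_deriv_def partial_deriv_exists_def
  by (simp add: all_multi_indices_iff[where Q = "\<lambda>is. iter_pderiv_exists E U is \<gamma> \<and>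
      continuous_map (top_of_set U) (tvs_topology E) (iter_pderiv E U is \<gamma>)"])

definition iter_pderiv2 ::
  "('k::real_normed_field, 'e::ab_group_add) tvs \<Rightarrow> ('n::finite) rvec set \<Rightarrow> ('m::finite) rvec set \<Rightarrow>
   'n list \<Rightarrow> 'm list \<Rightarrow> ('n rvec \<times> 'm rvec \<Rightarrow> 'e) \<Rightarrow> 'n rvec \<times> 'm rvec \<Rightarrow> 'e" where
  "iter_pderiv2 E U V is js \<gamma> =
     (\<lambda>(x, y). iter_pderiv E U is (\<lambda>x'. iter_pderiv E V js (\<lambda>y'. \<gamma> (x', y')) y) x)"

lemma partial_deriv2_eq: "partial_deriv2 E U V \<alpha> \<beta> = iter_pderiv2 E U V (mi_list \<alpha>) (mi_list \<beta>)"
  by (simp add: fun_eq_iff partial_deriv2_def partial_deriv_def iter_pderiv2_def)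

lemma Ckl_iff_admissible:
  "\<gamma> \<in> Ckl k l U V E \<longleftrightarrow> (\<forall>z. z \<notin> U \<times> V \<longrightarrow> \<gamma> z = 0) \<and>
    (\<forall>is js. admissible k is \<longrightarrow> admissible l js \<longrightarrow>
      (\<forall>x\<in>U. iter_pderiv_exists E V js (\<lambda>y. \<gamma> (x, y))) \<and>
      (\<forall>y\<in>V. iter_pderiv_exists E U is (\<lambda>x. iter_pderiv E V js (\<lambda>y'. \<gamma> (x, y')) y)) \<and>
      continuous_map (top_of_set (U \<times> V)) (tvs_topology E) (iter_pderiv2 E U V is js \<gamma>))"
proof -
  define Q where "Q is js \<longleftrightarrow>
      (\<forall>x\<in>U. iter_pderiv_exists E V js (\<lambda>y. \<gamma> (x, y))) \<and>
      (\<forall>y\<in>V. iter_pderiv_exists E U is (\<lambda>x. iter_pderiv E V js (\<lambda>y'. \<gamma> (x, y')) y)) \<and>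
      continuous_map (top_of_set (U \<times> V)) (tvs_topology E) (iter_pderiv2 E U V is js \<gamma>)" for "is" js
  have "\<gamma> \<in> Ckl k l U V E \<longleftrightarrow> (\<forall>z. z \<notin> U \<times> V \<longrightarrow> \<gamma> z = 0) \<and>
      (\<forall>\<alpha>. enat (mi_order \<alpha>) \<le> k \<longrightarrow> (\<forall>\<beta>. enat (mi_order \<beta>) \<le> l \<longrightarrow> Q (mi_list \<alpha>) (mi_list \<beta>)))"
    unfolding Ckl_def Q_def partial_deriv2_exists_def partial_deriv_exists_def partial_deriv2_eq
      partial_deriv_def by auto
  then show ?thesis
    unfolding all_multi_indices_iff[where Q = "Q i" for i]
      all_multi_indices_iff[where Q = "\<lambda>is. \<forall>js. admissible l js \<longrightarrow> Q is js"]
    unfolding Q_def by blast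
qed

context seminormed_tvs
begin

lemma pderiv_onI: "has_pderiv E i \<gamma> x d \<Longrightarrow> x \<in> U \<Longrightarrow> pderiv_on E U i \<gamma> x = d"
  unfolding pderiv_on_def by (auto intro: has_pderiv_unique)

lemma iter_pderiv_has_pderiv:
  "iter_pderiv_exists E U (i # is) \<gamma> \<Longrightarrow> x \<in> U \<Longrightarrow>
    has_pderiv E i (iter_pderiv E U is \<gamma>) x (iter_pderiv E U (i # is) \<gamma> x)"
  using pderiv_onI by (fastforce simp del: pderiv_on_def)

text \<open>
  The principle by which all iterated derivatives below are computed: a family \<open>D\<close> whose members
  are derivatives of each other on \<open>U\<close> consists of the iterated derivatives of \<open>D []\<close>. Equality
  on \<open>U\<close> passes to derivatives because \<open>U\<close> is open and limits are unique.
\<close>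

lemma iter_pderiv_family:
  fixes U :: "('n::{finite,linorder}) rvec set"
  assumes U: "open U" and base: "\<And>x. x \<in> U \<Longrightarrow> D [] x = \<gamma> x"
    and step: "\<And>i js x. admissible k (i # js) \<Longrightarrow> x \<in> U \<Longrightarrow> has_pderiv E i (D js) x (D (i # js) x)"
  shows "admissible k is \<Longrightarrow>
    iter_pderiv_exists E U is \<gamma> \<and> (\<forall>x\<in>U. iter_pderiv E U is \<gamma> x = D is x)"
proof (induction "is")
  case Nil
  then show ?case using base by simp
next
  case (Cons i "is")
  have IH: "iter_pderiv_exists E U is \<gamma>" "\<And>x. x \<in> U \<Longrightarrow> iter_pderiv E U is \<gamma> x = D is x"
    using Cons admissible_ConsD by blast+
  have "has_pderiv E i (iter_pderiv E U is \<gamma>) x (D (i # is) x)" if "x \<in> U" for x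
    by (rule has_pderiv_cong[OF U that IH(2)[symmetric] step[OF Cons.prems that]])
  then show ?case using IH(1) by (auto intro: pderiv_onI)
qed

lemma CkI:
  fixes U :: "('n::{finite,linorder}) rvec set"
  assumes U: "open U" and base: "\<And>x. x \<in> U \<Longrightarrow> D [] x = \<gamma> x"
    and step: "\<And>i js x. admissible k (i # js) \<Longrightarrow> x \<in> U \<Longrightarrow> has_pderiv E i (D js) x (D (i # js) x)"
    and zero: "\<And>x. x \<notin> U \<Longrightarrow> \<gamma> x = 0"
    and cont: "\<And>is. admissible k is \<Longrightarrow> continuous_map (top_of_set U) (tvs_topology E) (D is)"
  shows "\<gamma> \<in> Ck k U E"
  unfolding Ck_iff_admissible
proof (intro conjI allI impI)
  fix "is" :: "'n list" assume a: "admissible k is"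
  note * = iter_pderiv_family[of U D \<gamma> k, OF U base step a]
  show "iter_pderiv_exists E U is \<gamma>" using * by blast
  show "continuous_map (top_of_set U) (tvs_topology E) (iter_pderiv E U is \<gamma>)"
    using * by (intro continuous_map_eq[OF cont[OF a]]) simp
qed (fact zero)

context
  fixes U :: "('n::{finite,linorder}) rvec set" and k \<gamma>
  assumes \<gamma>: "\<gamma> \<in> Ck k U E"
begin

lemma Ck_zero: "x \<notin> U \<Longrightarrow> \<gamma> x = 0"
  and Ck_continuous: "admissible k is \<Longrightarrow>
    continuous_map (top_of_set U) (tvs_topology E) (iter_pderiv E U is \<gamma>)"
  using \<gamma> by (simp_all add: Ck_iff_admissible)

lemma Ck_has_pderiv: "admissible k (i # is) \<Longrightarrow> x \<in> U \<Longrightarrow>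
    has_pderiv E i (iter_pderiv E U is \<gamma>) x (iter_pderiv E U (i # is) \<gamma> x)"
  using \<gamma> iter_pderiv_has_pderiv unfolding Ck_iff_admissible by blast

lemma Ck_carrier: "admissible k is \<Longrightarrow> x \<in> U \<Longrightarrow> iter_pderiv E U is \<gamma> x \<in> tvs_carrier E"
  using Ck_continuous by (rule continuous_map_in_carrier)

end

lemma Ck_linear:
  fixes U :: "('n::{finite,linorder}) rvec set"
  assumes U: "open U" and \<gamma>: "\<gamma> \<in> Ck k U E" and \<eta>: "\<eta> \<in> Ck k U E"
  shows "\<gamma> + \<eta> \<in> Ck k U E"
    and "(\<lambda>x. tvs_scale E c (\<gamma> x)) \<in> Ck k U E"
    and "admissible k is \<Longrightarrow> x \<in> U \<Longrightarrow>
      iter_pderiv E U is (\<gamma> + \<eta>) x = iter_pderiv E U is \<gamma> x + iter_pderiv E U is \<eta> x"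
    and "admissible k is \<Longrightarrow> x \<in> U \<Longrightarrow>
      iter_pderiv E U is (\<lambda>x. tvs_scale E c (\<gamma> x)) x = tvs_scale E c (iter_pderiv E U is \<gamma> x)"
proof -
  let ?D = "\<lambda>is x. iter_pderiv E U is \<gamma> x + iter_pderiv E U is \<eta> x"
  have base: "?D [] x = (\<gamma> + \<eta>) x" for x by simp
  have step: "has_pderiv E i (?D is) x (?D (i # is) x)" if "admissible k (i # is)" "x \<in> U" for i "is" x
    using that by (intro has_pderiv_add Ck_has_pderiv[OF \<gamma>] Ck_has_pderiv[OF \<eta>])
  show "\<gamma> + \<eta> \<in> Ck k U E"
    by (rule CkI[of U ?D, OF U base step])
      (simp_all add: continuous_map_add Ck_continuous[OF \<gamma>] Ck_continuous[OF \<eta>] Ck_zero[OF \<gamma>] Ck_zero[OF \<eta>])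
  show "iter_pderiv E U is (\<gamma> + \<eta>) x = ?D is x" if "admissible k is" "x \<in> U"
    using iter_pderiv_family[of U ?D "\<gamma> + \<eta>", OF U base step that(1)] that(2) by simp
  let ?S = "\<lambda>is x. tvs_scale E c (iter_pderiv E U is \<gamma> x)"
  have base: "?S [] x = tvs_scale E c (\<gamma> x)" for x by simp
  have step: "has_pderiv E i (?S is) x (?S (i # is) x)" if "admissible k (i # is)" "x \<in> U" for i "is" x
    using that by (intro has_pderiv_scale Ck_has_pderiv[OF \<gamma>])
  show "(\<lambda>x. tvs_scale E c (\<gamma> x)) \<in> Ck k U E"
    by (rule CkI[of U ?S, OF U base step])
      (simp_all add: continuous_map_scale Ck_continuous[OF \<gamma>] Ck_zero[OF \<gamma>])
  show "iter_pderiv E U is (\<lambda>x. tvs_scale E c (\<gamma> x)) x = ?S is x" if "admissible k is" "x \<in> U"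
    using iter_pderiv_family[of U ?S, OF U base step that(1)] that(2) by simp
qed

context
  fixes U :: "('n::{finite,linorder}) rvec set" and V :: "('m::{finite,linorder}) rvec set"
    and k l :: enat and G :: "'n list \<Rightarrow> 'm list \<Rightarrow> 'n rvec \<times> 'm rvec \<Rightarrow> 'e" and \<gamma>
  assumes UV: "open U" "open V"
    and base: "\<And>x y. x \<in> U \<Longrightarrow> y \<in> V \<Longrightarrow> G [] [] (x, y) = \<gamma> (x, y)"
    and dy: "\<And>j js x y. admissible l (j # js) \<Longrightarrow> x \<in> U \<Longrightarrow> y \<in> V \<Longrightarrow>
      has_pderiv E j (\<lambda>y. G [] js (x, y)) y (G [] (j # js) (x, y))"
    and dx: "\<And>i is js x y. admissible k (i # is) \<Longrightarrow> admissible l js \<Longrightarrow> x \<in> U \<Longrightarrow> y \<in> V \<Longrightarrow>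
      has_pderiv E i (\<lambda>x. G is js (x, y)) x (G (i # is) js (x, y))"
begin

lemma iter_pderiv2_family:
  assumes "is": "admissible k is" and js: "admissible l js"
  shows "x \<in> U \<Longrightarrow> iter_pderiv_exists E V js (\<lambda>y. \<gamma> (x, y))"
    and "y \<in> V \<Longrightarrow> iter_pderiv_exists E U is (\<lambda>x. iter_pderiv E V js (\<lambda>y'. \<gamma> (x, y')) y)"
    and "z \<in> U \<times> V \<Longrightarrow> iter_pderiv2 E U V is js \<gamma> z = G is js z"
proof -
  have y: "iter_pderiv_exists E V js (\<lambda>y. \<gamma> (x, y)) \<and>
      (\<forall>y\<in>V. iter_pderiv E V js (\<lambda>y. \<gamma> (x, y)) y = G [] js (x, y))" if "x \<in> U" for x
    by (rule iter_pderiv_family[where k = l and D = "\<lambda>js y. G [] js (x, y)", OF UV(2) _ _ js])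
      (simp_all add: that base dy)
  then show "x \<in> U \<Longrightarrow> iter_pderiv_exists E V js (\<lambda>y. \<gamma> (x, y))" by blast
  have x: "iter_pderiv_exists E U is (\<lambda>x. iter_pderiv E V js (\<lambda>y'. \<gamma> (x, y')) y) \<and>
      (\<forall>x\<in>U. iter_pderiv E U is (\<lambda>x. iter_pderiv E V js (\<lambda>y'. \<gamma> (x, y')) y) x = G is js (x, y))"
    if "y \<in> V" for y
    by (rule iter_pderiv_family[where k = k and D = "\<lambda>is x. G is js (x, y)", OF UV(1) _ _ "is"])
      (simp_all add: that y dx js)
  then show "y \<in> V \<Longrightarrow> iter_pderiv_exists E U is (\<lambda>x. iter_pderiv E V js (\<lambda>y'. \<gamma> (x, y')) y)"
    by blast
  show "z \<in> U \<times> V \<Longrightarrow> iter_pderiv2 E U V is js \<gamma> z = G is js z"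
    using x by (auto simp: iter_pderiv2_def)
qed

lemma CklI:
  assumes zero: "\<And>z. z \<notin> U \<times> V \<Longrightarrow> \<gamma> z = 0"
    and cont: "\<And>is js. admissible k is \<Longrightarrow> admissible l js \<Longrightarrow>
      continuous_map (top_of_set (U \<times> V)) (tvs_topology E) (G is js)"
  shows "\<gamma> \<in> Ckl k l U V E"
  unfolding Ckl_iff_admissible
proof (intro conjI allI impI ballI)
  fix "is" :: "'n list" and js :: "'m list" assume *: "admissible k is" "admissible l js"
  show "iter_pderiv_exists E V js (\<lambda>y. \<gamma> (x, y))" if "x \<in> U" for x
    using iter_pderiv2_family(1)[OF * that] .
  show "iter_pderiv_exists E U is (\<lambda>x. iter_pderiv E V js (\<lambda>y'. \<gamma> (x, y')) y)" if "y \<in> V" for y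
    using iter_pderiv2_family(2)[OF * that] .
  show "continuous_map (top_of_set (U \<times> V)) (tvs_topology E) (iter_pderiv2 E U V is js \<gamma>)"
    using iter_pderiv2_family(3)[OF *] by (intro continuous_map_eq[OF cont[OF *]]) simp
qed (fact zero)

end

context
  fixes U :: "('n::{finite,linorder}) rvec set" and V :: "('m::{finite,linorder}) rvec set"
    and k l \<gamma>
  assumes UV: "open U" "open V" and \<gamma>: "\<gamma> \<in> Ckl k l U V E"
begin

lemma Ckl_zero: "z \<notin> U \<times> V \<Longrightarrow> \<gamma> z = 0"
  and Ckl_continuous: "admissible k is \<Longrightarrow> admissible l js \<Longrightarrow>
    continuous_map (top_of_set (U \<times> V)) (tvs_topology E) (iter_pderiv2 E U V is js \<gamma>)"
  using \<gamma> unfolding Ckl_iff_admissible by blast+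

lemma Ckl_carrier: "admissible k is \<Longrightarrow> admissible l js \<Longrightarrow> z \<in> U \<times> V \<Longrightarrow>
    iter_pderiv2 E U V is js \<gamma> z \<in> tvs_carrier E"
  using Ckl_continuous by (rule continuous_map_in_carrier)

lemma Ckl_has_pderiv_snd:
  assumes "admissible l (j # js)" "x \<in> U" "y \<in> V"
  shows "has_pderiv E j (\<lambda>y. iter_pderiv2 E U V [] js \<gamma> (x, y)) y
    (iter_pderiv2 E U V [] (j # js) \<gamma> (x, y))"
proof -
  have "iter_pderiv_exists E V (j # js) (\<lambda>y. \<gamma> (x, y))"
    using \<gamma> assms admissible_Nil[of k] unfolding Ckl_iff_admissible by blast
  from iter_pderiv_has_pderiv[OF this assms(3)] show ?thesis by (simp add: iter_pderiv2_def)
qed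

lemma Ckl_has_pderiv_fst:
  assumes "admissible k (i # is)" "admissible l js" "x \<in> U" "y \<in> V"
  shows "has_pderiv E i (\<lambda>x. iter_pderiv2 E U V is js \<gamma> (x, y)) x
    (iter_pderiv2 E U V (i # is) js \<gamma> (x, y))"
proof -
  have "iter_pderiv_exists E U (i # is) (\<lambda>x. iter_pderiv E V js (\<lambda>y'. \<gamma> (x, y')) y)"
    using \<gamma> assms unfolding Ckl_iff_admissible by blast
  from iter_pderiv_has_pderiv[OF this assms(3)] show ?thesis by (simp add: iter_pderiv2_def)
qed

text \<open>
  The definition of \<open>C\<^sup>k\<^sup>,\<^sup>l\<close> only provides derivatives in \<open>y\<close> before any derivative in \<open>x\<close>. Each
  further derivative in \<open>x\<close> is moved past one derivative in \<open>y\<close> by Schwarz's theorem.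
\<close>

lemma Ckl_has_pderiv_snd_any:
  "admissible k is \<Longrightarrow> admissible l (j # js) \<Longrightarrow> x \<in> U \<Longrightarrow> y \<in> V \<Longrightarrow>
    has_pderiv E j (\<lambda>y. iter_pderiv2 E U V is js \<gamma> (x, y)) y
      (iter_pderiv2 E U V is (j # js) \<gamma> (x, y))"
proof (induction "is" arbitrary: x y)
  case Nil
  then show ?case by (intro Ckl_has_pderiv_snd)
next
  case (Cons i "is")
  note "is" = admissible_ConsD[OF Cons.prems(1)] and js = admissible_ConsD[OF Cons.prems(2)]
  let ?g = "\<lambda>is js x y. iter_pderiv2 E U V is js \<gamma> (x, y)"
  show ?case
  proof (rule mixed_derivatives_commute[OF UV Cons.prems(3,4), of "?g is js" j
        "?g is (j # js)" i "?g (i # is) js"])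
    show "?g is js x y \<in> tvs_carrier E" if "x \<in> U" "y \<in> V" for x y
      using that "is" js by (simp add: Ckl_carrier)
    show "has_pderiv E j (?g is js x) y (?g is (j # js) x y)" if "x \<in> U" "y \<in> V" for x y
      using Cons.IH[OF "is" Cons.prems(2) that] .
    show "has_pderiv E i (\<lambda>x. ?g is js x y) x (?g (i # is) js x y)" if "x \<in> U" "y \<in> V" for x y
      using Ckl_has_pderiv_fst[OF Cons.prems(1) js that] .
    show "has_pderiv E i (\<lambda>x. ?g is (j # js) x y) x (?g (i # is) (j # js) x y)"
      if "x \<in> U" "y \<in> V" for x y
      using Ckl_has_pderiv_fst[OF Cons.prems(1,2) that] .
    show "continuous_map (top_of_set (U \<times> V)) (tvs_topology E) (\<lambda>(x, y). ?g (i # is) (j # js) x y)"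
      using Ckl_continuous[OF Cons.prems(1,2)] by simp
  qed
qed

end

lemma Ckl_linear:
  fixes U :: "('n::{finite,linorder}) rvec set" and V :: "('m::{finite,linorder}) rvec set"
  assumes UV: "open U" "open V" and \<gamma>: "\<gamma> \<in> Ckl k l U V E" and \<eta>: "\<eta> \<in> Ckl k l U V E"
  shows "\<gamma> + \<eta> \<in> Ckl k l U V E"
    and "(\<lambda>z. tvs_scale E c (\<gamma> z)) \<in> Ckl k l U V E"
    and "admissible k is \<Longrightarrow> admissible l js \<Longrightarrow> z \<in> U \<times> V \<Longrightarrow>
      iter_pderiv2 E U V is js (\<gamma> + \<eta>) z = iter_pderiv2 E U V is js \<gamma> z + iter_pderiv2 E U V is js \<eta> z"
    and "admissible k is \<Longrightarrow> admissible l js \<Longrightarrow> z \<in> U \<times> V \<Longrightarrow>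
      iter_pderiv2 E U V is js (\<lambda>z. tvs_scale E c (\<gamma> z)) z = tvs_scale E c (iter_pderiv2 E U V is js \<gamma> z)"
proof -
  let ?D = "\<lambda>is js z. iter_pderiv2 E U V is js \<gamma> z + iter_pderiv2 E U V is js \<eta> z"
  have base: "?D [] [] (x, y) = (\<gamma> + \<eta>) (x, y)" for x y by (simp add: iter_pderiv2_def)
  have dy: "has_pderiv E j (\<lambda>y. ?D [] js (x, y)) y (?D [] (j # js) (x, y))"
    if "admissible l (j # js)" "x \<in> U" "y \<in> V" for j js x y
    using that by (intro has_pderiv_add Ckl_has_pderiv_snd[OF UV \<gamma>] Ckl_has_pderiv_snd[OF UV \<eta>])
  have dx: "has_pderiv E i (\<lambda>x. ?D is js (x, y)) x (?D (i # is) js (x, y))"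
    if "admissible k (i # is)" "admissible l js" "x \<in> U" "y \<in> V" for i "is" js x y
    using that by (intro has_pderiv_add Ckl_has_pderiv_fst[OF UV \<gamma>] Ckl_has_pderiv_fst[OF UV \<eta>])
  show "\<gamma> + \<eta> \<in> Ckl k l U V E"
    by (rule CklI[of U V ?D, OF UV base dy dx])
      (auto simp: Ckl_zero[OF UV \<gamma>] Ckl_zero[OF UV \<eta>] simp del: mem_Sigma_iff
        intro!: continuous_map_add Ckl_continuous[OF UV \<gamma>] Ckl_continuous[OF UV \<eta>])
  show "iter_pderiv2 E U V is js (\<gamma> + \<eta>) z = ?D is js z"
    if "admissible k is" "admissible l js" "z \<in> U \<times> V"
    by (rule iter_pderiv2_family(3)[of U V ?D, OF UV base dy dx that])
  let ?S = "\<lambda>is js z. tvs_scale E c (iter_pderiv2 E U V is js \<gamma> z)"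
  have base: "?S [] [] (x, y) = tvs_scale E c (\<gamma> (x, y))" for x y by (simp add: iter_pderiv2_def)
  have dy: "has_pderiv E j (\<lambda>y. ?S [] js (x, y)) y (?S [] (j # js) (x, y))"
    if "admissible l (j # js)" "x \<in> U" "y \<in> V" for j js x y
    using that by (intro has_pderiv_scale Ckl_has_pderiv_snd[OF UV \<gamma>])
  have dx: "has_pderiv E i (\<lambda>x. ?S is js (x, y)) x (?S (i # is) js (x, y))"
    if "admissible k (i # is)" "admissible l js" "x \<in> U" "y \<in> V" for i "is" js x y
    using that by (intro has_pderiv_scale Ckl_has_pderiv_fst[OF UV \<gamma>])
  show "(\<lambda>z. tvs_scale E c (\<gamma> z)) \<in> Ckl k l U V E"
    by (rule CklI[of U V ?S, OF UV base dy dx])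
      (auto simp: Ckl_zero[OF UV \<gamma>] simp del: mem_Sigma_iff
        intro!: continuous_map_scale Ckl_continuous[OF UV \<gamma>])
  show "iter_pderiv2 E U V is js (\<lambda>z. tvs_scale E c (\<gamma> z)) z = ?S is js z"
    if "admissible k is" "admissible l js" "z \<in> U \<times> V"
    by (rule iter_pderiv2_family(3)[of U V ?S, OF UV base dy dx that])
qed

end

section \<open>Weighted suprema and the weighted function spaces\<close>

definition weighted_sup :: "'x set \<Rightarrow> ('x \<Rightarrow> real) \<Rightarrow> ('e \<Rightarrow> real) \<Rightarrow> ('x \<Rightarrow> 'e) \<Rightarrow> ennreal" where
  "weighted_sup X f q \<eta> = (SUP x\<in>X. ennreal (f x * q (\<eta> x)))"

lemma weighted_sup_le: "(\<And>x. x \<in> X \<Longrightarrow> f x * q (\<eta> x) \<le> B) \<Longrightarrow> weighted_sup X f q \<eta> \<le> ennreal B"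
  unfolding weighted_sup_def by (auto intro!: SUP_least ennreal_leI)

lemma weighted_sup_ge:
  assumes "weighted_sup X f q \<eta> < \<infinity>" "x \<in> X"
  shows "f x * q (\<eta> x) \<le> enn2real (weighted_sup X f q \<eta>)"
proof -
  have "ennreal (f x * q (\<eta> x)) \<le> weighted_sup X f q \<eta>"
    unfolding weighted_sup_def using assms(2) by (rule SUP_upper)
  then show ?thesis
    using assms(1) by (cases "weighted_sup X f q \<eta>") (auto simp: ennreal_le_iff)
qed

text \<open>
  One proof serves the weighted spaces over \<open>U\<close>, over \<open>V\<close> and over \<open>U \<times> V\<close>. All of them consist of
  functions on a set \<open>X\<close> for which a set of linear operators \<open>L\<close>, the iterated partial derivatives,
  has finite weighted suprema. The identity is among the operators, so the positivity of weights
  separates points.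
\<close>

definition weighted_seminorms ::
  "('k::real_normed_field, 'e::ab_group_add) tvs \<Rightarrow> 'x set \<Rightarrow> ('x \<Rightarrow> real) set \<Rightarrow>
    (('x \<Rightarrow> 'e) \<Rightarrow> 'x \<Rightarrow> 'e) set \<Rightarrow> (('x \<Rightarrow> 'e) \<Rightarrow> ennreal) set" where
  "weighted_seminorms E X W Ops =
    {\<lambda>\<gamma>. weighted_sup X f q (L \<gamma>) |f q L. f \<in> W \<and> q \<in> continuous_seminorms E \<and> L \<in> Ops}"

lemma (in seminormed_tvs) weighted_seminorm_family:
  fixes S0 :: "('x \<Rightarrow> 'e) set"
  assumes zero_closed: "0 \<in> S0"
    and add_closed: "\<And>\<gamma> \<eta>. \<gamma> \<in> S0 \<Longrightarrow> \<eta> \<in> S0 \<Longrightarrow> \<gamma> + \<eta> \<in> S0"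
    and scale_closed: "\<And>c \<gamma>. \<gamma> \<in> S0 \<Longrightarrow> (\<lambda>x. tvs_scale E c (\<gamma> x)) \<in> S0"
    and carrier: "\<And>L \<gamma> x. L \<in> Ops \<Longrightarrow> \<gamma> \<in> S0 \<Longrightarrow> x \<in> X \<Longrightarrow> L \<gamma> x \<in> tvs_carrier E"
    and add: "\<And>L \<gamma> \<eta> x. L \<in> Ops \<Longrightarrow> \<gamma> \<in> S0 \<Longrightarrow> \<eta> \<in> S0 \<Longrightarrow> x \<in> X \<Longrightarrow> L (\<gamma> + \<eta>) x = L \<gamma> x + L \<eta> x"
    and scale: "\<And>L c \<gamma> x. L \<in> Ops \<Longrightarrow> \<gamma> \<in> S0 \<Longrightarrow> x \<in> X \<Longrightarrow>
      L (\<lambda>x. tvs_scale E c (\<gamma> x)) x = tvs_scale E c (L \<gamma> x)"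
    and ident: "(\<lambda>\<gamma>. \<gamma>) \<in> Ops"
    and off: "\<And>\<gamma> x. \<gamma> \<in> S0 \<Longrightarrow> x \<notin> X \<Longrightarrow> \<gamma> x = 0"
    and nonneg: "\<And>f x. f \<in> W \<Longrightarrow> x \<in> X \<Longrightarrow> 0 \<le> f x"
    and pos: "\<And>x. x \<in> X \<Longrightarrow> \<exists>f\<in>W. 0 < f x"
  shows "seminorm_family (\<lambda>c \<gamma> x. tvs_scale E c (\<gamma> x))
    {\<gamma> \<in> S0. \<forall>p\<in>weighted_seminorms E X W Ops. p \<gamma> < \<infinity>} (weighted_seminorms E X W Ops)"
proof -
  let ?P = "weighted_seminorms E X W Ops"
  let ?S = "{\<gamma> \<in> S0. \<forall>p\<in>?P. p \<gamma> < \<infinity>}"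
  let ?s = "\<lambda>c \<gamma> x. tvs_scale E c (\<gamma> x :: 'e)"
  interpret F: vector_space ?s
    by unfold_locales (simp_all add: fun_eq_iff scale_right_distrib scale_left_distrib)
  have tri: "p (\<gamma> + \<eta>) \<le> p \<gamma> + p \<eta>" if p: "p \<in> ?P" and g: "\<gamma> \<in> S0" "\<eta> \<in> S0" for p \<gamma> \<eta>
  proof -
    obtain f q L where f: "f \<in> W" and q: "q \<in> continuous_seminorms E" and L: "L \<in> Ops"
      and p: "p = (\<lambda>\<gamma>. weighted_sup X f q (L \<gamma>))"
      using p unfolding weighted_seminorms_def by blast
    show ?thesis
      unfolding p weighted_sup_def
    proof (rule SUP_least)
      fix x assume x: "x \<in> X"
      have c: "L \<gamma> x \<in> tvs_carrier E" "L \<eta> x \<in> tvs_carrier E" using carrier L g x by auto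
      have "ennreal (f x * q (L (\<gamma> + \<eta>) x)) \<le> ennreal (f x * q (L \<gamma> x) + f x * q (L \<eta> x))"
        using mult_left_mono[OF csn_triangle[OF q c] nonneg[OF f x]] add[OF L g x]
        by (intro ennreal_leI) (simp add: distrib_left)
      also have "\<dots> = ennreal (f x * q (L \<gamma> x)) + ennreal (f x * q (L \<eta> x))"
        using csn_nonneg[OF q] c nonneg[OF f x] by simp
      also have "\<dots> \<le> (SUP x\<in>X. ennreal (f x * q (L \<gamma> x))) + (SUP x\<in>X. ennreal (f x * q (L \<eta> x)))"
        using x by (intro add_mono SUP_upper)
      finally show "ennreal (f x * q (L (\<gamma> + \<eta>) x)) \<le>
          (SUP x\<in>X. ennreal (f x * q (L \<gamma> x))) + (SUP x\<in>X. ennreal (f x * q (L \<eta> x)))" .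
    qed
  qed
  have hom: "p (?s c \<gamma>) = ennreal (norm c) * p \<gamma>" if p: "p \<in> ?P" and g: "\<gamma> \<in> S0" for p c \<gamma>
  proof -
    obtain f q L where f: "f \<in> W" and q: "q \<in> continuous_seminorms E" and L: "L \<in> Ops"
      and p: "p = (\<lambda>\<gamma>. weighted_sup X f q (L \<gamma>))"
      using p unfolding weighted_seminorms_def by blast
    have "ennreal (f x * q (L (?s c \<gamma>) x)) = ennreal (norm c) * ennreal (f x * q (L \<gamma> x))"
      if x: "x \<in> X" for x
      using scale[OF L g x] csn_scale[OF q carrier[OF L g x], of c]
      by (simp add: ennreal_mult'[symmetric] mult.left_commute)
    then show ?thesis
      unfolding p weighted_sup_def SUP_mult_left_ennreal by (intro SUP_cong refl)
  qed
  have S_zero: "p 0 < \<infinity>" if "p \<in> ?P" for p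
  proof -
    have "?s 0 0 = (0 :: 'x \<Rightarrow> 'e)" by (simp add: fun_eq_iff)
    then show ?thesis using hom[OF that zero_closed, of 0] by simp
  qed
  show ?thesis
  proof (intro seminorm_family.intro seminorm_family_axioms.intro F.vector_space_axioms)
    show "F.subspace ?S"
    proof (intro F.subspaceI)
      show "0 \<in> ?S" using zero_closed S_zero by simp
      show "\<gamma> + \<eta> \<in> ?S" if "\<gamma> \<in> ?S" "\<eta> \<in> ?S" for \<gamma> \<eta>
        using that add_closed le_less_trans[OF tri] by simp
      show "?s c \<gamma> \<in> ?S" if g: "\<gamma> \<in> ?S" for c \<gamma>
      proof -
        have "p (?s c \<gamma>) < \<infinity>" if "p \<in> ?P" for p
        proof -
          have "p (?s c \<gamma>) = ennreal (norm c) * p \<gamma>" using g that by (intro hom) auto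
          then show ?thesis using g that by (simp add: ennreal_mult_less_top)
        qed
        then show ?thesis using g scale_closed by simp
      qed
    qed
    show "\<exists>p\<in>?P. p \<gamma> \<noteq> 0" if g: "\<gamma> \<in> ?S" and nz: "\<gamma> \<noteq> 0" for \<gamma>
    proof -
      obtain x where x: "\<gamma> x \<noteq> 0" using nz by (auto simp: fun_eq_iff)
      then have xX: "x \<in> X" using off g by auto
      then obtain f where f: "f \<in> W" "0 < f x" using pos by blast
      have c: "\<gamma> x \<in> tvs_carrier E" using carrier[OF ident] g xX by simp
      obtain q where q: "q \<in> continuous_seminorms E" "q (\<gamma> x) \<noteq> 0" using separating[OF c x] by blast
      have "0 < ennreal (f x * q (\<gamma> x))" using f(2) q(2) csn_nonneg[OF q(1) c] by (simp add: less_le)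
      also have "\<dots> \<le> weighted_sup X f q \<gamma>" unfolding weighted_sup_def using xX by (rule SUP_upper)
      finally show ?thesis
        using f(1) q(1) ident
        by (intro bexI[of _ "\<lambda>\<gamma>. weighted_sup X f q \<gamma>"])
          (auto simp: weighted_seminorms_def intro!: exI[of _ f] exI[of _ q] exI[of _ "\<lambda>\<gamma>. \<gamma>"])
    qed
  qed (use tri hom in auto)
qed

lemma CkW_seminorms_eq:
  "CkW_seminorms k W U E = weighted_seminorms E U W (iter_pderiv E U ` {is. admissible k is})"
  unfolding admissible_eq_mi_list image_image CkW_seminorms_def weighted_seminorms_def
    wnorm_def[abs_def] partial_deriv_def weighted_sup_def[symmetric]
  by (intro set_eqI) (simp add: image_iff Bex_def, blast)

lemma CklW_seminorms_eq:
  "CklW_seminorms k l W U V E = weighted_seminorms E (U \<times> V) W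
    ((\<lambda>(is, js). iter_pderiv2 E U V is js) ` ({is. admissible k is} \<times> {js. admissible l js}))"
  unfolding admissible_eq_mi_list CklW_seminorms_def weighted_seminorms_def
    wnorm2_def[abs_def] partial_deriv2_eq weighted_sup_def[symmetric]
  by (intro set_eqI) (simp add: image_iff Bex_def, blast)

context seminormed_tvs
begin

lemma CkW_seminorm_family:
  fixes U :: "('n::{finite,linorder}) rvec set"
  assumes U: "open U" and W: "set_of_weights U W"
  shows "seminorm_family (\<lambda>c \<gamma> x. tvs_scale E c (\<gamma> x))
    {\<gamma> \<in> Ck k U E. \<forall>p\<in>CkW_seminorms k W U E. p \<gamma> < \<infinity>} (CkW_seminorms k W U E)"
  unfolding CkW_seminorms_eq
proof (rule weighted_seminorm_family)
  show "0 \<in> Ck k U E"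
    by (rule CkI[where D = "\<lambda>is x. 0", OF U])
      (simp_all add: has_pderiv_def limitin_def)
  show "(\<lambda>\<gamma>. \<gamma>) \<in> iter_pderiv E U ` {is. admissible k is}"
    by (intro image_eqI[of _ _ "[]"]) (simp_all add: fun_eq_iff)
qed (use W in \<open>auto simp: Ck_linear[OF U] Ck_carrier Ck_zero set_of_weights_def\<close>)

lemma CklW_seminorm_family:
  fixes U :: "('n::{finite,linorder}) rvec set" and V :: "('m::{finite,linorder}) rvec set"
  assumes UV: "open U" "open V" and W: "set_of_weights U W1" "set_of_weights V W2"
  defines "W \<equiv> weights_tensor W1 W2"
  shows "seminorm_family (\<lambda>c \<gamma> x. tvs_scale E c (\<gamma> x))
    {\<gamma> \<in> Ckl k l U V E. \<forall>p\<in>CklW_seminorms k l W U V E. p \<gamma> < \<infinity>} (CklW_seminorms k l W U V E)"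
  unfolding CklW_seminorms_eq
proof (rule weighted_seminorm_family)
  let ?Ops = "(\<lambda>(is, js). iter_pderiv2 E U V is js) ` ({is. admissible k is} \<times> {js. admissible l js})"
  show "0 \<in> Ckl k l U V E"
    by (rule CklI[where G = "\<lambda>is js z. 0", OF UV])
      (simp_all add: has_pderiv_def limitin_def)
  show "(\<lambda>\<gamma>. \<gamma>) \<in> ?Ops"
    by (intro image_eqI[of _ _ "([], [])"]) (simp_all add: fun_eq_iff iter_pderiv2_def)
  show "L \<gamma> z \<in> tvs_carrier E" if "L \<in> ?Ops" "\<gamma> \<in> Ckl k l U V E" "z \<in> U \<times> V" for L \<gamma> z
    using that(1) Ckl_carrier[OF UV that(2) _ _ that(3)] by auto
  show "L (\<gamma> + \<eta>) z = L \<gamma> z + L \<eta> z"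
    if "L \<in> ?Ops" "\<gamma> \<in> Ckl k l U V E" "\<eta> \<in> Ckl k l U V E" "z \<in> U \<times> V" for L \<gamma> \<eta> z
    using that(1) Ckl_linear(3)[OF UV that(2,3) _ _ that(4)] by auto
  show "L (\<lambda>z. tvs_scale E c (\<gamma> z)) z = tvs_scale E c (L \<gamma> z)"
    if "L \<in> ?Ops" "\<gamma> \<in> Ckl k l U V E" "z \<in> U \<times> V" for L c \<gamma> z
    using that(1) Ckl_linear(4)[OF UV that(2) that(2) _ _ that(3)] by auto
  show "0 \<le> f z" if "f \<in> W" "z \<in> U \<times> V" for f z
    using that W by (auto simp: W_def weights_tensor_def set_of_weights_def)
  show "\<exists>f\<in>W. 0 < f z" if "z \<in> U \<times> V" for z
  proof -
    obtain f1 f2 where "f1 \<in> W1" "f1 (fst z) > 0" "f2 \<in> W2" "f2 (snd z) > 0"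
      using W \<open>z \<in> U \<times> V\<close> unfolding set_of_weights_def by (metis mem_Times_iff)
    then show ?thesis
      by (intro bexI[of _ "\<lambda>(x, y). f1 x * f2 y"])
        (auto simp: W_def weights_tensor_def split: prod.split)
  qed
  show "(\<lambda>z. tvs_scale E c (\<gamma> z)) \<in> Ckl k l U V E" if "\<gamma> \<in> Ckl k l U V E" for c \<gamma>
    by (rule Ckl_linear(2)[OF UV that that])
  show "\<gamma> z = 0" if "\<gamma> \<in> Ckl k l U V E" "z \<notin> U \<times> V" for \<gamma> z
    by (rule Ckl_zero[OF UV that])
qed (fact Ckl_linear(1)[OF UV])

end

section \<open>Continuous linear maps\<close>

lemma csn_sum:
  assumes "finite A" "\<And>a. a \<in> A \<Longrightarrow> Q a \<in> continuous_seminorms E"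
  shows "(\<lambda>x. \<Sum>a\<in>A. Q a x) \<in> continuous_seminorms E"
proof (rule continuous_seminormsI)
  note Q = assms(2)[unfolded continuous_seminorms_def]
  show "0 \<le> (\<Sum>a\<in>A. Q a x)" if "x \<in> tvs_carrier E" for x
    using Q that by (intro sum_nonneg) blast
  show "(\<Sum>a\<in>A. Q a (x + y)) \<le> (\<Sum>a\<in>A. Q a x) + (\<Sum>a\<in>A. Q a y)"
    if "x \<in> tvs_carrier E" "y \<in> tvs_carrier E" for x y
    unfolding sum.distrib[symmetric] using Q that by (intro sum_mono) blast
  show "(\<Sum>a\<in>A. Q a (tvs_scale E c x)) = norm c * (\<Sum>a\<in>A. Q a x)" if "x \<in> tvs_carrier E" for c x
    unfolding sum_distrib_left using Q that by (intro sum.cong refl) blast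
  show "continuous_map (tvs_topology E) euclidean (\<lambda>x. \<Sum>a\<in>A. Q a x)"
    using assms(1) Q by (intro continuous_map_sum) auto
qed

lemma (in seminormed_tvs) continuous_linear_mapI:
  assumes E': "seminormed_tvs E'"
    and maps: "\<And>x. x \<in> tvs_carrier E \<Longrightarrow> L x \<in> tvs_carrier E'"
    and diff: "\<And>x y. x \<in> tvs_carrier E \<Longrightarrow> y \<in> tvs_carrier E \<Longrightarrow> L (x - y) = L x - L y"
    and dom: "\<And>q'. q' \<in> continuous_seminorms E' \<Longrightarrow>
      \<exists>q\<in>continuous_seminorms E. \<exists>C\<ge>0. \<forall>x\<in>tvs_carrier E. q' (L x) \<le> C * q x"
  shows "continuous_map (tvs_topology E) (tvs_topology E') L"
proof -
  have "openin (tvs_topology E) {x \<in> tvs_carrier E. L x \<in> N}" if N: "openin (tvs_topology E') N" for N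
  proof (subst openin_subopen, intro ballI)
    fix x assume "x \<in> {x \<in> tvs_carrier E. L x \<in> N}"
    then have x: "x \<in> tvs_carrier E" "L x \<in> N" by auto
    obtain q' r where q': "q' \<in> continuous_seminorms E'" and r: "0 < r"
      and sub: "{y \<in> tvs_carrier E'. q' (y - L x) < r} \<subseteq> N"
      using seminormed_tvs.ball_basis[OF E' N x(2)] by blast
    obtain q C where q: "q \<in> continuous_seminorms E" and C: "0 \<le> C"
      and bound: "\<And>x. x \<in> tvs_carrier E \<Longrightarrow> q' (L x) \<le> C * q x"
      using dom[OF q'] by meson
    define s where "s = r / (C + 1)"
    have s: "0 < s" "C * s < r" using r C by (simp_all add: s_def field_simps)
    have "{y \<in> tvs_carrier E. q (y - x) < s} \<subseteq> {x \<in> tvs_carrier E. L x \<in> N}"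
    proof clarify
      fix y assume y: "y \<in> tvs_carrier E" "q (y - x) < s"
      have "q' (L y - L x) \<le> C * q (y - x)" using bound[of "y - x"] diff y(1) x(1) by simp
      also have "\<dots> \<le> C * s" using y(2) C by (intro mult_left_mono) auto
      also have "\<dots> < r" by (rule s)
      finally show "L y \<in> N" using sub maps[OF y(1)] by auto
    qed
    moreover have "x \<in> {y \<in> tvs_carrier E. q (y - x) < s}" using x s by (simp add: csn_zero[OF q])
    ultimately show "\<exists>T. openin (tvs_topology E) T \<and> x \<in> T \<and> T \<subseteq> {x \<in> tvs_carrier E. L x \<in> N}"
      using ball_open[OF q x(1), of s] by (intro exI conjI)
  qed
  then show ?thesis using maps by (simp add: continuous_map_def Pi_iff)
qed

text \<open>
  In a space given by a family \<open>P\<close>, smallness of each \<open>p \<in> P\<close> makes every continuous seminorm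
  small, since finitely many \<open>p\<close> dominate it.
\<close>

lemma (in seminorm_family) eventually_csn_less:
  assumes q: "q \<in> continuous_seminorms space" and e: "0 < e"
    and g: "\<forall>\<^sub>F h in G. g h \<in> S"
    and small: "\<And>p e. p \<in> P \<Longrightarrow> 0 < e \<Longrightarrow> \<forall>\<^sub>F h in G. real_p p (g h) < e"
  shows "\<forall>\<^sub>F h in G. q (g h) < e"
proof -
  obtain A C where A: "finite A" "A \<subseteq> P" and C: "0 \<le> C"
    and dom: "\<And>x. x \<in> S \<Longrightarrow> q x \<le> C * (\<Sum>p\<in>A. real_p p x)"
    using csn_dominated[OF q] by meson
  define n where "n = C * real (card A) + 1"
  have n: "0 < n" using C by (simp add: n_def add_nonneg_pos)
  have "\<forall>\<^sub>F h in G. \<forall>p\<in>A. real_p p (g h) < e / n"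
    using A small e n by (intro eventually_ball_finite) (auto simp: subset_iff)
  with g show ?thesis
  proof eventually_elim
    case (elim h)
    have "q (g h) \<le> C * (\<Sum>p\<in>A. real_p p (g h))" using dom elim by simp
    also have "\<dots> \<le> C * (\<Sum>p\<in>A. e / n)"
      using elim C by (intro mult_left_mono sum_mono) auto
    also have "\<dots> = C * real (card A) * (e / n)" by simp
    also have "\<dots> < n * (e / n)" using e n by (intro mult_strict_right_mono) (auto simp: n_def)
    finally show ?case using n by simp
  qed
qed

lemma (in seminorm_family) limitin_familyI:
  assumes f: "\<forall>\<^sub>F h in G. f h \<in> S" and l: "l \<in> S"
    and small: "\<And>p e. p \<in> P \<Longrightarrow> 0 < e \<Longrightarrow> \<forall>\<^sub>F h in G. real_p p (f h - l) < e"
  shows "limitin (seminorm_topology S P) f l G"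
proof -
  interpret T: seminormed_tvs space by (rule seminormed_tvs_space)
  have "\<forall>\<^sub>F h in G. f h - l \<in> S" using f by eventually_elim (simp add: l)
  then have "\<forall>\<^sub>F h in G. q (f h - l) < e" if "q \<in> continuous_seminorms space" "0 < e" for q e
    by (rule eventually_csn_less[OF that]) (rule small)
  then show ?thesis using T.limitin_iff[of f G l] f l by simp
qed

lemma (in seminorm_family) continuous_map_familyI:
  assumes f: "\<And>x. x \<in> A \<Longrightarrow> f x \<in> S"
    and small: "\<And>a p e. a \<in> A \<Longrightarrow> p \<in> P \<Longrightarrow> 0 < e \<Longrightarrow> \<forall>\<^sub>F x in at a within A. real_p p (f x - f a) < e"
  shows "continuous_map (top_of_set A) (seminorm_topology S P) f"
proof -
  interpret T: seminormed_tvs space by (rule seminormed_tvs_space)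
  have "\<forall>\<^sub>F x in at a within A. q (f x - f a) < e"
    if "a \<in> A" "q \<in> continuous_seminorms space" "0 < e" for a q e
  proof (rule eventually_csn_less[OF that(2,3)])
    show "\<forall>\<^sub>F x in at a within A. f x - f a \<in> S"
      using f that(1) by (auto simp: eventually_at_filter)
  qed (rule small[OF that(1)])
  then show ?thesis using T.continuous_map_iff[of A f] f by simp
qed

lemma (in seminorm_family) continuous_linear_map_familyI:
  assumes E: "seminormed_tvs E"
    and maps: "\<And>x. x \<in> tvs_carrier E \<Longrightarrow> L x \<in> S"
    and diff: "\<And>x y. x \<in> tvs_carrier E \<Longrightarrow> y \<in> tvs_carrier E \<Longrightarrow> L (x - y) = L x - L y"
    and dom: "\<And>p. p \<in> P \<Longrightarrow>
      \<exists>q\<in>continuous_seminorms E. \<exists>C\<ge>0. \<forall>x\<in>tvs_carrier E. real_p p (L x) \<le> C * q x"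
  shows "continuous_map (tvs_topology E) (seminorm_topology S P) L"
proof -
  interpret E: seminormed_tvs E by (rule E)
  have "continuous_map (tvs_topology E) (tvs_topology space) L"
  proof (rule E.continuous_linear_mapI[OF seminormed_tvs_space])
    fix q' assume "q' \<in> continuous_seminorms space"
    then obtain A C where A: "finite A" "A \<subseteq> P" and C: "0 \<le> C"
      and q': "\<And>x. x \<in> S \<Longrightarrow> q' x \<le> C * (\<Sum>p\<in>A. real_p p x)"
      using csn_dominated by meson
    have "\<forall>p\<in>A. \<exists>q c. q \<in> continuous_seminorms E \<and> 0 \<le> c \<and>
        (\<forall>x\<in>tvs_carrier E. real_p p (L x) \<le> c * q x)"
      using dom A(2) by (meson subsetD)
    then obtain Q c where Q: "\<And>p. p \<in> A \<Longrightarrow> Q p \<in> continuous_seminorms E"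
      and c: "\<And>p. p \<in> A \<Longrightarrow> 0 \<le> c p"
      and bound: "\<And>p x. p \<in> A \<Longrightarrow> x \<in> tvs_carrier E \<Longrightarrow> real_p p (L x) \<le> c p * Q p x"
      by metis
    define K where "K = (\<Sum>p\<in>A. c p)"
    have cK: "c p \<le> K" if "p \<in> A" for p
      unfolding K_def using A(1) c that by (intro member_le_sum) auto
    have "q' (L x) \<le> (C * K) * (\<Sum>p\<in>A. Q p x)" if x: "x \<in> tvs_carrier E" for x
    proof -
      have "q' (L x) \<le> C * (\<Sum>p\<in>A. real_p p (L x))" using q' maps x by simp
      also have "\<dots> \<le> C * (\<Sum>p\<in>A. K * Q p x)"
      proof (intro mult_left_mono sum_mono C)
        fix p assume p: "p \<in> A"
        have "real_p p (L x) \<le> c p * Q p x" by (rule bound[OF p x])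
        also have "\<dots> \<le> K * Q p x"
          using cK[OF p] E.csn_nonneg[OF Q[OF p] x] by (rule mult_right_mono)
        finally show "real_p p (L x) \<le> K * Q p x" .
      qed
      finally show ?thesis by (simp add: sum_distrib_left mult.assoc)
    qed
    moreover have "0 \<le> C * K" using C c by (simp add: K_def sum_nonneg)
    ultimately show "\<exists>q\<in>continuous_seminorms E. \<exists>C\<ge>0. \<forall>x\<in>tvs_carrier E. q' (L x) \<le> C * q x"
      by (intro bexI[OF _ csn_sum[OF A(1) Q]] exI[of _ "C * K"]) auto
  qed (use maps diff in simp_all)
  then show ?thesis by simp
qed

lemma has_pderiv_linear_image:
  fixes x :: "('n::finite) rvec"
  assumes F: "seminormed_tvs F"
    and L: "continuous_map (tvs_topology F) (tvs_topology E) L"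
    and diff: "\<And>a b. a \<in> tvs_carrier F \<Longrightarrow> b \<in> tvs_carrier F \<Longrightarrow> L (a - b) = L a - L b"
    and scale: "\<And>c a. a \<in> tvs_carrier F \<Longrightarrow> L (tvs_scale F c a) = tvs_scale E c (L a)"
    and U: "open U" "x \<in> U" and \<gamma>: "\<And>x. x \<in> U \<Longrightarrow> \<gamma> x \<in> tvs_carrier F"
    and d: "has_pderiv F i \<gamma> x d"
  shows "has_pderiv E i (\<lambda>x. L (\<gamma> x)) x (L d)"
proof -
  interpret F: seminormed_tvs F by (rule F)
  let ?dq = "\<lambda>h::real. tvs_scale F (of_real (1 / h)) (\<gamma> (x + h *\<^sub>R axis i 1) - \<gamma> x)"
  have "limitin (tvs_topology E) (L \<circ> ?dq) (L d) (at 0)"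
    using d unfolding has_pderiv_def by (rule continuous_map_limit[OF L])
  moreover have "\<forall>\<^sub>F h in at 0. (L \<circ> ?dq) h =
      tvs_scale E (of_real (1 / h)) (L (\<gamma> (x + h *\<^sub>R axis i 1)) - L (\<gamma> x))"
    using eventually_shift_in_open[OF U, of i] by eventually_elim (simp add: \<gamma> U diff scale)
  ultimately show ?thesis unfolding has_pderiv_def by (rule limitin_transform_eventually[rotated])
qed

lemma eventually_within_Times:
  fixes a :: "'a::metric_space" and b :: "'b::metric_space"
  shows "\<forall>\<^sub>F x in at a within A. P x \<Longrightarrow> P a \<Longrightarrow> \<forall>\<^sub>F z in at (a, b) within A \<times> B. P (fst z)"
    and "\<forall>\<^sub>F y in at b within B. R y \<Longrightarrow> R b \<Longrightarrow> \<forall>\<^sub>F z in at (a, b) within A \<times> B. R (snd z)"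
proof -
  assume "\<forall>\<^sub>F x in at a within A. P x" and a: "P a"
  then obtain d where d: "d > 0" "\<And>x. x \<in> A \<Longrightarrow> x \<noteq> a \<Longrightarrow> dist x a < d \<Longrightarrow> P x"
    by (auto simp: eventually_at)
  have "P (fst z)" if "z \<in> A \<times> B" "dist z (a, b) < d" for z
    using d(2)[of "fst z"] a that dist_fst_le[of z "(a, b)"] by (cases "fst z = a") auto
  then show "\<forall>\<^sub>F z in at (a, b) within A \<times> B. P (fst z)"
    using d(1) unfolding eventually_at by blast
next
  assume "\<forall>\<^sub>F y in at b within B. R y" and b: "R b"
  then obtain d where d: "d > 0" "\<And>y. y \<in> B \<Longrightarrow> y \<noteq> b \<Longrightarrow> dist y b < d \<Longrightarrow> R y"
    by (auto simp: eventually_at)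
  have "R (snd z)" if "z \<in> A \<times> B" "dist z (a, b) < d" for z
    using d(2)[of "snd z"] b that dist_snd_le[of z "(a, b)"] by (cases "snd z = b") auto
  then show "\<forall>\<^sub>F z in at (a, b) within A \<times> B. R (snd z)"
    using d(1) unfolding eventually_at by blast
qed

lemma (in seminormed_tvs) Ck_diff:
  fixes U :: "('n::{finite,linorder}) rvec set"
  assumes U: "open U" and \<gamma>: "\<gamma> \<in> Ck k U E" and \<eta>: "\<eta> \<in> Ck k U E"
    and "admissible k is" "x \<in> U"
  shows "iter_pderiv E U is (\<gamma> - \<eta>) x = iter_pderiv E U is \<gamma> x - iter_pderiv E U is \<eta> x"
proof -
  let ?m = "\<lambda>x. tvs_scale E (- 1) (\<eta> x)"
  have m: "?m \<in> Ck k U E" by (rule Ck_linear(2)[OF U \<eta> \<eta>])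
  have eq: "\<gamma> - \<eta> = \<gamma> + ?m" by (simp add: fun_eq_iff)
  show ?thesis
    unfolding eq Ck_linear(3)[OF U \<gamma> m assms(4,5)] Ck_linear(4)[OF U \<eta> \<eta> assms(4,5)] by simp
qed

context seminormed_tvs
begin

context
  fixes U :: "('n::{finite,linorder}) rvec set" and W :: "('n rvec \<Rightarrow> real) set" and k :: enat
  assumes U: "open U" and W: "set_of_weights U W"
begin

lemma CkW_carrier_iff:
  "\<gamma> \<in> tvs_carrier (CkW k W U E) \<longleftrightarrow> \<gamma> \<in> Ck k U E \<and> (\<forall>p\<in>CkW_seminorms k W U E. p \<gamma> < \<infinity>)"
  using seminorm_family.topspace_eq[OF CkW_seminorm_family[OF U W, of k]] by (simp add: CkW_def)

lemma CkW_topology: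
  "tvs_topology (CkW k W U E) =
    seminorm_topology (tvs_carrier (CkW k W U E)) (CkW_seminorms k W U E)"
  using seminorm_family.topspace_eq[OF CkW_seminorm_family[OF U W, of k]] by (simp add: CkW_def)

lemma CkW_space:
  "\<lparr>tvs_scale = tvs_scale (CkW k W U E),
    tvs_topology = seminorm_topology (tvs_carrier (CkW k W U E)) (CkW_seminorms k W U E)\<rparr> = CkW k W U E"
  using CkW_topology by simp

lemma CkW_family: "seminorm_family (tvs_scale (CkW k W U E)) (tvs_carrier (CkW k W U E)) (CkW_seminorms k W U E)"
  using CkW_seminorm_family[OF U W, of k] seminorm_family.topspace_eq[OF CkW_seminorm_family[OF U W, of k]]
  by (simp add: CkW_def)

lemma CkW_seminormed: "seminormed_tvs (CkW k W U E)"
  using seminorm_family.seminormed_tvs_space[OF CkW_family] unfolding CkW_space .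

lemma CkW_csn: "p \<in> CkW_seminorms k W U E \<Longrightarrow> (\<lambda>\<eta>. enn2real (p \<eta>)) \<in> continuous_seminorms (CkW k W U E)"
  using seminorm_family.real_p_csn[OF CkW_family] unfolding CkW_space .

end

context
  fixes U :: "('n::{finite,linorder}) rvec set" and V :: "('m::{finite,linorder}) rvec set"
    and W1 :: "('n rvec \<Rightarrow> real) set" and W2 :: "('m rvec \<Rightarrow> real) set" and k l :: enat
  assumes UV: "open U" "open V" and W: "set_of_weights U W1" "set_of_weights V W2"
begin

lemma CklW_carrier_iff:
  "\<gamma> \<in> tvs_carrier (CklW k l (weights_tensor W1 W2) U V E) \<longleftrightarrow> \<gamma> \<in> Ckl k l U V E \<and>
    (\<forall>p\<in>CklW_seminorms k l (weights_tensor W1 W2) U V E. p \<gamma> < \<infinity>)"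
  using seminorm_family.topspace_eq[OF CklW_seminorm_family[OF UV W, of k l]] by (simp add: CklW_def)

lemma CklW_topology:
  "tvs_topology (CklW k l (weights_tensor W1 W2) U V E) =
    seminorm_topology (tvs_carrier (CklW k l (weights_tensor W1 W2) U V E))
      (CklW_seminorms k l (weights_tensor W1 W2) U V E)"
  using seminorm_family.topspace_eq[OF CklW_seminorm_family[OF UV W, of k l]] by (simp add: CklW_def)

lemma CklW_family:
  "seminorm_family (tvs_scale (CklW k l (weights_tensor W1 W2) U V E))
    (tvs_carrier (CklW k l (weights_tensor W1 W2) U V E)) (CklW_seminorms k l (weights_tensor W1 W2) U V E)"
  using CklW_seminorm_family[OF UV W, of k l]
    seminorm_family.topspace_eq[OF CklW_seminorm_family[OF UV W, of k l]]
  by (simp add: CklW_def)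

lemma CklW_space:
  "\<lparr>tvs_scale = tvs_scale (CklW k l (weights_tensor W1 W2) U V E),
    tvs_topology = seminorm_topology (tvs_carrier (CklW k l (weights_tensor W1 W2) U V E))
      (CklW_seminorms k l (weights_tensor W1 W2) U V E)\<rparr> = CklW k l (weights_tensor W1 W2) U V E"
  using CklW_topology by simp

lemma CklW_seminormed: "seminormed_tvs (CklW k l (weights_tensor W1 W2) U V E)"
  using seminorm_family.seminormed_tvs_space[OF CklW_family] unfolding CklW_space .

lemma CklW_csn:
  "p \<in> CklW_seminorms k l (weights_tensor W1 W2) U V E \<Longrightarrow>
    (\<lambda>\<eta>. enn2real (p \<eta>)) \<in> continuous_seminorms (CklW k l (weights_tensor W1 W2) U V E)"
  using seminorm_family.real_p_csn[OF CklW_family] unfolding CklW_space .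

end

end

lemma weighted_sup_in_CkW_seminorms:
  "f \<in> W \<Longrightarrow> q \<in> continuous_seminorms E \<Longrightarrow> admissible k is \<Longrightarrow>
    (\<lambda>\<eta>. weighted_sup U f q (iter_pderiv E U is \<eta>)) \<in> CkW_seminorms k W U E"
  unfolding CkW_seminorms_eq weighted_seminorms_def by blast

lemma CkW_seminorms_cases:
  assumes "p \<in> CkW_seminorms k W U E"
  obtains f q "is" where "f \<in> W" "q \<in> continuous_seminorms E" "admissible k is"
    "p = (\<lambda>\<eta>. weighted_sup U f q (iter_pderiv E U is \<eta>))"
  using assms unfolding CkW_seminorms_eq weighted_seminorms_def by blast

lemma weighted_sup_in_CklW_seminorms:
  "f1 \<in> W1 \<Longrightarrow> f2 \<in> W2 \<Longrightarrow> q \<in> continuous_seminorms E \<Longrightarrow> admissible k is \<Longrightarrow> admissible l js \<Longrightarrow>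
    (\<lambda>\<eta>. weighted_sup (U \<times> V) (\<lambda>(x, y). f1 x * f2 y) q (iter_pderiv2 E U V is js \<eta>)) \<in>
      CklW_seminorms k l (weights_tensor W1 W2) U V E"
  unfolding CklW_seminorms_eq weighted_seminorms_def weights_tensor_def by blast

lemma CklW_seminorms_cases:
  assumes "p \<in> CklW_seminorms k l (weights_tensor W1 W2) U V E"
  obtains f1 f2 q "is" js where "f1 \<in> W1" "f2 \<in> W2" "q \<in> continuous_seminorms E"
    "admissible k is" "admissible l js"
    "p = (\<lambda>\<eta>. weighted_sup (U \<times> V) (\<lambda>(x, y). f1 x * f2 y) q (iter_pderiv2 E U V is js \<eta>))"
proof -
  obtain f q L where f: "f \<in> weights_tensor W1 W2" and q: "q \<in> continuous_seminorms E"
    and L: "L \<in> (\<lambda>(is, js). iter_pderiv2 E U V is js) ` ({is. admissible k is} \<times> {js. admissible l js})"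
    and p: "p = (\<lambda>\<eta>. weighted_sup (U \<times> V) f q (L \<eta>))"
    using assms unfolding CklW_seminorms_eq weighted_seminorms_def by blast
  obtain f1 f2 where "f1 \<in> W1" "f2 \<in> W2" "f = (\<lambda>(x, y). f1 x * f2 y)"
    using f unfolding weights_tensor_def by blast
  moreover obtain "is" js where "admissible k is" "admissible l js" "L = iter_pderiv2 E U V is js"
    using L by auto
  ultimately show ?thesis using that q p by blast
qed

section \<open>The exponential law\<close>

text \<open>
  A weight that is positive at a point is, by continuity, bounded below near it, so that weighted
  seminorms control values locally. The \<open>o\<close>-condition makes such control uniform over \<open>V\<close>.
\<close>

locale weighted_exponential = seminormed_tvs E
  for E :: "('k::real_normed_field, 'e::ab_group_add) tvs" +
  fixes U :: "('n::{finite,linorder}) rvec set" and V :: "('m::{finite,linorder}) rvec set"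
    and k l :: enat and W1 :: "('n rvec \<Rightarrow> real) set" and W2 :: "('m rvec \<Rightarrow> real) set"
  assumes U: "open U" and V: "open V"
    and W1: "set_of_weights U W1" and W2: "set_of_weights V W2"
    and W1_continuous: "\<And>f. f \<in> W1 \<Longrightarrow> continuous_on U f"
    and W2_continuous: "\<And>f. f \<in> W2 \<Longrightarrow> continuous_on V f"
    and W2_o: "o_condition V W2"
begin

abbreviation F :: "('k, 'm rvec \<Rightarrow> 'e) tvs" where
  "F \<equiv> CkW l W2 V E"

abbreviation F_norm :: "('m rvec \<Rightarrow> real) \<Rightarrow> ('e \<Rightarrow> real) \<Rightarrow> 'm list \<Rightarrow> ('m rvec \<Rightarrow> 'e) \<Rightarrow> ennreal" where
  "F_norm f q js \<eta> \<equiv> weighted_sup V f q (iter_pderiv E V js \<eta>)"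

sublocale F: seminormed_tvs F
  by (rule CkW_seminormed[OF V W2])

lemma F_scale: "tvs_scale F = (\<lambda>c \<eta> y. tvs_scale E c (\<eta> y))"
  by (simp add: CkW_def)

lemma F_Ck: "\<eta> \<in> tvs_carrier F \<Longrightarrow> \<eta> \<in> Ck l V E"
  by (simp add: CkW_carrier_iff[OF V W2])

lemma F_norm_csn:
  "f \<in> W2 \<Longrightarrow> q \<in> continuous_seminorms E \<Longrightarrow> admissible l js \<Longrightarrow>
    (\<lambda>\<eta>. enn2real (F_norm f q js \<eta>)) \<in> continuous_seminorms F"
  by (rule CkW_csn[OF V W2 weighted_sup_in_CkW_seminorms])

lemma F_norm_finite:
  "f \<in> W2 \<Longrightarrow> q \<in> continuous_seminorms E \<Longrightarrow> admissible l js \<Longrightarrow> \<eta> \<in> tvs_carrier F \<Longrightarrow>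
    F_norm f q js \<eta> < \<infinity>"
  using weighted_sup_in_CkW_seminorms CkW_carrier_iff[OF V W2] by fastforce

lemma F_norm_bound:
  "f \<in> W2 \<Longrightarrow> q \<in> continuous_seminorms E \<Longrightarrow> admissible l js \<Longrightarrow> \<eta> \<in> tvs_carrier F \<Longrightarrow> y \<in> V \<Longrightarrow>
    f y * q (iter_pderiv E V js \<eta> y) \<le> enn2real (F_norm f q js \<eta>)"
  by (rule weighted_sup_ge[OF F_norm_finite])

lemma F_iter_diff:
  "\<eta> \<in> tvs_carrier F \<Longrightarrow> \<zeta> \<in> tvs_carrier F \<Longrightarrow> admissible l js \<Longrightarrow> y \<in> V \<Longrightarrow>
    iter_pderiv E V js (\<eta> - \<zeta>) y = iter_pderiv E V js \<eta> y - iter_pderiv E V js \<zeta> y"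
  by (rule Ck_diff[OF V F_Ck F_Ck])

lemma F_iter_scale:
  "\<eta> \<in> tvs_carrier F \<Longrightarrow> admissible l js \<Longrightarrow> y \<in> V \<Longrightarrow>
    iter_pderiv E V js (tvs_scale F c \<eta>) y = tvs_scale E c (iter_pderiv E V js \<eta> y)"
  unfolding F_scale by (rule Ck_linear(4)[OF V F_Ck F_Ck])

lemma F_iter_carrier:
  "\<eta> \<in> tvs_carrier F \<Longrightarrow> admissible l js \<Longrightarrow> y \<in> V \<Longrightarrow> iter_pderiv E V js \<eta> y \<in> tvs_carrier E"
  by (rule Ck_carrier[OF F_Ck])

subsection \<open>From vector-valued maps to maps of two variables\<close>

text \<open>
  Evaluating a derivative at a point \<open>y\<close> is continuous because some weight is positive at \<open>y\<close>;
  being linear, it commutes with partial derivatives of \<open>F\<close>-valued maps.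
\<close>

lemma eval_continuous:
  assumes js: "admissible l js" and y: "y \<in> V"
  shows "continuous_map (tvs_topology F) (tvs_topology E) (\<lambda>\<eta>. iter_pderiv E V js \<eta> y)"
proof (rule F.continuous_linear_mapI[OF seminormed_tvs_axioms])
  fix q assume q: "q \<in> continuous_seminorms E"
  obtain f where f: "f \<in> W2" "0 < f y" using W2 y unfolding set_of_weights_def by blast
  have "q (iter_pderiv E V js \<eta> y) \<le> (1 / f y) * enn2real (F_norm f q js \<eta>)"
    if "\<eta> \<in> tvs_carrier F" for \<eta>
    using F_norm_bound[OF f(1) q js that y] f(2) by (simp add: field_simps)
  then show "\<exists>q'\<in>continuous_seminorms F. \<exists>C\<ge>0. \<forall>\<eta>\<in>tvs_carrier F.
      q (iter_pderiv E V js \<eta> y) \<le> C * q' \<eta>"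
    using f(2) by (intro bexI[OF _ F_norm_csn[OF f(1) q js]] exI[of _ "1 / f y"]) auto
qed (use F_iter_carrier F_iter_diff js y in auto)

context
  fixes \<gamma> assumes \<gamma>: "\<gamma> \<in> Ck k U F"
begin

text \<open>
  Joint continuity at \<open>(a, b)\<close>: a weight that is positive at \<open>b\<close> is bounded below near \<open>b\<close>, hence
  closeness in \<open>F\<close> controls values at all \<open>y\<close> near \<open>b\<close> uniformly.
\<close>

lemma uncurry_continuous:
  assumes "is": "admissible k is" and js: "admissible l js"
  shows "continuous_map (top_of_set (U \<times> V)) (tvs_topology E)
    (\<lambda>(x, y). iter_pderiv E V js (iter_pderiv F U is \<gamma> x) y)"
  unfolding continuous_map_iff
proof (intro conjI ballI allI impI)
  let ?D = "iter_pderiv F U is \<gamma>"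
  let ?G = "\<lambda>(x, y). iter_pderiv E V js (?D x) y"
  note DF = F.Ck_carrier[OF \<gamma> "is"]
  show "?G z \<in> tvs_carrier E" if "z \<in> U \<times> V" for z
    using that F_iter_carrier[OF DF js] by auto
  fix z q e assume z: "z \<in> U \<times> V" and q: "q \<in> continuous_seminorms E" and e: "(0::real) < e"
  obtain a b where ab: "z = (a, b)" "a \<in> U" "b \<in> V" using z by auto
  obtain f where f: "f \<in> W2" "0 < f b" using W2 ab unfolding set_of_weights_def by blast
  have fb: "f b / 2 < f b" using f by simp
  have "(f \<longlongrightarrow> f b) (at b within V)" using W2_continuous[OF f(1)] ab by (simp add: continuous_on_def)
  then have f_near: "\<forall>\<^sub>F y in at b within V. f b / 2 < f y" using fb by (rule order_tendstoD)
  have small: "0 < e / 2 * (f b / 2)" using e f by simp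
  have D_near: "\<forall>\<^sub>F x in at a within U. enn2real (F_norm f q js (?D x - ?D a)) < e / 2 * (f b / 2)"
    by (rule F.continuous_map_csnD[OF F.Ck_continuous[OF \<gamma> "is"] ab(2) F_norm_csn[OF f(1) q js] small])
  have "\<forall>\<^sub>F y in at b within V. q (iter_pderiv E V js (?D a) y - iter_pderiv E V js (?D a) b) < e / 2"
    using e ab DF js q by (intro continuous_map_csnD[OF Ck_continuous[OF F_Ck]]) auto
  then have y_near: "\<forall>\<^sub>F z in at (a, b) within U \<times> V.
      q (iter_pderiv E V js (?D a) (snd z) - iter_pderiv E V js (?D a) b) < e / 2"
    by (rule eventually_within_Times(2)) (simp add: csn_zero[OF q] e)
  have "\<forall>\<^sub>F z in at (a, b) within U \<times> V. z \<in> U \<times> V" by (simp add: eventually_at_filter)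
  moreover have "\<forall>\<^sub>F z in at (a, b) within U \<times> V.
      enn2real (F_norm f q js (?D (fst z) - ?D a)) < e / 2 * (f b / 2)"
    using D_near by (rule eventually_within_Times(1)) (use small F.csn_zero[OF F_norm_csn[OF f(1) q js]] in simp)
  moreover note y_near eventually_within_Times(2)[OF f_near fb, of a U]
  ultimately have "\<forall>\<^sub>F z in at (a, b) within U \<times> V. q (?G z - ?G (a, b)) < e"
  proof (eventually_elim)
    case prems: (elim z)
    obtain x' y' where xy: "z = (x', y')" "x' \<in> U" "y' \<in> V" using prems by auto
    have d: "?D x' - ?D a \<in> tvs_carrier F" using DF xy ab by simp
    have "f y' * q (iter_pderiv E V js (?D x' - ?D a) y') < e / 2 * (f b / 2)"
      using F_norm_bound[OF f(1) q js d xy(3)] prems xy by simp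
    also have "\<dots> \<le> e / 2 * f y'" using prems xy e by (intro mult_left_mono) auto
    finally have x_near: "q (iter_pderiv E V js (?D x') y' - iter_pderiv E V js (?D a) y') < e / 2"
      using prems xy f F_iter_diff[OF DF[OF xy(2)] DF[OF ab(2)] js xy(3)]
      by (simp add: mult.commute[of "f y'"])
    have "q (?G z - ?G (a, b)) \<le> q (iter_pderiv E V js (?D x') y' - iter_pderiv E V js (?D a) y') +
        q (iter_pderiv E V js (?D a) y' - iter_pderiv E V js (?D a) b)"
      unfolding xy prod.case using xy ab by (intro csn_triangle_diff[OF q] F_iter_carrier[OF DF js])
    then show ?case using x_near prems xy by simp
  qed
  then show "\<forall>\<^sub>F z' in at z within U \<times> V. q (?G z' - ?G z) < e" by (simp add: ab)
qed

lemma uncurry_has_pderiv_snd: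
  assumes "admissible l (j # js)" "x \<in> U" "y \<in> V"
  shows "has_pderiv E j (iter_pderiv E V js (\<gamma> x)) y (iter_pderiv E V (j # js) (\<gamma> x) y)"
  using F.Ck_carrier[OF \<gamma> admissible_Nil assms(2)] assms(1,3)
  by (intro Ck_has_pderiv[OF F_Ck]) simp_all

lemma uncurry_has_pderiv_fst:
  assumes i: "admissible k (i # is)" and js: "admissible l js" and x: "x \<in> U" and y: "y \<in> V"
  shows "has_pderiv E i (\<lambda>x. iter_pderiv E V js (iter_pderiv F U is \<gamma> x) y) x
    (iter_pderiv E V js (iter_pderiv F U (i # is) \<gamma> x) y)"
proof (rule has_pderiv_linear_image[OF F.seminormed_tvs_axioms eval_continuous[OF js y] _ _ U x])
  show "has_pderiv F i (iter_pderiv F U is \<gamma>) x (iter_pderiv F U (i # is) \<gamma> x)"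
    by (rule F.Ck_has_pderiv[OF \<gamma> i x])
  show "iter_pderiv F U is \<gamma> x \<in> tvs_carrier F" if "x \<in> U" for x
    by (rule F.Ck_carrier[OF \<gamma> admissible_ConsD[OF i] that])
qed (use F_iter_diff F_iter_scale js y in auto)

lemma uncurry_Ckl: "(\<lambda>(x, y). \<gamma> x y) \<in> Ckl k l U V E"
  and iter_pderiv2_uncurry: "admissible k is \<Longrightarrow> admissible l js \<Longrightarrow> x \<in> U \<Longrightarrow> y \<in> V \<Longrightarrow>
    iter_pderiv2 E U V is js (\<lambda>(x, y). \<gamma> x y) (x, y) =
      iter_pderiv E V js (iter_pderiv F U is \<gamma> x) y"
proof -
  let ?G = "\<lambda>is js (x, y). iter_pderiv E V js (iter_pderiv F U is \<gamma> x) y"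
  have base: "?G [] [] (x, y) = (\<lambda>(x, y). \<gamma> x y) (x, y)" for x y by simp
  have dy: "has_pderiv E j (\<lambda>y. ?G [] js (x, y)) y (?G [] (j # js) (x, y))"
    if "admissible l (j # js)" "x \<in> U" "y \<in> V" for j js x y
    using uncurry_has_pderiv_snd[OF that] by simp
  have dx: "has_pderiv E i (\<lambda>x. ?G is js (x, y)) x (?G (i # is) js (x, y))"
    if "admissible k (i # is)" "admissible l js" "x \<in> U" "y \<in> V" for i "is" js x y
    using uncurry_has_pderiv_fst[OF that] by simp
  show "(\<lambda>(x, y). \<gamma> x y) \<in> Ckl k l U V E"
  proof (rule CklI[of U V ?G, OF U V base dy dx])
    show "(\<lambda>(x, y). \<gamma> x y) z = 0" if "z \<notin> U \<times> V" for z
    proof (cases "fst z \<in> U")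
      case True
      then have "\<gamma> (fst z) \<in> Ck l V E" using F.Ck_carrier[OF \<gamma> admissible_Nil True] F_Ck by simp
      then have "\<gamma> (fst z) (snd z) = 0" using True that by (intro Ck_zero) (auto simp: mem_Times_iff)
      then show ?thesis by (simp add: case_prod_beta)
    qed (simp add: case_prod_beta F.Ck_zero[OF \<gamma>])
  qed (use uncurry_continuous in auto)
  show "iter_pderiv2 E U V is js (\<lambda>(x, y). \<gamma> x y) (x, y) = iter_pderiv E V js (iter_pderiv F U is \<gamma> x) y"
    if "admissible k is" "admissible l js" "x \<in> U" "y \<in> V"
    using iter_pderiv2_family(3)[of U V ?G, OF U V base dy dx that(1,2), of "(x, y)"] that(3,4) by simp
qed

text \<open>A supremum over \<open>U \<times> V\<close> is an iterated supremum.\<close>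

lemma weighted_sup_uncurry:
  assumes f1: "f1 \<in> W1" and f2: "f2 \<in> W2" and q: "q \<in> continuous_seminorms E"
    and "is": "admissible k is" and js: "admissible l js"
  shows "weighted_sup (U \<times> V) (\<lambda>(x, y). f1 x * f2 y) q (iter_pderiv2 E U V is js (\<lambda>(x, y). \<gamma> x y)) =
    weighted_sup U f1 (\<lambda>\<eta>. enn2real (F_norm f2 q js \<eta>)) (iter_pderiv F U is \<gamma>)"
    (is "?lhs = ?rhs")
proof -
  let ?D = "iter_pderiv F U is \<gamma>"
  have eq: "ennreal (f1 x * enn2real (F_norm f2 q js (?D x))) =
      (SUP y\<in>V. ennreal ((\<lambda>(x, y). f1 x * f2 y) (x, y) *
        q (iter_pderiv2 E U V is js (\<lambda>(x, y). \<gamma> x y) (x, y))))" if x: "x \<in> U" for x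
  proof -
    have f1x: "0 \<le> f1 x" using W1 f1 x by (simp add: set_of_weights_def)
    have "ennreal (f1 x * enn2real (F_norm f2 q js (?D x))) = ennreal (f1 x) * F_norm f2 q js (?D x)"
      using F_norm_finite[OF f2 q js F.Ck_carrier[OF \<gamma> "is" x]] f1x by (simp add: ennreal_mult)
    also have "\<dots> = (SUP y\<in>V. ennreal (f1 x) * ennreal (f2 y * q (iter_pderiv E V js (?D x) y)))"
      unfolding weighted_sup_def SUP_mult_left_ennreal ..
    also have "\<dots> = (SUP y\<in>V. ennreal ((\<lambda>(x, y). f1 x * f2 y) (x, y) *
        q (iter_pderiv2 E U V is js (\<lambda>(x, y). \<gamma> x y) (x, y))))"
      using f1x by (intro SUP_cong refl)
        (simp add: iter_pderiv2_uncurry[OF "is" js x] ennreal_mult'[symmetric] mult.assoc)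
    finally show ?thesis .
  qed
  have "?rhs = (SUP x\<in>U. SUP y\<in>V. ennreal ((\<lambda>(x, y). f1 x * f2 y) (x, y) *
        q (iter_pderiv2 E U V is js (\<lambda>(x, y). \<gamma> x y) (x, y))))"
    unfolding weighted_sup_def[of U] using eq by (intro SUP_cong refl)
  also have "\<dots> = ?lhs"
    unfolding weighted_sup_def[of "U \<times> V"]
    by (intro antisym SUP_least) (auto intro: SUP_upper SUP_upper2)
  finally show ?thesis by simp
qed

end

text \<open>
  A continuous seminorm \<open>Q\<close> on \<open>F\<close> is dominated by finitely many of the defining ones, and for
  those the preceding lemma applies. The sum is indexed by \<open>A\<close> because different seminorms on \<open>F\<close>
  may be sent to the same seminorm \<open>b a\<close>.
\<close>

lemma weighted_sup_dominated:
  assumes f1: "f1 \<in> W1" and Q: "Q \<in> continuous_seminorms F" and "is": "admissible k is"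
  shows "\<exists>(A :: (('m rvec \<Rightarrow> 'e) \<Rightarrow> ennreal) set) b C. finite A \<and>
    b ` A \<subseteq> CklW_seminorms k l (weights_tensor W1 W2) U V E \<and> 0 \<le> C \<and>
    (\<forall>\<gamma>\<in>Ck k U F. weighted_sup U f1 Q (iter_pderiv F U is \<gamma>) \<le>
      ennreal C * (\<Sum>a\<in>A. b a (\<lambda>(x, y). \<gamma> x y)))"
proof -
  obtain A C where A: "finite A" "A \<subseteq> CkW_seminorms l W2 V E" and C: "0 \<le> C"
    and dom: "\<And>\<eta>. \<eta> \<in> tvs_carrier F \<Longrightarrow> Q \<eta> \<le> C * (\<Sum>p\<in>A. enn2real (p \<eta>))"
    using seminorm_family.csn_dominated[OF CkW_family[OF V W2, of l], unfolded CkW_space[OF V W2], OF Q]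
    by blast
  have "\<exists>b. b \<in> CklW_seminorms k l (weights_tensor W1 W2) U V E \<and> (\<forall>\<gamma>\<in>Ck k U F.
      weighted_sup U f1 (\<lambda>\<eta>. enn2real (p \<eta>)) (iter_pderiv F U is \<gamma>) = b (\<lambda>(x, y). \<gamma> x y))"
    if p: "p \<in> A" for p
  proof -
    have "p \<in> CkW_seminorms l W2 V E" using p A by blast
    then obtain f q js where f: "f \<in> W2" and q: "q \<in> continuous_seminorms E"
      and js: "admissible l js" and p: "p = (\<lambda>\<eta>. F_norm f q js \<eta>)"
      by (rule CkW_seminorms_cases)
    show ?thesis
      unfolding p using weighted_sup_in_CklW_seminorms[OF f1 f q "is" js, of U V]
        weighted_sup_uncurry[OF _ f1 f q "is" js] by (intro exI conjI) auto
  qed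
  then obtain b where b: "b ` A \<subseteq> CklW_seminorms k l (weights_tensor W1 W2) U V E"
    and b_eq: "\<And>p \<gamma>. p \<in> A \<Longrightarrow> \<gamma> \<in> Ck k U F \<Longrightarrow>
      weighted_sup U f1 (\<lambda>\<eta>. enn2real (p \<eta>)) (iter_pderiv F U is \<gamma>) = b p (\<lambda>(x, y). \<gamma> x y)"
    by (metis image_subsetI)
  have "weighted_sup U f1 Q (iter_pderiv F U is \<gamma>) \<le> ennreal C * (\<Sum>p\<in>A. b p (\<lambda>(x, y). \<gamma> x y))"
    if \<gamma>: "\<gamma> \<in> Ck k U F" for \<gamma>
    unfolding weighted_sup_def
  proof (rule SUP_least)
    fix x assume x: "x \<in> U"
    let ?d = "iter_pderiv F U is \<gamma> x"
    have f1x: "0 \<le> f1 x" using W1 f1 x by (simp add: set_of_weights_def)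
    have "f1 x * Q ?d \<le> f1 x * (C * (\<Sum>p\<in>A. enn2real (p ?d)))"
      using dom F.Ck_carrier[OF \<gamma> "is" x] f1x by (intro mult_left_mono) auto
    also have "\<dots> = C * (\<Sum>p\<in>A. f1 x * enn2real (p ?d))"
      by (simp add: sum_distrib_left mult.left_commute)
    finally have "ennreal (f1 x * Q ?d) \<le> ennreal C * (\<Sum>p\<in>A. ennreal (f1 x * enn2real (p ?d)))"
      using C f1x by (subst sum_ennreal) (auto simp: ennreal_mult'[symmetric] intro!: ennreal_leI)
    also have "\<dots> \<le> ennreal C * (\<Sum>p\<in>A. b p (\<lambda>(x, y). \<gamma> x y))"
    proof (intro mult_left_mono sum_mono)
      fix p assume "p \<in> A"
      show "ennreal (f1 x * enn2real (p ?d)) \<le> b p (\<lambda>(x, y). \<gamma> x y)"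
        unfolding b_eq[OF \<open>p \<in> A\<close> \<gamma>, symmetric] weighted_sup_def using x by (rule SUP_upper)
    qed simp
    finally show "ennreal (f1 x * Q ?d) \<le> ennreal C * (\<Sum>p\<in>A. b p (\<lambda>(x, y). \<gamma> x y))" .
  qed
  then show ?thesis using A(1) b C by blast
qed

end

context weighted_exponential
begin

subsection \<open>From maps of two variables to vector-valued maps\<close>

context
  fixes \<delta> assumes \<delta>: "\<delta> \<in> tvs_carrier (CklW k l (weights_tensor W1 W2) U V E)"
begin

lemma delta_Ckl: "\<delta> \<in> Ckl k l U V E"
  and delta_finite: "p \<in> CklW_seminorms k l (weights_tensor W1 W2) U V E \<Longrightarrow> p \<delta> < \<infinity>"
  using \<delta> by (auto simp: CklW_carrier_iff[OF U V W1 W2])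

abbreviation mixed :: "'n list \<Rightarrow> 'm list \<Rightarrow> 'n rvec \<Rightarrow> 'm rvec \<Rightarrow> 'e" where
  "mixed is js x y \<equiv> iter_pderiv2 E U V is js \<delta> (x, y)"

lemma mixed_carrier: "admissible k is \<Longrightarrow> admissible l js \<Longrightarrow> x \<in> U \<Longrightarrow> y \<in> V \<Longrightarrow> mixed is js x y \<in> tvs_carrier E"
  by (rule Ckl_carrier[OF U V delta_Ckl]) auto

lemma mixed_bound:
  assumes "f1 \<in> W1" "f2 \<in> W2" "q \<in> continuous_seminorms E" "admissible k is" "admissible l js"
  shows "\<exists>M\<ge>0. \<forall>x\<in>U. \<forall>y\<in>V. f1 x * f2 y * q (mixed is js x y) \<le> M"
proof -
  let ?p = "weighted_sup (U \<times> V) (\<lambda>(x, y). f1 x * f2 y) q (iter_pderiv2 E U V is js \<delta>)"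
  have "?p < \<infinity>" using delta_finite[OF weighted_sup_in_CklW_seminorms[OF assms]] .
  then have "\<forall>x\<in>U. \<forall>y\<in>V. f1 x * f2 y * q (mixed is js x y) \<le> enn2real ?p"
    using weighted_sup_ge[of "U \<times> V" "\<lambda>(x, y). f1 x * f2 y" q "iter_pderiv2 E U V is js \<delta>"] by fastforce
  then show ?thesis by (intro exI[of _ "enn2real ?p"]) simp
qed

lemma weight_bounded_below:
  assumes x: "x0 \<in> U"
  shows "\<exists>f\<in>W1. \<exists>c>0. \<exists>r>0. ball x0 r \<subseteq> U \<and> (\<forall>x\<in>ball x0 r. c \<le> f x)"
proof -
  obtain f where f: "f \<in> W1" "0 < f x0" using W1 x unfolding set_of_weights_def by blast
  obtain r1 where r1: "r1 > 0" "ball x0 r1 \<subseteq> U" using U x open_contains_ball by blast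
  obtain r2 where r2: "r2 > 0" "\<And>x. x \<in> U \<Longrightarrow> dist x x0 < r2 \<Longrightarrow> dist (f x) (f x0) < f x0 / 2"
    using W1_continuous[OF f(1)] x half_gt_zero[OF f(2)] unfolding continuous_on_iff by metis
  have "f x0 / 2 \<le> f x" if "x \<in> ball x0 (min r1 r2)" for x
  proof -
    have "dist (f x) (f x0) < f x0 / 2" using that r1(2) by (intro r2(2)) (auto simp: dist_commute)
    then show ?thesis by (simp add: dist_real_def abs_if field_simps split: if_splits)
  qed
  moreover have "ball x0 (min r1 r2) \<subseteq> U" using r1(2) by auto
  moreover have "0 < f x0 / 2" "0 < min r1 r2" using f r1 r2 by simp_all
  ultimately show ?thesis using f(1) by blast
qed

text \<open>
  The heart of the surjectivity: the \<open>o\<close>-condition on the weights over \<open>V\<close>. If \<open>f = o(h)\<close>, then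
  off a compact set \<open>K\<close> the quantity in question is a small multiple of the \<open>h\<close>-weighted suprema of
  the derivative at points near \<open>x0\<close>, which are bounded uniformly because some weight over \<open>U\<close> is
  bounded below near \<open>x0\<close>. On \<open>K\<close> the derivative is uniformly continuous in \<open>x\<close> at \<open>x0\<close>.
\<close>

lemma locally_uniform_continuity:
  assumes x0: "x0 \<in> U" and f: "f \<in> W2" and q: "q \<in> continuous_seminorms E"
    and "is": "admissible k is" and js: "admissible l js" and e: "0 < e"
  shows "\<exists>r>0. ball x0 r \<subseteq> U \<and> (\<forall>x\<in>ball x0 r. \<forall>y\<in>V. f y * q (mixed is js x y - mixed is js x0 y) \<le> e)"
proof -
  obtain f1 c r1 where f1: "f1 \<in> W1" and c: "0 < c" and r1: "0 < r1" "ball x0 r1 \<subseteq> U"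
    and f1_ge: "\<And>x. x \<in> ball x0 r1 \<Longrightarrow> c \<le> f1 x"
    using weight_bounded_below[OF x0] by meson
  obtain h where h: "h \<in> W2" "weight_small_o V f h" using W2_o f unfolding o_condition_def by blast
  obtain M where M: "0 \<le> M" and bound: "\<And>x y. x \<in> U \<Longrightarrow> y \<in> V \<Longrightarrow> f1 x * h y * q (mixed is js x y) \<le> M"
    using mixed_bound[OF f1 h(1) q "is" js] by blast
  have f_nonneg: "0 \<le> f y" and h_nonneg: "0 \<le> h y" if "y \<in> V" for y
    using W2 f h that by (auto simp: set_of_weights_def)
  note gc = mixed_carrier[OF "is" js]
  have h_bound: "h y * q (mixed is js x y) \<le> M / c" if x: "x \<in> ball x0 r1" and y: "y \<in> V" for x y
  proof -
    have xU: "x \<in> U" using x r1(2) by blast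
    have "c * (h y * q (mixed is js x y)) \<le> f1 x * (h y * q (mixed is js x y))"
      using f1_ge[OF x] h_nonneg[OF y] csn_nonneg[OF q gc[OF xU y]] by (intro mult_right_mono) auto
    also have "\<dots> \<le> M" using bound[OF xU y] by (simp add: mult.assoc)
    finally show ?thesis using c by (simp add: field_simps)
  qed
  (* Chosen such that \<epsilon> times twice the bound M / c is at most e, also when M = 0. *)
  define \<epsilon> where "\<epsilon> = e * c / (2 * M + 1)"
  have \<epsilon>: "0 < \<epsilon>" using e c M by (simp add: \<epsilon>_def)
  have \<epsilon>_le: "\<epsilon> * (2 * (M / c)) \<le> e"
    using e c M by (simp add: \<epsilon>_def field_simps)
  obtain K where K: "compact K" "K \<subseteq> V" and off_K: "\<And>y. y \<in> V - K \<Longrightarrow> f y \<le> \<epsilon> * h y"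
    using h(2) \<epsilon> unfolding weight_small_o_def by meson
  have "compact (f ` K)"
    using K W2_continuous[OF f] by (intro compact_continuous_image) (auto intro: continuous_on_subset)
  then obtain B where B: "0 < B" "\<And>y. y \<in> K \<Longrightarrow> f y \<le> B"
    using compact_imp_bounded[of "f ` K"] unfolding bounded_pos by fastforce
  have cont: "continuous_map (top_of_set (U \<times> V)) (tvs_topology E) (iter_pderiv2 E U V is js \<delta>)"
    by (rule Ckl_continuous[OF U V delta_Ckl "is" js])
  have "continuous_map (top_of_set (U \<times> K)) (tvs_topology E) (iter_pderiv2 E U V is js \<delta>)"
    using continuous_map_from_subtopology_mono[OF cont] K(2) by (simp add: Sigma_mono)
  moreover have "continuous_map (top_of_set (U \<times> K)) (tvs_topology E) (\<lambda>z. iter_pderiv2 E U V is js \<delta> (x0, snd z))"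
  proof -
    have "continuous_map (top_of_set (U \<times> K)) (top_of_set (U \<times> V)) (\<lambda>z. (x0, snd z))"
      using x0 K(2) by (auto intro!: continuous_intros simp: continuous_map_in_subtopology)
    from continuous_map_compose[OF this cont] show ?thesis by (simp add: o_def)
  qed
  ultimately have "continuous_map (top_of_set (U \<times> K)) (tvs_topology E)
      (\<lambda>z. iter_pderiv2 E U V is js \<delta> z - iter_pderiv2 E U V is js \<delta> (x0, snd z))"
    by (rule continuous_map_diff)
  from continuous_on_csn[OF this q]
  have "continuous_on (U \<times> K) (\<lambda>z. q (iter_pderiv2 E U V is js \<delta> z - iter_pderiv2 E U V is js \<delta> (x0, snd z)))" .
  from continuous_on_prod_compactE[OF this K(1) x0, of "e / B"]
  obtain X where X: "x0 \<in> X" "open X"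
    and on_K: "\<forall>x\<in>X \<inter> U. \<forall>y\<in>K. dist (q (mixed is js x y - mixed is js x0 y)) (q (mixed is js x0 y - mixed is js x0 y)) \<le> e / B"
    using e B(1) by auto
  obtain r2 where r2: "r2 > 0" "ball x0 r2 \<subseteq> X" using X open_contains_ball by blast
  define r where "r = min r1 r2"
  have "f y * q (mixed is js x y - mixed is js x0 y) \<le> e" if x: "x \<in> ball x0 r" and y: "y \<in> V" for x y
  proof -
    have x1: "x \<in> ball x0 r1" and xX: "x \<in> X" using x r2(2) by (auto simp: r_def)
    have xU: "x \<in> U" using x1 r1(2) by blast
    have d: "mixed is js x y - mixed is js x0 y \<in> tvs_carrier E" using gc xU x0 y by simp
    show ?thesis
    proof (cases "y \<in> K")
      case True
      have "q (mixed is js x y - mixed is js x0 y) \<le> e / B"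
        using on_K[rule_format, of x y] True xU xX csn_nonneg[OF q d]
        by (simp add: csn_zero[OF q] dist_real_def)
      then have "f y * q (mixed is js x y - mixed is js x0 y) \<le> B * (e / B)"
        using B True csn_nonneg[OF q d] by (intro mult_mono) auto
      then show ?thesis using B(1) by simp
    next
      case False
      have "f y * q (mixed is js x y - mixed is js x0 y) \<le> \<epsilon> * h y * (q (mixed is js x y) + q (mixed is js x0 y))"
        using off_K[of y] y False csn_nonneg[OF q d] f_nonneg[OF y]
          csn_triangle_minus[OF q gc[OF xU y] gc[OF x0 y]] by (intro mult_mono) auto
      also have "\<dots> = \<epsilon> * (h y * q (mixed is js x y) + h y * q (mixed is js x0 y))"
        by (simp add: algebra_simps)
      also have "\<dots> \<le> \<epsilon> * (M / c + M / c)"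
        using h_bound[OF x1 y] h_bound[OF _ y, of x0] r1(1) \<epsilon> by (intro mult_left_mono add_mono) auto
      also have "\<dots> \<le> e" using \<epsilon>_le by simp
      finally show ?thesis .
    qed
  qed
  then show ?thesis using r1 r2 by (intro exI[of _ r]) (auto simp: r_def)
qed

text \<open>The extension by \<open>0\<close> makes the partial map in \<open>y\<close> an element of \<open>F\<close>.\<close>

definition slice :: "'n list \<Rightarrow> 'n rvec \<Rightarrow> 'm rvec \<Rightarrow> 'e" where
  "slice is x = (\<lambda>y. if y \<in> V then mixed is [] x y else 0)"

context
  fixes "is" :: "'n list" and x assumes "is": "admissible k is" and x: "x \<in> U"
begin

lemma slice_Ck: "slice is x \<in> Ck l V E"
    and iter_slice: "admissible l js \<Longrightarrow> y \<in> V \<Longrightarrow> iter_pderiv E V js (slice is x) y = mixed is js x y"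
proof -
  have base: "mixed is [] x y = slice is x y" if "y \<in> V" for y using that by (simp add: slice_def)
  have step: "has_pderiv E j (mixed is js x) y (mixed is (j # js) x y)" if "admissible l (j # js)" "y \<in> V" for j js y
    by (rule Ckl_has_pderiv_snd_any[OF U V delta_Ckl "is" that(1) x that(2)])
  show "slice is x \<in> Ck l V E"
  proof (rule CkI[of V "\<lambda>js. mixed is js x", OF V base step])
    fix js :: "'m list" assume js: "admissible l js"
    have "continuous_map (top_of_set V) (top_of_set (U \<times> V)) (\<lambda>y. (x, y))"
      using x by (auto intro!: continuous_intros simp: continuous_map_in_subtopology)
    from continuous_map_compose[OF this Ckl_continuous[OF U V delta_Ckl "is" js]]
    show "continuous_map (top_of_set V) (tvs_topology E) (mixed is js x)" by (simp add: o_def)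
  qed (simp_all add: slice_def)
  show "iter_pderiv E V js (slice is x) y = mixed is js x y" if "admissible l js" "y \<in> V"
    using iter_pderiv_family[of V "\<lambda>js. mixed is js x" "slice is x", OF V base step that(1)] that(2) by simp
qed

lemma slice_in_F: "slice is x \<in> tvs_carrier F"
  unfolding CkW_carrier_iff[OF V W2]
proof (intro conjI slice_Ck ballI)
  fix p assume "p \<in> CkW_seminorms l W2 V E"
  then obtain f q js where f: "f \<in> W2" and q: "q \<in> continuous_seminorms E"
    and js: "admissible l js" and p: "p = (\<lambda>\<eta>. F_norm f q js \<eta>)"
    by (rule CkW_seminorms_cases)
  obtain f1 where f1: "f1 \<in> W1" "0 < f1 x" using W1 x unfolding set_of_weights_def by blast
  obtain M where M: "\<And>x y. x \<in> U \<Longrightarrow> y \<in> V \<Longrightarrow> f1 x * f y * q (mixed is js x y) \<le> M"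
    using mixed_bound[OF f1(1) f q "is" js] by blast
  have "p (slice is x) \<le> ennreal (M / f1 x)"
    unfolding p
  proof (rule weighted_sup_le)
    fix y assume "y \<in> V"
    then show "f y * q (iter_pderiv E V js (slice is x) y) \<le> M / f1 x"
      using M[OF x] f1(2) by (simp add: iter_slice js field_simps)
  qed
  then show "p (slice is x) < \<infinity>" by (auto intro: le_less_trans)
qed

end

lemma slice_continuous:
  assumes "is": "admissible k is"
  shows "continuous_map (top_of_set U) (tvs_topology F) (slice is)"
proof (subst CkW_topology[OF V W2], rule seminorm_family.continuous_map_familyI[OF CkW_family[OF V W2]])
  show "slice is x \<in> tvs_carrier F" if "x \<in> U" for x by (rule slice_in_F[OF "is" that])
  fix a p e assume a: "a \<in> U" and "p \<in> CkW_seminorms l W2 V E" and e: "(0::real) < e"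
  then obtain f q js where f: "f \<in> W2" and q: "q \<in> continuous_seminorms E"
    and js: "admissible l js" and p: "p = (\<lambda>\<eta>. F_norm f q js \<eta>)"
    by (elim CkW_seminorms_cases)
  obtain r where r: "r > 0" "\<And>x y. x \<in> ball a r \<Longrightarrow> y \<in> V \<Longrightarrow> f y * q (mixed is js x y - mixed is js a y) \<le> e / 2"
    using locally_uniform_continuity[OF a f q "is" js half_gt_zero[OF e]] by meson
  have "enn2real (p (slice is x - slice is a)) < e" if x: "x \<in> U" "dist x a < r" for x
  proof -
    have "p (slice is x - slice is a) \<le> ennreal (e / 2)"
      unfolding p
    proof (rule weighted_sup_le)
      fix y assume y: "y \<in> V"
      show "f y * q (iter_pderiv E V js (slice is x - slice is a) y) \<le> e / 2"
        using r(2)[of x y] x y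
        by (simp add: F_iter_diff[OF slice_in_F[OF "is" x(1)] slice_in_F[OF "is" a] js y] iter_slice "is" js a dist_commute)
    qed
    then have "enn2real (p (slice is x - slice is a)) \<le> e / 2" using e by (intro enn2real_leI) auto
    then show ?thesis using e by simp
  qed
  then show "\<forall>\<^sub>F x in at a within U. enn2real (p (slice is x - slice is a)) < e"
    unfolding eventually_at using r(1) by blast
qed

text \<open>
  The difference quotient minus the expected derivative has \<open>y\<close>-derivatives to which the mean
  value inequality in \<open>x\<close> applies, so the preceding uniform continuity of the next derivative gives
  convergence in \<open>F\<close>.
\<close>

lemma slice_has_pderiv:
  assumes i: "admissible k (i # is)" and x: "x \<in> U"
  shows "has_pderiv F i (slice is) x (slice (i # is) x)"
  unfolding has_pderiv_def
proof (subst CkW_topology[OF V W2], rule seminorm_family.limitin_familyI[OF CkW_family[OF V W2]])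
  note "is" = admissible_ConsD[OF i]
  let ?x = "\<lambda>h. x + h *\<^sub>R axis i 1"
  let ?dq = "\<lambda>h::real. tvs_scale F (of_real (1 / h)) (slice is (?x h) - slice is x)"
  show "\<forall>\<^sub>F h in at 0. ?dq h \<in> tvs_carrier F"
    using eventually_shift_in_open[OF U x, of i]
    by eventually_elim (intro F.carrier_closed slice_in_F "is" x)
  show "slice (i # is) x \<in> tvs_carrier F" by (rule slice_in_F[OF i x])
  fix p e assume "p \<in> CkW_seminorms l W2 V E" and e: "(0::real) < e"
  then obtain f q js where f: "f \<in> W2" and q: "q \<in> continuous_seminorms E"
    and js: "admissible l js" and p: "p = (\<lambda>\<eta>. F_norm f q js \<eta>)"
    by (elim CkW_seminorms_cases)
  obtain r where r: "r > 0" and rU: "ball x r \<subseteq> U" and near: "\<And>x' y. x' \<in> ball x r \<Longrightarrow> y \<in> V \<Longrightarrow>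
      f y * q (mixed (i # is) js x' y - mixed (i # is) js x y) \<le> e / 2"
    using locally_uniform_continuity[OF x f q i js half_gt_zero[OF e]] by meson
  have "\<forall>\<^sub>F h::real in at 0. \<bar>h\<bar> < r \<and> h \<noteq> 0" using r by (auto simp: eventually_at)
  then show "\<forall>\<^sub>F h in at 0. enn2real (p (?dq h - slice (i # is) x)) < e"
  proof eventually_elim
    case (elim h)
    have ball: "?x t \<in> ball x r" if "\<bar>t\<bar> \<le> \<bar>h\<bar>" for t
      using that elim by (simp add: dist_norm)
    have xU: "?x t \<in> U" if "\<bar>t\<bar> \<le> \<bar>h\<bar>" for t using ball[OF that] rU by blast
    have "p (?dq h - slice (i # is) x) \<le> ennreal (e / 2)"
      unfolding p
    proof (rule weighted_sup_le)
      fix y assume y: "y \<in> V"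
      let ?A = "mixed (i # is) js x y"
      let ?R = "mixed is js (?x h) y - mixed is js x y - tvs_scale E (of_real h) ?A"
      have A: "?A \<in> tvs_carrier E" by (rule mixed_carrier[OF i js x y])
      have R: "?R \<in> tvs_carrier E"
        using mixed_carrier[OF "is" js xU[of h] y] mixed_carrier[OF "is" js x y] A by simp
      have "iter_pderiv E V js (?dq h - slice (i # is) x) y =
          tvs_scale E (of_real (1 / h)) (mixed is js (?x h) y - mixed is js x y) - ?A"
        using slice_in_F[OF "is" xU[of h]] slice_in_F[OF "is" x] slice_in_F[OF i x] js y i "is" x xU[of h]
        by (simp add: F_iter_diff F_iter_scale iter_slice)
      also have "\<dots> = tvs_scale E (of_real (1 / h)) ?R"
        using elim by (simp add: scale_right_diff_distrib)
      finally have quot: "q (iter_pderiv E V js (?dq h - slice (i # is) x) y) = (1 / \<bar>h\<bar>) * q ?R"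
        using csn_scale[OF q R, of "of_real (1 / h)"] by (simp add: norm_divide)
      have "f y * q ?R \<le> e / 2 * \<bar>h\<bar>"
      proof (cases "f y = 0")
        case False
        then have fy: "0 < f y" using W2 f y by (auto simp: set_of_weights_def less_le)
        have "q ?R \<le> e / 2 / f y * \<bar>h\<bar>"
        proof (rule mean_value_inequality[OF q A])
          fix t :: real assume t: "\<bar>t\<bar> \<le> \<bar>h\<bar>"
          show "mixed is js (?x t) y \<in> tvs_carrier E" by (rule mixed_carrier[OF "is" js xU[OF t] y])
          show "has_pderiv E i (\<lambda>x. mixed is js x y) (?x t) (mixed (i # is) js (?x t) y)"
            by (rule Ckl_has_pderiv_fst[OF U V delta_Ckl i js xU[OF t] y])
          show "q (mixed (i # is) js (?x t) y - ?A) \<le> e / 2 / f y"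
            using near[OF ball[OF t] y] fy by (simp add: field_simps)
        qed
        then show ?thesis using fy by (simp add: field_simps)
      qed (use e in simp)
      then have "(1 / \<bar>h\<bar>) * (f y * q ?R) \<le> (1 / \<bar>h\<bar>) * (e / 2 * \<bar>h\<bar>)"
        by (intro mult_left_mono) auto
      then show "f y * q (iter_pderiv E V js (?dq h - slice (i # is) x) y) \<le> e / 2"
        unfolding quot using elim by (simp add: mult.left_commute)
    qed
    then have "enn2real (p (?dq h - slice (i # is) x)) \<le> e / 2" using e by (intro enn2real_leI) auto
    then show ?case using e by simp
  qed
qed

lemma curry_Ck: "(\<lambda>x y. \<delta> (x, y)) \<in> Ck k U F"
proof (rule F.CkI[of U slice, OF U _ slice_has_pderiv _ slice_continuous])
  show "slice [] x = (\<lambda>y. \<delta> (x, y))" if "x \<in> U" for x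
    using Ckl_zero[OF U V delta_Ckl] by (auto simp: slice_def fun_eq_iff iter_pderiv2_def)
  show "(\<lambda>y. \<delta> (x, y)) = 0" if "x \<notin> U" for x
    using Ckl_zero[OF U V delta_Ckl] that by (auto simp: fun_eq_iff)
qed

lemma curry_in_CkW: "(\<lambda>x y. \<delta> (x, y)) \<in> tvs_carrier (CkW k W1 U F)"
  unfolding F.CkW_carrier_iff[OF U W1]
proof (intro conjI curry_Ck ballI)
  fix p assume "p \<in> CkW_seminorms k W1 U F"
  then obtain f Q "is" where f: "f \<in> W1" and Q: "Q \<in> continuous_seminorms F"
    and "is": "admissible k is" and p: "p = (\<lambda>\<eta>. weighted_sup U f Q (iter_pderiv F U is \<eta>))"
    by (rule CkW_seminorms_cases)
  obtain A b C where A: "finite (A :: (('m rvec \<Rightarrow> 'e) \<Rightarrow> ennreal) set)"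
    and b: "b ` A \<subseteq> CklW_seminorms k l (weights_tensor W1 W2) U V E"
    and dom: "\<And>\<gamma>. \<gamma> \<in> Ck k U F \<Longrightarrow> weighted_sup U f Q (iter_pderiv F U is \<gamma>) \<le>
      ennreal C * (\<Sum>a\<in>A. b a (\<lambda>(x, y). \<gamma> x y))"
    using weighted_sup_dominated[OF f Q "is"] by meson
  have "p (\<lambda>x y. \<delta> (x, y)) \<le> ennreal C * (\<Sum>a\<in>A. b a \<delta>)"
    unfolding p using dom[OF curry_Ck] by simp
  also have "\<dots> < \<infinity>"
    using A b delta_finite by (auto simp: ennreal_mult_less_top)
  finally show "p (\<lambda>x y. \<delta> (x, y)) < \<infinity>" .
qed

end

subsection \<open>The homeomorphism\<close>

lemma uncurry_in_CklW:
  assumes "\<gamma> \<in> tvs_carrier (CkW k W1 U F)"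
  shows "(\<lambda>(x, y). \<gamma> x y) \<in> tvs_carrier (CklW k l (weights_tensor W1 W2) U V E)"
  unfolding CklW_carrier_iff[OF U V W1 W2]
proof (intro conjI ballI)
  have \<gamma>: "\<gamma> \<in> Ck k U F" "\<And>p. p \<in> CkW_seminorms k W1 U F \<Longrightarrow> p \<gamma> < \<infinity>"
    using assms by (auto simp: F.CkW_carrier_iff[OF U W1])
  show "(\<lambda>(x, y). \<gamma> x y) \<in> Ckl k l U V E" by (rule uncurry_Ckl[OF \<gamma>(1)])
  fix p assume "p \<in> CklW_seminorms k l (weights_tensor W1 W2) U V E"
  then obtain f1 f2 q "is" js where *: "f1 \<in> W1" "f2 \<in> W2" "q \<in> continuous_seminorms E"
    "admissible k is" "admissible l js"
    "p = (\<lambda>\<eta>. weighted_sup (U \<times> V) (\<lambda>(x, y). f1 x * f2 y) q (iter_pderiv2 E U V is js \<eta>))"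
    by (rule CklW_seminorms_cases)
  show "p (\<lambda>(x, y). \<gamma> x y) < \<infinity>"
    unfolding *(6) weighted_sup_uncurry[OF \<gamma>(1) *(1-5)]
    by (rule \<gamma>(2)[OF weighted_sup_in_CkW_seminorms[OF *(1) F_norm_csn[OF *(2,3,5)] *(4)]])
qed

lemma continuous_uncurry:
  "continuous_map (tvs_topology (CkW k W1 U F)) (tvs_topology (CklW k l (weights_tensor W1 W2) U V E))
    (\<lambda>\<gamma> (x, y). \<gamma> x y)"
proof (subst CklW_topology[OF U V W1 W2], rule seminorm_family.continuous_linear_map_familyI[OF CklW_family[OF U V W1 W2]
      F.CkW_seminormed[OF U W1]])
  fix p assume "p \<in> CklW_seminorms k l (weights_tensor W1 W2) U V E"
  then obtain f1 f2 q "is" js where *: "f1 \<in> W1" "f2 \<in> W2" "q \<in> continuous_seminorms E"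
    "admissible k is" "admissible l js"
    and p: "p = (\<lambda>\<eta>. weighted_sup (U \<times> V) (\<lambda>(x, y). f1 x * f2 y) q (iter_pderiv2 E U V is js \<eta>))"
    by (rule CklW_seminorms_cases)
  let ?p = "\<lambda>\<gamma>. weighted_sup U f1 (\<lambda>\<eta>. enn2real (F_norm f2 q js \<eta>)) (iter_pderiv F U is \<gamma>)"
  have "?p \<in> CkW_seminorms k W1 U F"
    by (rule weighted_sup_in_CkW_seminorms[OF *(1) F_norm_csn[OF *(2,3,5)] *(4)])
  moreover have "p (\<lambda>(x, y). \<gamma> x y) = ?p \<gamma>" if "\<gamma> \<in> tvs_carrier (CkW k W1 U F)" for \<gamma>
    unfolding p using that by (intro weighted_sup_uncurry * ) (simp add: F.CkW_carrier_iff[OF U W1])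
  ultimately show "\<exists>q\<in>continuous_seminorms (CkW k W1 U F). \<exists>C\<ge>0. \<forall>\<gamma>\<in>tvs_carrier (CkW k W1 U F).
      enn2real (p (\<lambda>(x, y). \<gamma> x y)) \<le> C * q \<gamma>"
    by (intro bexI[OF _ F.CkW_csn[OF U W1, of ?p]] exI[of _ 1]) auto
qed (auto simp: uncurry_in_CklW)

lemma continuous_curry:
  "continuous_map (tvs_topology (CklW k l (weights_tensor W1 W2) U V E)) (tvs_topology (CkW k W1 U F))
    (\<lambda>\<delta> x y. \<delta> (x, y))"
proof (subst F.CkW_topology[OF U W1], rule seminorm_family.continuous_linear_map_familyI[OF F.CkW_family[OF U W1]
      CklW_seminormed[OF U V W1 W2]])
  let ?H = "CklW k l (weights_tensor W1 W2) U V E"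
  fix p assume "p \<in> CkW_seminorms k W1 U F"
  then obtain f Q "is" where f: "f \<in> W1" and Q: "Q \<in> continuous_seminorms F"
    and "is": "admissible k is" and p: "p = (\<lambda>\<eta>. weighted_sup U f Q (iter_pderiv F U is \<eta>))"
    by (rule CkW_seminorms_cases)
  obtain A b C where A: "finite (A :: (('m rvec \<Rightarrow> 'e) \<Rightarrow> ennreal) set)"
    and b: "b ` A \<subseteq> CklW_seminorms k l (weights_tensor W1 W2) U V E" and C: "0 \<le> C"
    and dom: "\<And>\<gamma>. \<gamma> \<in> Ck k U F \<Longrightarrow> weighted_sup U f Q (iter_pderiv F U is \<gamma>) \<le>
      ennreal C * (\<Sum>a\<in>A. b a (\<lambda>(x, y). \<gamma> x y))"
    using weighted_sup_dominated[OF f Q "is"] by meson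
  have "enn2real (p (\<lambda>x y. \<delta> (x, y))) \<le> C * (\<Sum>a\<in>A. enn2real (b a \<delta>))" if \<delta>: "\<delta> \<in> tvs_carrier ?H" for \<delta>
  proof (rule enn2real_leI)
    have fin: "b a \<delta> = ennreal (enn2real (b a \<delta>))" if "a \<in> A" for a
      using delta_finite[OF \<delta>, of "b a"] b that by (auto simp: less_top[symmetric])
    have "p (\<lambda>x y. \<delta> (x, y)) \<le> ennreal C * (\<Sum>a\<in>A. b a \<delta>)"
      unfolding p using dom[OF curry_Ck[OF \<delta>]] by simp
    also have "(\<Sum>a\<in>A. b a \<delta>) = ennreal (\<Sum>a\<in>A. enn2real (b a \<delta>))"
      using fin by (simp add: sum_ennreal[symmetric] del: sum_ennreal cong: sum.cong)
    finally show "p (\<lambda>x y. \<delta> (x, y)) \<le> ennreal (C * (\<Sum>a\<in>A. enn2real (b a \<delta>)))"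
      using C by (simp add: ennreal_mult')
  qed (use C in \<open>simp add: sum_nonneg\<close>)
  moreover have "(\<lambda>\<delta>. \<Sum>a\<in>A. enn2real (b a \<delta>)) \<in> continuous_seminorms ?H"
    using b by (intro csn_sum A CklW_csn[OF U V W1 W2]) auto
  ultimately show "\<exists>q\<in>continuous_seminorms ?H. \<exists>C\<ge>0. \<forall>\<delta>\<in>tvs_carrier ?H.
      enn2real (p (\<lambda>x y. \<delta> (x, y))) \<le> C * q \<delta>"
    using C by (intro bexI exI[of _ C]) auto
qed (auto simp: curry_in_CkW fun_eq_iff)

lemma homeomorphic_uncurry:
  "homeomorphic_map (tvs_topology (CkW k W1 U F)) (tvs_topology (CklW k l (weights_tensor W1 W2) U V E))
    (\<lambda>\<gamma> (x, y). \<gamma> x y)"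
  unfolding homeomorphic_map_maps homeomorphic_maps_def
  using continuous_uncurry continuous_curry by (intro exI[of _ "\<lambda>\<delta> x y. \<delta> (x, y)"]) auto

lemma linear_uncurry:
  "Vector_Spaces.linear (tvs_scale (CkW k W1 U F)) (tvs_scale (CklW k l (weights_tensor W1 W2) U V E))
    (\<lambda>\<gamma> (x, y). \<gamma> x y)"
proof -
  have "vector_space (tvs_scale (CkW k W1 U F))"
    using F.CkW_seminormed[OF U W1] by (rule seminormed_tvs.axioms)
  moreover have "vector_space (tvs_scale (CklW k l (weights_tensor W1 W2) U V E))"
    using CklW_seminormed[OF U V W1 W2] by (rule seminormed_tvs.axioms)
  ultimately show ?thesis
    unfolding Vector_Spaces.linear_def module_hom_def module_iff_vector_space module_hom_axioms_def
    by (auto simp: CkW_def CklW_def fun_eq_iff)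
qed

end

lemma Ck_nonneg_continuous:
  assumes "f \<in> Ck_nonneg k U"
  shows "continuous_on U f"
proof -
  have "continuous_map (top_of_set U) (tvs_topology real_tvs) (iter_pderiv real_tvs U [] f)"
    using assms admissible_Nil[of k] unfolding Ck_nonneg_def Ck_iff_admissible by blast
  then show ?thesis by (simp add: real_tvs_def)
qed

theorem theorem3p37:
  fixes E :: "('k::real_normed_field, 'e::ab_group_add) tvs"
    and U :: "('n::{finite,linorder}) rvec set"
    and V :: "('m::{finite,linorder}) rvec set"
    and k l :: enat
    and W1 :: "('n rvec \<Rightarrow> real) set"
    and W2 :: "('m rvec \<Rightarrow> real) set"
  assumes "hausdorff_lcs E"
    and "open U" and "open V"
    and "W1 \<subseteq> Ck_nonneg k U" and "set_of_weights U W1" and "o_condition U W1"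
    and "\<And>f \<alpha>. f \<in> W1 \<Longrightarrow> enat (mi_order \<alpha>) \<le> k \<Longrightarrow>
           \<exists>g\<in>W1. \<forall>x\<in>U. \<bar>partial_deriv real_tvs U \<alpha> f x\<bar> \<le> g x"
    and "W2 \<subseteq> Ck_nonneg l V" and "set_of_weights V W2" and "o_condition V W2"
    and "\<And>f \<beta>. f \<in> W2 \<Longrightarrow> enat (mi_order \<beta>) \<le> l \<Longrightarrow>
           \<exists>g\<in>W2. \<forall>y\<in>V. \<bar>partial_deriv real_tvs V \<beta> f y\<bar> \<le> g y"
  shows "Vector_Spaces.linear
           (tvs_scale (CkW k W1 U (CkW l W2 V E)))
           (tvs_scale (CklW k l (weights_tensor W1 W2) U V E))
           (\<lambda>\<gamma> (x, y). \<gamma> x y) \<and>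
         homeomorphic_map
           (tvs_topology (CkW k W1 U (CkW l W2 V E)))
           (tvs_topology (CklW k l (weights_tensor W1 W2) U V E))
           (\<lambda>\<gamma> (x, y). \<gamma> x y)"
proof -
  interpret seminormed_tvs E by (rule hausdorff_lcs_imp_seminormed_tvs[OF assms(1)])
  interpret weighted_exponential E U V k l W1 W2
    using assms(2,3,4,5,8,9,10) by unfold_locales (auto intro: Ck_nonneg_continuous)
  show ?thesis using linear_uncurry homeomorphic_uncurry ..
qed

end
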